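(* Suppose the Boundedness, Link-function and Demand-shock assumptions stated in the context hold. Then for any sequence of covariates $x_1,\dots,x_T\in\mathcal X$, the regret $\mathrm{Reg}_T^{\pi}(x_1,\dots,x_T)$ of the UCB pricing algorithm (described in the context) run with regularization parameter $\lambda=1$ is at most $$4\bar g\,\bar p\,\bar\gamma\sqrt{T d\log\left(\frac{2d+T}{2d}\right)}+\bar p\bar D=\tilde O(d\sqrt T),$$ where $\bar\gamma=2\bar\theta+\frac{2\bar\sigma}{\underline g}\sqrt{2\log T+2d\log\left(\frac{2d+T}{2d}\right)}$ and $\tilde O$ hides logarithmic factors.
   Context: Model. For $t=1,\dots,T$ the seller observes $x_t\in\mathcal X\subset\mathbb R^d$, sets a price $p_t\in[\underline p,\bar p]$ with $0\le\underline p\le\bar p$, and observes the demand $D_t=g(x_t^\top\alpha^*+x_t^\top\beta^*\cdot p_t)+\epsilon_t$. Here $g:\mathbb R\to\mathbb R$ is known and $\theta^*=(\alpha^*,\beta^* )\in\mathbb R^{2d}$ is unknown. Put $z_t=(x_t,p_tx_t)\in\mathbb R^{2d}$. Boundedness. $\theta^*\in\Theta:=\{\theta\in\mathbb R^{2d}:\|\theta\|_2\le\bar\theta\}$ for some $\bar\theta>0$; $0\le g(x^\top\alpha^*+x^\top\beta^*p)\le\bar D$ and $\|(x,px)\|_2\le1$ for all $x\in\mathcal X$, $p\in[\underline p,\bar p]$. Link function. $g$ is strictly increasing and differentiable, and there are constants with $0<\underline g\le g'(z)\le\bar g<\infty$ for all $z=x^\top\alpha+x^\top\beta p$ with $x\in\mathcal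 X$, $(\alpha,\beta)\in\Theta$, $p\in[\underline p,\bar p]$. Demand shock. With $\mathcal H_t=\sigma(p_1,\dots,p_t,\epsilon_1,\dots,\epsilon_t,x_1,\dots,x_{t+1})$ and $\mathcal H_0$ trivial, $\mathbb E[\epsilon_t|\mathcal H_{t-1}]=0$ and $\log\mathbb E[e^{s\epsilon_t}|\mathcal H_{t-1}]\le\bar\sigma^2s^2/2$ for all $s\in\mathbb R$ and all $t$; $\bar\sigma$ is known. Revenue and regret. $r(p;a,b)=p\,g(a+bp)$ and $r^*(a,b)=\max_{p\in[\underline p,\bar p]}r(p;a,b)$; maximizers are assumed computable. For a (non-anticipating) policy $\pi$ producing prices $p_t$ from $x_1,\dots,x_t$, $D_1,\dots,D_{t-1}$, $p_1,\dots,p_{t-1}$ (and possibly independent randomization), $\mathrm{Reg}_T^\pi(x_1,\dots,x_T)=\sum_{t=1}^T r^*(x_t^\top\alpha^*,x_t^\top\beta^* )-\mathbb E[\sum_{t=1}^T p_tD_t]$, with expectation over the shocks and the policy's randomness. Estimator. $M_t=\lambda I_{2d}+\sum_{s=1}^tz_sz_s^\top$, $\|z\|_M=\sqrt{z^\top Mz}$. The quasi-likelihood is $l_t(\theta)=-\int_{D_t}^{g(z_t^\top\theta)}\frac{u-D_t}{h(u)}du$ with $h(u)=g'(g^{-1}(u))$ (up to a constant not depending on $\theta$, $l_t$ is the function with gradient $(D_t-g(z_t^\top\theta))z_t$). The estimator is $\hat\theta_t=\arg\max_{\theta\in\Theta}\{-\frac{\lambda\underline g}{2}\|\theta\|_2^2+\sum_{s=1}^tl_s(\theta)\}$.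 UCB pricing algorithm. At each $t$: compute $\hat\theta_{t-1}$ and the confidence set $\Theta_t=\{\theta\in\Theta:\|\theta-\hat\theta_{t-1}\|_{M_{t-1}}\le2\sqrt\lambda\bar\theta+\frac{2\bar\sigma}{\underline g}\sqrt{2\log T+2d\log(\frac{2d\lambda+T}{2d\lambda})}\}$; observe $x_t$; choose $(\alpha_t,\beta_t)\in\arg\max_{(\alpha,\beta)\in\Theta_t}r^*(x_t^\top\alpha,x_t^\top\beta)$; set $p_t\in\arg\max_{p\in[\underline p,\bar p]}r(p;x_t^\top\alpha_t,x_t^\top\beta_t)$. *)

theory Defs
  imports "HOL-Probability.Probability"
begin

(* A vector of R^(2d) has the index type 'd + 'd: the block alpha (resp. x) sits at Inl,
   the block beta (resp. p x) at Inr. *)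

definition vstack :: "real ^ 'd \<Rightarrow> real ^ 'd \<Rightarrow> real ^ ('d::finite + 'd)" where
  "vstack a b = (\<chi> i. case i of Inl j \<Rightarrow> a $ j | Inr j \<Rightarrow> b $ j)"

definition upper_block :: "real ^ ('d::finite + 'd) \<Rightarrow> real ^ 'd" where
  "upper_block \<theta> = (\<chi> j. \<theta> $ Inl j)"

definition lower_block :: "real ^ ('d::finite + 'd) \<Rightarrow> real ^ 'd" where
  "lower_block \<theta> = (\<chi> j. \<theta> $ Inr j)"

definition feature :: "real ^ 'd \<Rightarrow> real \<Rightarrow> real ^ ('d::finite + 'd)" where
  "feature x p = vstack x (p *\<^sub>R x)"

definition param_space :: "real \<Rightarrow> (real ^ ('d::finite + 'd)) set" where
  "param_space B = {\<theta>. norm \<theta> \<le> B}"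

definition revenue :: "(real \<Rightarrow> real) \<Rightarrow> real \<Rightarrow> real \<Rightarrow> real \<Rightarrow> real" where
  "revenue g p a b = p * g (a + b * p)"

(* The supremum is a maximum for continuous g, the price interval being compact. *)
definition opt_revenue :: "(real \<Rightarrow> real) \<Rightarrow> real \<Rightarrow> real \<Rightarrow> real \<Rightarrow> real \<Rightarrow> real" where
  "opt_revenue g pl pu a b = (SUP p\<in>{pl..pu}. revenue g p a b)"

definition design_matrix :: "real \<Rightarrow> (nat \<Rightarrow> real ^ 'n) \<Rightarrow> nat \<Rightarrow> real ^ 'n ^ 'n::finite" where
  "design_matrix lam z t = mat lam + (\<Sum>s=1..t. \<chi> i j. z s $ i * z s $ j)"

definition weighted_norm :: "real ^ 'n ^ 'n \<Rightarrow> real ^ 'n::finite \<Rightarrow> real" where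
  "weighted_norm A v = sqrt (v \<bullet> (A *v v))"

(* The quasi-likelihood is usually written with lower limit D instead of g 0.  The two differ
   by a constant that does not depend on \<theta>, but D carries an unbounded shock and may lie outside
   the range of g, where the integrand is undefined, while every u between g 0 and g (z \<bullet> \<theta>)
   is a value of g.  The interval integral is oriented. *)
definition quasi_loglik ::
  "(real \<Rightarrow> real) \<Rightarrow> real ^ 'n \<Rightarrow> real \<Rightarrow> real ^ 'n::finite \<Rightarrow> real" where
  "quasi_loglik g z D \<theta> =
     - (LINT u=ereal (g 0)..ereal (g (z \<bullet> \<theta>))|lebesgue. ((u - D) / deriv g (inv g u)))"

definition penalized_loglik ::
  "(real \<Rightarrow> real) \<Rightarrow> real \<Rightarrow> real \<Rightarrow> (nat \<Rightarrow> real ^ 'n) \<Rightarrow> (nat \<Rightarrow> real) \<Rightarrow> nat \<Rightarrow>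
   real ^ 'n::finite \<Rightarrow> real" where
  "penalized_loglik g glow lam z D t \<theta> =
     - (lam * glow / 2) * (norm \<theta>)\<^sup>2 + (\<Sum>s=1..t. quasi_loglik g (z s) (D s) \<theta>)"

definition conf_radius :: "real \<Rightarrow> real \<Rightarrow> real \<Rightarrow> real \<Rightarrow> nat \<Rightarrow> nat \<Rightarrow> real" where
  "conf_radius lam B sig glow d T =
     2 * sqrt lam * B + 2 * sig / glow *
       sqrt (2 * ln (real T) +
             2 * real d * ln ((2 * real d * lam + real T) / (2 * real d * lam)))"

definition conf_set ::
  "real \<Rightarrow> real \<Rightarrow> real \<Rightarrow> real \<Rightarrow> nat \<Rightarrow> (nat \<Rightarrow> real ^ ('d + 'd)) \<Rightarrow> nat \<Rightarrow>
   real ^ ('d + 'd) \<Rightarrow> (real ^ ('d::finite + 'd)) set" where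
  "conf_set lam B sig glow T z t \<theta>hat =
     {\<theta> \<in> param_space B.
        weighted_norm (design_matrix lam z (t - 1)) (\<theta> - \<theta>hat)
          \<le> conf_radius lam B sig glow CARD('d) T}"

(* One trajectory of the algorithm: \<theta>hat t is the estimator from the first t rounds, \<theta>opt t the
   optimistic parameter of round t.  Ties in the maximizations may be broken arbitrarily. *)
definition ucb_pricing_run ::
  "(real \<Rightarrow> real) \<Rightarrow> real \<Rightarrow> real \<Rightarrow> real \<Rightarrow> real \<Rightarrow> real \<Rightarrow> real \<Rightarrow> nat \<Rightarrow>
   (nat \<Rightarrow> real ^ 'd) \<Rightarrow> (nat \<Rightarrow> real) \<Rightarrow> (nat \<Rightarrow> real) \<Rightarrow>
   (nat \<Rightarrow> real ^ ('d + 'd)) \<Rightarrow> (nat \<Rightarrow> real ^ ('d::finite + 'd)) \<Rightarrow> bool" where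
  "ucb_pricing_run g pl pu glow B sig lam T x p D \<theta>hat \<theta>opt \<longleftrightarrow>
     (let z = (\<lambda>s. feature (x s) (p s)) in
      \<forall>t\<in>{1..T}.
        is_arg_max (penalized_loglik g glow lam z D (t - 1)) (\<lambda>\<theta>. \<theta> \<in> param_space B)
          (\<theta>hat (t - 1)) \<and>
        is_arg_max (\<lambda>\<theta>. opt_revenue g pl pu (x t \<bullet> upper_block \<theta>) (x t \<bullet> lower_block \<theta>))
          (\<lambda>\<theta>. \<theta> \<in> conf_set lam B sig glow T z t (\<theta>hat (t - 1))) (\<theta>opt t) \<and>
        is_arg_max (\<lambda>q. revenue g q (x t \<bullet> upper_block (\<theta>opt t)) (x t \<bullet> lower_block (\<theta>opt t)))
          (\<lambda>q. q \<in> {pl..pu}) (p t))"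

definition preimages :: "'w set \<Rightarrow> ('w \<Rightarrow> 'b) \<Rightarrow> 'b measure \<Rightarrow> 'w set set" where
  "preimages \<Omega> f N = {f -` B \<inter> \<Omega> | B. B \<in> sets N}"

(* The covariates are deterministic, so they add only trivial events here and below. *)
definition history_algebra ::
  "'w set \<Rightarrow> (nat \<Rightarrow> real ^ 'd) \<Rightarrow> (nat \<Rightarrow> 'w \<Rightarrow> real) \<Rightarrow> (nat \<Rightarrow> 'w \<Rightarrow> real) \<Rightarrow> nat \<Rightarrow> 'w measure"
  where
  "history_algebra \<Omega> x p \<epsilon> t =
     sigma \<Omega> ((\<Union>s\<in>{1..t}. preimages \<Omega> (p s) borel) \<union>
              (\<Union>s\<in>{1..t}. preimages \<Omega> (\<epsilon> s) borel) \<union>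
              (\<Union>s\<in>{1..t + 1}. preimages \<Omega> (\<lambda>_. x s) borel))"

(* What a non-anticipating policy with random seed U may use when it sets the price of round t. *)
definition policy_algebra ::
  "'w set \<Rightarrow> ('w \<Rightarrow> 'u) \<Rightarrow> 'u measure \<Rightarrow> (nat \<Rightarrow> real ^ 'd) \<Rightarrow> (nat \<Rightarrow> 'w \<Rightarrow> real) \<Rightarrow>
   (nat \<Rightarrow> 'w \<Rightarrow> real) \<Rightarrow> nat \<Rightarrow> 'w measure" where
  "policy_algebra \<Omega> U N x p D t =
     sigma \<Omega> (preimages \<Omega> U N \<union>
              (\<Union>s\<in>{1..t}. preimages \<Omega> (\<lambda>_. x s) borel) \<union>
              (\<Union>s\<in>{1..<t}. preimages \<Omega> (D s) borel) \<union>
              (\<Union>s\<in>{1..<t}. preimages \<Omega> (p s) borel))"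

definition regret ::
  "'w measure \<Rightarrow> (real \<Rightarrow> real) \<Rightarrow> real \<Rightarrow> real \<Rightarrow> real ^ 'd \<Rightarrow> real ^ 'd \<Rightarrow> nat \<Rightarrow>
   (nat \<Rightarrow> real ^ 'd::finite) \<Rightarrow> (nat \<Rightarrow> 'w \<Rightarrow> real) \<Rightarrow> (nat \<Rightarrow> 'w \<Rightarrow> real) \<Rightarrow> real" where
  "regret M g pl pu \<alpha> \<beta> T x p D =
     (\<Sum>t=1..T. opt_revenue g pl pu (x t \<bullet> \<alpha>) (x t \<bullet> \<beta>))
       - (\<integral>\<omega>. (\<Sum>t=1..T. p t \<omega> * D t \<omega>) \<partial>M)"

definition gamma_bar :: "real \<Rightarrow> real \<Rightarrow> real \<Rightarrow> nat \<Rightarrow> nat \<Rightarrow> real" where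
  "gamma_bar B sig glow d T =
     2 * B + 2 * sig / glow *
       sqrt (2 * ln (real T) + 2 * real d * ln ((2 * real d + real T) / (2 * real d)))"

definition regret_bound ::
  "real \<Rightarrow> real \<Rightarrow> real \<Rightarrow> real \<Rightarrow> real \<Rightarrow> real \<Rightarrow> nat \<Rightarrow> nat \<Rightarrow> real" where
  "regret_bound gup glow pu Dbar B sig d T =
     4 * gup * pu * gamma_bar B sig glow d T *
       sqrt (real T * real d * ln ((2 * real d + real T) / (2 * real d))) + pu * Dbar"

end

theory Submission
  imports Defs
begin

text \<open>
  With \<open>S\<^sub>t\<close> the sum of \<open>\<epsilon>\<^sub>s z\<^sub>s\<close> over \<open>s \<le> t\<close>, the process
  \<open>W\<^sub>t = exp (S\<^sub>t M\<^sub>t\<^sup>-\<^sup>1 S\<^sub>t / (2 \<sigma>\<^sup>2)) / sqrt (det M\<^sub>t)\<close> is a supermartingale: by Sherman--Morrison its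
  one-step ratio depends only on two predictable scalars, and it is a one-dimensional Gaussian mixture
  of the factors \<open>exp (y \<epsilon> - \<sigma>\<^sup>2 y\<^sup>2 / 2)\<close>. The maximal inequality at level \<open>T\<close> therefore bounds
  \<open>S\<^sub>t\<close> for all \<open>t\<close> simultaneously outside an event of probability at most \<open>1 / T\<close>. Since the
  quasi-likelihood is strongly concave in \<open>z \<theta>\<close>, the true parameter then lies in every confidence set.
  Optimism and the Lipschitz bound on \<open>g\<close> reduce the regret of a round to the leverage of its feature,
  and Cauchy--Schwarz with the elliptical potential bound sums these. The exceptional event costs at
  most one round's worth of revenue on average.
\<close>

section \<open>Design matrices and the elliptical potential\<close>

text \<open>Two features of the model shape the argument. The shocks are sub-Gaussian given a
  history that need not contain the seed of the policy, while the next feature may depend on that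
  seed. The martingale argument therefore runs along the sigma-algebras generated by the seed and
  the past shocks; the sub-Gaussian bound is carried over to them by independence of the seed from
  the vector of all shocks. Moreover, \<open>\<theta>hat\<close> and \<open>\<theta>opt\<close> are
  arbitrary maximizers and need not be measurable. Hence the exceptional event is built from prices
  and shocks only, and everything about estimators and confidence sets is proved trajectory by
  trajectory.

  Conditional bounds take the form of inequalities between nonnegative integrals with measurable
  multipliers, so the exponential process needs no integrability proof.

  The failure probability \<open>1 / T\<close> is the source of \<open>2 * ln T\<close> in the
  radius. The other logarithm bounds the determinant of a matrix of size 2d with trace at most 2d +
  T.\<close>

lemma outer_mult_vec:
  fixes a b x :: "real ^ 'n::finite"
  shows "(\<chi> i j. a $ i * b $ j) *v x = (b \<bullet> x) *\<^sub>R a"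
  by (simp add: vec_eq_iff matrix_vector_mult_def inner_vec_def sum_distrib_left sum_distrib_right ac_simps)

lemma matrix_mult_add_left: "(A + B) ** C = A ** C + B ** C" for A B :: "'a::semiring_1 ^ 'n ^ 'm"
  by (simp add: vec_eq_iff matrix_matrix_mult_def sum.distrib algebra_simps)

text \<open>The determinant is additive in each row, so the multiples of \<open>z\<close> can be
  added to the rows of the identity one at a time; \<open>R S\<close> is the stage at which the rows
  in \<open>S\<close> have been changed.\<close>

lemma det_identity_plus_outer:
  fixes w z :: "real ^ 'n::finite"
  shows "det (mat 1 + (\<chi> i j. w $ i * z $ j)) = 1 + w \<bullet> z"
proof -
  define R where "R S i = axis i 1 + (if i \<in> S then w $ i else 0) *s z" for S :: "'n set" and i
  \<comment> \<open>Once row \<open>k\<close> is \<open>z\<close>, the multiples of \<open>z\<close>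
    in the other rows disappear by row operations, and Cramer's rule evaluates the remaining
    determinant.\<close>
  have row_z: "det (\<chi> i. if i = k then z else R S i) = z $ k"
    if "finite S" "k \<notin> S" for S :: "'n set" and k
    using that
  proof (induction S rule: finite_induct)
    case empty
    have row: "row i (mat 1) = R {} i" for i :: 'n
      by (auto simp: vec_eq_iff row_def mat_def R_def axis_def)
    have "(\<Sum>i\<in>UNIV. z $ i *s R {} i) = z"
      by (simp add: vec_eq_iff R_def axis_def if_distrib[of "(*) _"] cong: if_cong)
    then show ?case
      using cramer_lemma_transpose[of k z "mat 1"] by (simp add: row cong: if_cong)
  next
    case (insert j S)
    let ?A = "(\<chi> i. if i = k then z else R S i) :: real ^ 'n ^ 'n"
    from insert have "j \<noteq> k" by auto
    have "(\<chi> i. if i = k then z else R (insert j S) i)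
      = (\<chi> i. if i = j then row j ?A + w $ j *s row k ?A else row i ?A)"
      using insert.hyps \<open>j \<noteq> k\<close> by (auto simp: vec_eq_iff row_def R_def)
    then show ?case
      using det_row_operation[OF \<open>j \<noteq> k\<close>, of ?A "w $ j"] insert by simp
  qed
  have "det (\<chi> i. R S i) = 1 + (\<Sum>i\<in>S. w $ i * z $ i)" if "finite S" for S
    using that
  proof (induction S rule: finite_induct)
    case empty
    have "(\<chi> i. R {} i) = mat 1"
      by (auto simp: vec_eq_iff R_def mat_def axis_def)
    then show ?case by simp
  next
    case (insert k S)
    have "(\<chi> i. R (insert k S) i) = (\<chi> i. if i = k then R S k + w $ k *s z else R S i)"
      using insert.hyps by (auto simp: vec_eq_iff R_def)
    then have "det (\<chi> i. R (insert k S) i)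
      = det (\<chi> i. if i = k then R S k else R S i) + det (\<chi> i. if i = k then w $ k *s z else R S i)"
      using det_row_add[of k "\<lambda>_. R S k" "\<lambda>_. w $ k *s z" "R S"] by simp
    also have "(\<chi> i. if i = k then R S k else R S i) = (\<chi> i. R S i)"
      by (auto simp: vec_eq_iff)
    also have "det (\<chi> i. if i = k then w $ k *s z else R S i) = w $ k * z $ k"
      using det_row_mul[of k "w $ k" "\<lambda>_. z" "R S"] row_z[OF insert.hyps] by simp
    finally show ?case using insert by simp
  qed
  from this[of UNIV] have "det (\<chi> i. R UNIV i) = 1 + w \<bullet> z"
    by (simp add: inner_vec_def)
  moreover have "(\<chi> i. R UNIV i) = mat 1 + (\<chi> i j. w $ i * z $ j)"
    by (auto simp: vec_eq_iff R_def mat_def axis_def)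
  ultimately show ?thesis by simp
qed

section \<open>Positive definite matrices and Hadamard's inequality\<close>

lemma transpose_eq_entry:
  assumes "transpose A = A"
  shows "A $ k $ l = A $ l $ k"
  using arg_cong[OF assms, of "\<lambda>B. B $ k $ l"] by (simp add: transpose_def)

lemma symmetric_inner:
  fixes A :: "real ^ 'n ^ 'n::finite"
  assumes "transpose A = A"
  shows "x \<bullet> (A *v y) = (A *v x) \<bullet> y"
  using dot_lmul_matrix[of x A y] assms
  by (metis transpose_matrix_vector)

lemma psd_Cauchy_Schwarz:
  fixes A :: "real ^ 'n ^ 'n::finite"
  assumes sym: "transpose A = A" and psd: "\<And>x. 0 \<le> x \<bullet> (A *v x)"
  shows "(x \<bullet> (A *v y))\<^sup>2 \<le> (x \<bullet> (A *v x)) * (y \<bullet> (A *v y))"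
proof -
  define a b c where "a = x \<bullet> (A *v x)" and "b = x \<bullet> (A *v y)" and "c = y \<bullet> (A *v y)"
  have yx: "y \<bullet> (A *v x) = b"
    using symmetric_inner[OF sym, of y x] by (simp add: b_def inner_commute)
  have q: "0 \<le> a + 2 * r * b + r\<^sup>2 * c" for r
  proof -
    have "(x + r *\<^sub>R y) \<bullet> (A *v (x + r *\<^sub>R y)) = a + 2 * r * b + r\<^sup>2 * c"
      using yx by (simp add: a_def b_def c_def matrix_vector_mult_scaleR power2_eq_square algebra_simps)
    then show ?thesis using psd[of "x + r *\<^sub>R y"] by simp
  qed
  have "c \<ge> 0" "a \<ge> 0" using psd by (auto simp: a_def c_def)
  have "b\<^sup>2 \<le> a * c"
  proof (cases "c = 0")
    case True
    have "b = 0"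
    proof (rule ccontr)
      assume "b \<noteq> 0"
      \<comment> \<open>For \<open>c = 0\<close> the quadratic is affine in \<open>r\<close>, and
        this choice of \<open>r\<close> makes it -1.\<close>
      with q[of "- (a + 1) / (2 * b)"] True show False by (simp add: field_simps)
    qed
    with True show ?thesis by simp
  next
    case False
    with \<open>c \<ge> 0\<close> have "c > 0" by simp
    have "0 \<le> c * (a + 2 * (- b / c) * b + (- b / c)\<^sup>2 * c)"
      using q[of "- b / c"] \<open>c > 0\<close> by (intro mult_nonneg_nonneg) auto
    also have "\<dots> = a * c - b\<^sup>2"
      using \<open>c > 0\<close> by (simp add: field_simps power2_eq_square)
    finally show ?thesis by simp
  qed
  then show ?thesis by (simp add: a_def b_def c_def)
qed

text \<open>The pinching of \<open>A\<close> along the splitting of the coordinates into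
  \<open>i\<close> and the rest. Repeated over all indices it leaves only the diagonal of
  \<open>A\<close>.\<close>

definition isolate :: "'n \<Rightarrow> real ^ 'n ^ 'n \<Rightarrow> real ^ 'n ^ 'n::finite" where
  "isolate i A = (\<chi> k l. if k = l \<or> (k \<noteq> i \<and> l \<noteq> i) then A $ k $ l else 0)"

lemma isolate_quadratic_form:
  fixes A :: "real ^ 'n ^ 'n::finite"
  shows "x \<bullet> (isolate i A *v x)
    = A $ i $ i * (x $ i)\<^sup>2 + (x - x $ i *\<^sub>R axis i 1) \<bullet> (A *v (x - x $ i *\<^sub>R axis i 1))"
proof -
  let ?y = "x - x $ i *\<^sub>R axis i 1"
  have y: "?y $ k = (if k = i then 0 else x $ k)" for k
    by (auto simp: axis_def)
  have "x \<bullet> (isolate i A *v x) = (\<Sum>k\<in>UNIV. \<Sum>l\<in>UNIV. x $ k * isolate i A $ k $ l * x $ l)"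
    by (simp add: inner_vec_def matrix_vector_mult_def sum_distrib_left ac_simps)
  also have "\<dots> = (\<Sum>k\<in>UNIV. \<Sum>l\<in>UNIV. (if k = i then if l = i then A $ i $ i * (x $ i)\<^sup>2 else 0 else 0)
       + ?y $ k * A $ k $ l * ?y $ l)"
    unfolding y by (intro sum.cong refl) (auto simp: isolate_def power2_eq_square)
  also have "\<dots> = A $ i $ i * (x $ i)\<^sup>2 + (\<Sum>k\<in>UNIV. \<Sum>l\<in>UNIV. ?y $ k * A $ k $ l * ?y $ l)"
    by (simp add: sum.distrib if_distrib[of "sum _"] sum.If_cases)
  also have "(\<Sum>k\<in>UNIV. \<Sum>l\<in>UNIV. ?y $ k * A $ k $ l * ?y $ l) = ?y \<bullet> (A *v ?y)"
    by (simp add: inner_vec_def matrix_vector_mult_def sum_distrib_left ac_simps)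
  finally show ?thesis .
qed

lemma pd_diag_pos:
  fixes A :: "real ^ 'n ^ 'n::finite"
  assumes "\<And>x. x \<noteq> 0 \<Longrightarrow> 0 < x \<bullet> (A *v x)"
  shows "0 < A $ i $ i"
proof -
  have "axis i 1 \<bullet> (A *v axis i 1) = A $ i $ i"
    by (simp add: inner_axis' matrix_vector_mult_basis column_def)
  then show ?thesis using assms[of "axis i 1"] by simp
qed

lemma isolate_pd:
  fixes A :: "real ^ 'n ^ 'n::finite"
  assumes "transpose A = A" "\<And>x. x \<noteq> 0 \<Longrightarrow> 0 < x \<bullet> (A *v x)"
  shows "transpose (isolate i A) = isolate i A"
    and "x \<noteq> 0 \<Longrightarrow> 0 < x \<bullet> (isolate i A *v x)"
proof -
  have "A $ k $ l = A $ l $ k" for k l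
    using assms(1) by (rule transpose_eq_entry)
  then show "transpose (isolate i A) = isolate i A"
    by (auto simp: vec_eq_iff transpose_def isolate_def)
next
  assume "x \<noteq> 0"
  have nn: "0 \<le> y \<bullet> (A *v y)" for y
    using assms(2)[of y] by (cases "y = 0") auto
  have "0 < A $ i $ i" using pd_diag_pos[OF assms(2)] .
  show "0 < x \<bullet> (isolate i A *v x)"
  proof (cases "x $ i = 0")
    case True
    then show ?thesis using assms(2)[OF \<open>x \<noteq> 0\<close>] by (simp add: isolate_quadratic_form)
  next
    case False
    then show ?thesis unfolding isolate_quadratic_form
      using nn \<open>0 < A $ i $ i\<close> by (simp add: add_pos_nonneg)
  qed
qed

text \<open>If \<open>A v = e\<^sub>i\<close>, replacing row \<open>i\<close> by \<open>e\<^sub>i\<close> gives the minor \<open>m = v\<^sub>i det A\<close>, while the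
  isolated matrix has determinant \<open>A\<^sub>i\<^sub>i m\<close>; Cauchy--Schwarz gives \<open>1 \<le> A\<^sub>i\<^sub>i v\<^sub>i\<close>.\<close>

lemma det_le_det_isolate:
  fixes A :: "real ^ 'n ^ 'n::finite"
  assumes sym: "transpose A = A" and pd: "\<And>x. x \<noteq> 0 \<Longrightarrow> 0 < x \<bullet> (A *v x)"
    and det: "0 < det A"
  shows "det A \<le> det (isolate i A)"
proof -
  obtain v where v: "A *v v = axis i 1"
    using iffD2[OF cramer refl, of A "axis i 1"] det by auto
  have Aij: "A $ k $ l = A $ l $ k" for k l
    using sym by (rule transpose_eq_entry)
  define N where "N = (\<chi> k. if k = i then axis i 1 else row k (isolate i A))"
  have "(\<Sum>j\<in>UNIV. v $ j *s row j A) = axis i 1"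
  proof -
    have "(\<Sum>j\<in>UNIV. v $ j *s row j A) = A *v v"
      by (simp add: vec_eq_iff matrix_vector_mult_def row_def Aij mult.commute)
    then show ?thesis using v by simp
  qed
  then have m: "det (\<chi> k. if k = i then axis i 1 else row k A) = v $ i * det A"
    using cramer_lemma_transpose[of i v A] by (simp cong: if_cong)
  \<comment> \<open>Column \<open>i\<close> of \<open>A\<close> without its diagonal entry.
    Multiplying \<open>N\<close> from the left by the identity plus the outer product of
    \<open>w\<close> and the \<open>i\<close>-th unit vector restores this column; as
    \<open>w $ i = 0\<close>, this factor has determinant 1.\<close>
  define w where "w = (\<chi> k. if k = i then 0 else A $ k $ i)"
  have "(\<chi> k. if k = i then axis i 1 else row k A) = (mat 1 + (\<chi> k l. w $ k * axis i 1 $ l)) ** N"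
  proof -
    have "(\<chi> k l. w $ k * axis i 1 $ l) ** N = (\<chi> k l. w $ k * N $ i $ l)"
      by (simp add: vec_eq_iff matrix_matrix_mult_def axis_def if_distrib[of "(*) _"]
          if_distrib[of "\<lambda>x. x * _"] cong: if_cong)
    then show ?thesis
      by (auto simp: matrix_mult_add_left vec_eq_iff w_def N_def row_def isolate_def axis_def)
  qed
  moreover have "w \<bullet> axis i 1 = 0"
    by (simp add: inner_axis w_def)
  ultimately have "det N = v $ i * det A"
    using m by (simp add: det_mul det_identity_plus_outer)
  moreover have "det (isolate i A) = A $ i $ i * det N"
  proof -
    have "isolate i A = (\<chi> k. if k = i then A $ i $ i *s axis i 1 else row k (isolate i A))"
      by (auto simp: vec_eq_iff row_def isolate_def axis_def)
    then show ?thesis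
      using det_row_mul[of i "A $ i $ i" "\<lambda>_. axis i 1" "\<lambda>k. row k (isolate i A)"]
      by (simp add: N_def)
  qed
  moreover have "1 \<le> A $ i $ i * v $ i"
  proof -
    have nn: "0 \<le> y \<bullet> (A *v y)" for y
      using pd[of y] by (cases "y = 0") auto
    have "axis i 1 \<bullet> (A *v v) = 1" "v \<bullet> (A *v v) = v $ i" "axis i 1 \<bullet> (A *v axis i 1) = A $ i $ i"
      by (simp_all add: v inner_axis inner_axis' matrix_vector_mult_basis column_def)
    then show ?thesis
      using psd_Cauchy_Schwarz[OF sym nn, of "axis i 1" v] by simp
  qed
  ultimately show ?thesis
    using det by (simp add: mult.assoc[symmetric])
qed

text \<open>Pinching at one index after another keeps the matrix positive definite, keeps its
  diagonal and never lowers the determinant; at the end the matrix is diagonal. For design matrices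
  the hypothesis \<open>0 < det A\<close> is supplied by the product formula
  \<open>det_design_matrix\<close>.\<close>

lemma Hadamard_inequality:
  fixes A :: "real ^ 'n ^ 'n::finite"
  assumes sym: "transpose A = A" and pd: "\<And>x. x \<noteq> 0 \<Longrightarrow> 0 < x \<bullet> (A *v x)"
    and det: "0 < det A"
  shows "det A \<le> (\<Prod>i\<in>UNIV. A $ i $ i)"
proof -
  have "\<exists>C. transpose C = C \<and> (\<forall>x. x \<noteq> 0 \<longrightarrow> 0 < x \<bullet> (C *v x)) \<and> det A \<le> det C
      \<and> (\<forall>i. C $ i $ i = A $ i $ i) \<and> (\<forall>i\<in>S. \<forall>j. i \<noteq> j \<longrightarrow> C $ i $ j = 0)"
    if "finite S" for S :: "'n set"
    using that
  proof (induction S rule: finite_induct)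
    case empty
    show ?case using sym pd by (intro exI[of _ A]) auto
  next
    case (insert k S)
    then obtain C where C: "transpose C = C" "\<forall>x. x \<noteq> 0 \<longrightarrow> 0 < x \<bullet> (C *v x)" "det A \<le> det C"
      "\<forall>i. C $ i $ i = A $ i $ i" "\<forall>i\<in>S. \<forall>j. i \<noteq> j \<longrightarrow> C $ i $ j = 0"
      by blast
    have "det C \<le> det (isolate k C)"
      using C det by (intro det_le_det_isolate) auto
    then show ?case
      using C isolate_pd[OF C(1)] by (intro exI[of _ "isolate k C"]) (auto simp: isolate_def)
  qed
  from this[of UNIV] obtain C :: "real ^ 'n ^ 'n"
    where C: "det A \<le> det C" "\<forall>i. C $ i $ i = A $ i $ i" "\<forall>i j. i \<noteq> j \<longrightarrow> C $ i $ j = 0"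
    by auto
  then show ?thesis using det_diagonal[of C] by simp
qed

text \<open>Hadamard's inequality followed by the inequality of arithmetic and geometric means for
  the diagonal entries; no eigenvalues are involved.\<close>

lemma det_le_trace_power:
  fixes A :: "real ^ 'n ^ 'n::finite"
  assumes sym: "transpose A = A" and pd: "\<And>x. x \<noteq> 0 \<Longrightarrow> 0 < x \<bullet> (A *v x)"
    and det: "0 < det A"
  shows "det A \<le> (trace A / CARD('n)) ^ CARD('n)"
proof -
  have d: "0 \<le> A $ i $ i" for i
    using pd_diag_pos[OF pd] by (simp add: less_imp_le)
  let ?P = "\<Prod>i\<in>UNIV. A $ i $ i"
  have "root CARD('n) ?P \<le> trace A / CARD('n)"
    using arith_geom_mean[of UNIV "\<lambda>i. A $ i $ i"] d by (simp add: trace_def sum_divide_distrib root_powr_inverse prod_nonneg)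
  then have "root CARD('n) ?P ^ CARD('n) \<le> (trace A / CARD('n)) ^ CARD('n)"
    by (intro power_mono) (auto intro!: prod_nonneg d)
  moreover have "root CARD('n) ?P ^ CARD('n) = ?P"
    by (intro real_root_pow_pos2) (auto intro!: prod_nonneg d)
  ultimately show ?thesis
    using Hadamard_inequality[OF sym pd det] by linarith
qed

section \<open>Design matrices: inverse, leverage and determinant\<close>

lemma design_matrix_0 [simp]: "design_matrix lam z 0 = mat lam"
  by (simp add: design_matrix_def)

lemma design_matrix_Suc:
  "design_matrix lam z (Suc t) = design_matrix lam z t + (\<chi> i j. z (Suc t) $ i * z (Suc t) $ j)"
  by (simp add: design_matrix_def add.assoc)

lemma design_matrix_transpose: "transpose (design_matrix lam z t) = design_matrix lam z t"
proof -
  have "design_matrix lam z t $ i $ j = design_matrix lam z t $ j $ i" for i j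
    by (induction t) (auto simp: design_matrix_Suc mat_def)
  then show ?thesis by (simp add: vec_eq_iff transpose_def)
qed

lemma mat_mult_vec:
  fixes x :: "real ^ 'n::finite"
  shows "mat c *v x = c *\<^sub>R x"
  by (simp add: vec_eq_iff matrix_vector_mult_def mat_def if_distrib[of "\<lambda>a. a * _"] cong: if_cong)

lemma design_matrix_mult_Suc:
  "design_matrix lam z (Suc t) *v x = design_matrix lam z t *v x + (z (Suc t) \<bullet> x) *\<^sub>R z (Suc t)"
  by (simp add: design_matrix_Suc matrix_vector_mult_add_rdistrib outer_mult_vec)

lemma design_quadratic_form:
  "x \<bullet> (design_matrix lam z t *v x) = lam * (norm x)\<^sup>2 + (\<Sum>s=1..t. (z s \<bullet> x)\<^sup>2)"
  by (induction t) (auto simp: design_matrix_mult_Suc inner_add_right dot_square_norm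
      mat_mult_vec power2_eq_square inner_commute)

lemma design_matrix_psd: "0 \<le> lam \<Longrightarrow> 0 \<le> x \<bullet> (design_matrix lam z t *v x)"
  by (simp add: design_quadratic_form sum_nonneg)

lemma trace_design_matrix:
  fixes z :: "nat \<Rightarrow> real ^ 'n::finite"
  shows "trace (design_matrix 1 z t) = real CARD('n) + (\<Sum>s=1..t. (norm (z s))\<^sup>2)"
proof (induction t)
  case (Suc t)
  have "trace (\<chi> i j. z (Suc t) $ i * z (Suc t) $ j) = (norm (z (Suc t)))\<^sup>2"
    unfolding power2_norm_eq_inner by (simp add: trace_def inner_vec_def)
  with Suc show ?case by (simp add: design_matrix_Suc trace_add)
qed (simp add: trace_I)

text \<open>The Sherman--Morrison recursion keeps the inverse an explicit rational function of the
  features, so that measurability is immediate.\<close>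

primrec design_inverse :: "(nat \<Rightarrow> real ^ 'n) \<Rightarrow> nat \<Rightarrow> real ^ 'n ^ 'n::finite" where
  "design_inverse z 0 = mat 1"
| "design_inverse z (Suc t) = design_inverse z t -
     (\<chi> i j. (design_inverse z t *v z (Suc t)) $ i * (design_inverse z t *v z (Suc t)) $ j
       / (1 + z (Suc t) \<bullet> (design_inverse z t *v z (Suc t))))"

text \<open>The squared norm of \<open>v\<close> in the inverse of the design matrix with
  regularization 1. It serves at a new feature, at the noise sum, where it is the self-normalized
  deviation, and at the true parameter.\<close>

definition leverage :: "(nat \<Rightarrow> real ^ 'n) \<Rightarrow> nat \<Rightarrow> real ^ 'n::finite \<Rightarrow> real" where
  "leverage z t v = v \<bullet> (design_inverse z t *v v)"

lemma design_inverse_transpose: "transpose (design_inverse z t) = design_inverse z t"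
proof -
  have "design_inverse z t $ i $ j = design_inverse z t $ j $ i" for i j
    by (induction t arbitrary: i j) (auto simp: mat_def mult.commute)
  then show ?thesis by (simp add: vec_eq_iff transpose_def)
qed

lemma design_inverse_mult_Suc:
  "design_inverse z (Suc t) *v x = design_inverse z t *v x
    - (z (Suc t) \<bullet> (design_inverse z t *v x) / (1 + leverage z t (z (Suc t))))
      *\<^sub>R (design_inverse z t *v z (Suc t))"
proof -
  define v c where "v = design_inverse z t *v z (Suc t)" and "c = 1 + leverage z t (z (Suc t))"
  have "(\<chi> i j. v $ i * v $ j / c) = (\<chi> i j. v $ i * ((1 / c) *\<^sub>R v) $ j)"
    by (simp add: vec_eq_iff)
  then have "(\<chi> i j. v $ i * v $ j / c) *v x = (v \<bullet> x / c) *\<^sub>R v"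
    using outer_mult_vec[of v "(1 / c) *\<^sub>R v" x] by simp
  moreover have "v \<bullet> x = z (Suc t) \<bullet> (design_inverse z t *v x)"
    unfolding v_def using symmetric_inner[OF design_inverse_transpose] by metis
  ultimately show ?thesis
    by (simp add: matrix_vector_mult_diff_rdistrib v_def c_def leverage_def)
qed

text \<open>The two claims need a joint induction: the recursion divides by one plus a leverage,
  which is nonzero by the second claim for \<open>t\<close>, and the second claim for
  \<open>Suc t\<close> rewrites the leverage of \<open>x\<close> as the form of the design matrix at
  the image of \<open>x\<close> under the new inverse.\<close>

lemma design_matrix_inverse:
  "design_matrix 1 z t *v (design_inverse z t *v x) = x"
  and leverage_nonneg: "0 \<le> leverage z t x"
proof (induction t arbitrary: x)
  case 0
  {
    case 1
    show ?case by simp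
  next
    case 2
    show ?case by (simp add: leverage_def)
  }
next
  case (Suc t)
  define w c where "w = z (Suc t)" and "c = 1 + leverage z t w"
  have c: "c \<noteq> 0" using Suc(2)[of w] by (simp add: c_def)
  have inv: "design_matrix 1 z (Suc t) *v (design_inverse z (Suc t) *v x) = x" for x
  proof -
    define b where "b = w \<bullet> (design_inverse z t *v x)"
    have "design_matrix 1 z (Suc t) *v (design_inverse z (Suc t) *v x)
      = design_matrix 1 z t *v (design_inverse z t *v x) - (b / c) *\<^sub>R (design_matrix 1 z t *v (design_inverse z t *v w))
        + (b - (b / c) * leverage z t w) *\<^sub>R w"
      unfolding design_matrix_mult_Suc design_inverse_mult_Suc
      by (simp add: w_def[symmetric] c_def[symmetric] b_def[symmetric] matrix_vector_mult_diff_distrib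
          matrix_vector_mult_scaleR inner_diff_right leverage_def[symmetric])
    also have "\<dots> = x + (b - b / c * c) *\<^sub>R w"
      using Suc(1) by (simp add: c_def algebra_simps add_divide_distrib)
    also have "\<dots> = x" using c by simp
    finally show ?thesis .
  qed
  {
    case 1
    show ?case by (rule inv)
  next
    case 2
    let ?y = "design_inverse z (Suc t) *v x"
    have "leverage z (Suc t) x = ?y \<bullet> (design_matrix 1 z (Suc t) *v ?y)"
      by (simp only: inv leverage_def inner_commute)
    then show ?case using design_matrix_psd[of 1] by simp
  }
qed

text \<open>Duality of the norms of a matrix and its inverse: Cauchy--Schwarz for the form of the
  design matrix, applied to \<open>x\<close> and the preimage of \<open>v\<close>.\<close>

lemma design_Cauchy_Schwarz:
  "\<bar>v \<bullet> x\<bar> \<le> sqrt (leverage z t v) * weighted_norm (design_matrix 1 z t) x"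
proof -
  let ?A = "design_matrix 1 z t" and ?y = "design_inverse z t *v v"
  have "(x \<bullet> (?A *v ?y))\<^sup>2 \<le> (x \<bullet> (?A *v x)) * (?y \<bullet> (?A *v ?y))"
    by (intro psd_Cauchy_Schwarz design_matrix_transpose design_matrix_psd) simp
  then have "(v \<bullet> x)\<^sup>2 \<le> leverage z t v * (x \<bullet> (?A *v x))"
    by (simp add: design_matrix_inverse leverage_def inner_commute mult.commute)
  then have "sqrt ((v \<bullet> x)\<^sup>2) \<le> sqrt (leverage z t v * (x \<bullet> (?A *v x)))"
    by (rule real_sqrt_le_mono)
  then show ?thesis by (simp add: real_sqrt_mult weighted_norm_def)
qed

lemma leverage_Suc:
  "leverage z (Suc t) v = leverage z t v
    - (z (Suc t) \<bullet> (design_inverse z t *v v))\<^sup>2 / (1 + leverage z t (z (Suc t)))"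
proof -
  have "v \<bullet> (design_inverse z t *v z (Suc t)) = z (Suc t) \<bullet> (design_inverse z t *v v)"
    using symmetric_inner[OF design_inverse_transpose] by (metis inner_commute)
  then show ?thesis
    by (simp add: leverage_def[of z "Suc t"] design_inverse_mult_Suc inner_diff_right power2_eq_square
        leverage_def[of z t v] del: design_inverse.simps)
qed

text \<open>Each new feature subtracts a nonnegative amount from the leverage, which starts at the
  squared Euclidean norm because the initial matrix is the identity.\<close>

lemma leverage_le_norm: "leverage z t v \<le> (norm v)\<^sup>2"
proof (induction t)
  case (Suc t)
  have "0 \<le> (z (Suc t) \<bullet> (design_inverse z t *v v))\<^sup>2 / (1 + leverage z t (z (Suc t)))"
    using leverage_nonneg[of z t] by (intro divide_nonneg_nonneg) (auto simp: add_nonneg_nonneg)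
  then show ?case using Suc by (simp add: leverage_Suc)
qed (simp add: leverage_def power2_norm_eq_inner)

lemma leverage_add:
  "leverage z t (v + e *\<^sub>R w) = leverage z t v + 2 * e * (w \<bullet> (design_inverse z t *v v)) + e\<^sup>2 * leverage z t w"
proof -
  have "v \<bullet> (design_inverse z t *v w) = w \<bullet> (design_inverse z t *v v)"
    using symmetric_inner[OF design_inverse_transpose] by (metis inner_commute)
  then show ?thesis
    by (simp add: leverage_def algebra_simps matrix_vector_mult_scaleR power2_eq_square)
qed

text \<open>Factoring out the old matrix leaves the identity plus an outer product, whose
  determinant is one plus the leverage of the new feature.\<close>

lemma det_design_matrix: "det (design_matrix 1 z t) = (\<Prod>s<t. 1 + leverage z s (z (Suc s)))"
proof (induction t)
  case (Suc t)
  define w where "w = design_inverse z t *v z (Suc t)"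
  have "design_matrix 1 z (Suc t) = design_matrix 1 z t ** (mat 1 + (\<chi> i j. w $ i * z (Suc t) $ j))"
  proof -
    have "design_matrix 1 z t ** (\<chi> i j. w $ i * z (Suc t) $ j)
      = (\<chi> i j. (design_matrix 1 z t *v w) $ i * z (Suc t) $ j)"
      by (simp add: vec_eq_iff matrix_matrix_mult_def matrix_vector_mult_def sum_distrib_right mult.assoc)
    then show ?thesis
      by (simp add: design_matrix_Suc matrix_add_ldistrib w_def design_matrix_inverse)
  qed
  then show ?case
    using Suc by (simp add: det_mul det_identity_plus_outer w_def leverage_def inner_commute)
qed simp

lemma det_design_matrix_ge_1: "1 \<le> det (design_matrix 1 z t)"
  unfolding det_design_matrix using leverage_nonneg by (intro prod_ge_1) simp

lemma ln_det_design_matrix_le: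
  fixes z :: "nat \<Rightarrow> real ^ 'n::finite"
  assumes "\<And>s. s \<in> {1..t} \<Longrightarrow> norm (z s) \<le> 1"
  shows "ln (det (design_matrix 1 z t)) \<le> CARD('n) * ln ((CARD('n) + real t) / CARD('n))"
proof -
  let ?A = "design_matrix 1 z t" and ?n = "CARD('n)"
  have pos: "0 < det ?A" using det_design_matrix_ge_1[of z t] by simp
  have pd: "0 < x \<bullet> (?A *v x)" if "x \<noteq> 0" for x
    using that by (auto simp: design_quadratic_form intro!: add_pos_nonneg sum_nonneg)
  have "(\<Sum>s=1..t. (norm (z s))\<^sup>2) \<le> (\<Sum>s=1..t. 1)"
    using assms by (intro sum_mono) (simp add: power_le_one)
  then have tr: "trace ?A \<le> ?n + real t" by (simp add: trace_design_matrix)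
  have tr0: "0 \<le> trace ?A" by (simp add: trace_design_matrix sum_nonneg)
  have "det ?A \<le> (trace ?A / ?n) ^ ?n"
    by (rule det_le_trace_power[OF design_matrix_transpose pd pos])
  also have "\<dots> \<le> ((?n + real t) / ?n) ^ ?n"
    using tr tr0 by (intro power_mono divide_right_mono) auto
  finally have "ln (det ?A) \<le> ln (((?n + real t) / ?n) ^ ?n)"
    using pos by (simp add: ln_mono)
  also have "\<dots> = ?n * ln ((?n + real t) / ?n)"
    by (rule ln_realpow)
  finally show ?thesis .
qed

text \<open>Replaces a leverage, at most 1 for features in the unit ball, by a logarithm; such
  logarithms add up to the log-determinant.\<close>

lemma le_two_ln_one_plus:
  fixes u :: real
  assumes "0 \<le> u" "u \<le> 1"
  shows "u \<le> 2 * ln (1 + u)"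
proof -
  have "ln (1 / (1 + u)) \<le> 1 / (1 + u) - 1"
    using assms by (intro ln_le_minus_one) simp
  then have "u / (1 + u) \<le> ln (1 + u)"
    using assms by (simp add: ln_div field_simps)
  moreover have "u / 2 \<le> u / (1 + u)"
    using assms by (intro divide_left_mono) auto
  ultimately show ?thesis by linarith
qed

text \<open>The index \<open>s - 1\<close> matters: the leverage is taken before the feature of
  round \<open>s\<close> enters the matrix, so the product formula turns the sum of
  \<open>ln (1 + leverage)\<close> into exactly the log-determinant. Cauchy--Schwarz against the
  constant sequence then passes to square roots.\<close>

lemma elliptical_potential:
  fixes z :: "nat \<Rightarrow> real ^ 'n::finite"
  assumes "\<And>s. s \<in> {1..t} \<Longrightarrow> norm (z s) \<le> 1"
  shows "(\<Sum>s=1..t. sqrt (leverage z (s - 1) (z s)))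
    \<le> sqrt (t * (2 * CARD('n) * ln ((CARD('n) + real t) / CARD('n))))"
proof -
  have u: "0 \<le> leverage z (s - 1) (z s)" "leverage z (s - 1) (z s) \<le> 1" if "s \<in> {1..t}" for s
    using leverage_nonneg order_trans[OF leverage_le_norm[of z "s - 1" "z s"] power_le_one] assms[OF that]
    by auto
  have "(\<Sum>s=1..t. leverage z (s - 1) (z s)) \<le> (\<Sum>s=1..t. 2 * ln (1 + leverage z (s - 1) (z s)))"
    using u by (intro sum_mono le_two_ln_one_plus)
  also have "\<dots> = 2 * (\<Sum>s<t. ln (1 + leverage z s (z (Suc s))))"
    by (simp add: sum_distrib_left sum.atLeast1_atMost_eq)
  also have "(\<Sum>s<t. ln (1 + leverage z s (z (Suc s)))) = ln (det (design_matrix 1 z t))"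
    unfolding det_design_matrix using leverage_nonneg[of z]
    by (subst ln_prod) (auto simp: add_nonneg_eq_0_iff)
  also have "\<dots> \<le> CARD('n) * ln ((CARD('n) + real t) / CARD('n))"
    using assms by (rule ln_det_design_matrix_le)
  finally have L: "(\<Sum>s=1..t. leverage z (s - 1) (z s)) \<le> 2 * CARD('n) * ln ((CARD('n) + real t) / CARD('n))"
    by simp
  have "(\<Sum>s=1..t. sqrt (leverage z (s - 1) (z s)))\<^sup>2
      \<le> t * (\<Sum>s=1..t. (sqrt (leverage z (s - 1) (z s)))\<^sup>2)"
    using Cauchy_Schwarz_ineq_sum[of "\<lambda>_. 1" "\<lambda>s. sqrt (leverage z (s - 1) (z s))" "{1..t}"] by simp
  also have "\<dots> = t * (\<Sum>s=1..t. leverage z (s - 1) (z s))"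
    using u by simp
  also have "\<dots> \<le> t * (2 * CARD('n) * ln ((CARD('n) + real t) / CARD('n)))"
    using L by (rule mult_left_mono) simp
  finally show ?thesis by (rule real_le_rsqrt)
qed

section \<open>A self-normalized bound for sub-Gaussian noise\<close>

text \<open>An \<open>F\<close>-measurable integrand sees only the restrictions of the measures to
  \<open>F\<close>, so domination on the events of \<open>F\<close> is enough. The intended
  \<open>M\<close> is an exponentially tilted measure, for which domination is known on
  \<open>F\<close> only.\<close>

lemma nn_integral_mono_subalgebra:
  assumes sub: "subalgebra M F" "subalgebra N F"
    and le: "\<And>A. A \<in> sets F \<Longrightarrow> emeasure M A \<le> emeasure N A"
    and H: "H \<in> borel_measurable F"
  shows "(\<integral>\<^sup>+\<omega>. H \<omega> \<partial>M) \<le> (\<integral>\<^sup>+\<omega>. H \<omega> \<partial>N)"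
proof -
  have sets: "sets (restr_to_subalg M F) = sets (restr_to_subalg N F)"
    using sub by (simp add: sets_restr_to_subalg)
  have "emeasure (restr_to_subalg M F) A \<le> emeasure (restr_to_subalg N F) A" for A
  proof (cases "A \<in> sets F")
    case True
    then show ?thesis using sub le by (simp add: emeasure_restr_to_subalg)
  next
    case False
    then show ?thesis using sub by (simp add: emeasure_notin_sets sets_restr_to_subalg)
  qed
  then have "restr_to_subalg M F \<le> restr_to_subalg N F"
    using sets sets_eq_imp_space_eq[OF sets] by (simp add: le_measure_iff le_fun_def)
  then have "(\<integral>\<^sup>+\<omega>. H \<omega> \<partial>restr_to_subalg M F) \<le> (\<integral>\<^sup>+\<omega>. H \<omega> \<partial>restr_to_subalg N F)"
    by (rule nn_integral_mono_measure[OF sets])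
  then show ?thesis
    using sub H by (simp add: nn_integral_subalgebra2)
qed

text \<open>The conditional moment generating function is bounded through its integrals over events
  instead of a version of the conditional expectation. In this form the bound can be integrated over
  an independent seed and used as a comparison of measures.\<close>

definition cond_subgaussian :: "'w measure \<Rightarrow> 'w measure \<Rightarrow> real \<Rightarrow> ('w \<Rightarrow> real) \<Rightarrow> bool" where
  "cond_subgaussian M F \<sigma> e \<longleftrightarrow> subalgebra M F \<and> e \<in> borel_measurable M \<and>
    (\<forall>s. \<forall>A\<in>sets F. (\<integral>\<^sup>+\<omega>. ennreal (exp (s * e \<omega>)) * indicator A \<omega> \<partial>M)
      \<le> ennreal (exp (\<sigma>\<^sup>2 * s\<^sup>2 / 2)) * emeasure M A)"

text \<open>The normalized exponential is taken as a density with respect to \<open>M\<close>; on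
  \<open>F\<close> the tilted measure is dominated by \<open>M\<close> itself.\<close>

lemma cond_subgaussian_const:
  assumes e: "cond_subgaussian M F \<sigma> e" and H: "H \<in> borel_measurable F"
  shows "(\<integral>\<^sup>+\<omega>. H \<omega> * ennreal (exp (s * e \<omega> - \<sigma>\<^sup>2 * s\<^sup>2 / 2)) \<partial>M) \<le> (\<integral>\<^sup>+\<omega>. H \<omega> \<partial>M)"
proof -
  have sub: "subalgebra M F" and [measurable]: "e \<in> borel_measurable M"
    using e by (auto simp: cond_subgaussian_def)
  have HM [measurable]: "H \<in> borel_measurable M"
    using sub H by (rule measurable_from_subalg)
  let ?f = "\<lambda>\<omega>. ennreal (exp (s * e \<omega> - \<sigma>\<^sup>2 * s\<^sup>2 / 2))"
  have f: "?f \<omega> = ennreal (exp (- (\<sigma>\<^sup>2 * s\<^sup>2 / 2))) * ennreal (exp (s * e \<omega>))" for \<omega>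
    by (simp add: ennreal_mult[symmetric] exp_add[symmetric])
  have "(\<integral>\<^sup>+\<omega>. H \<omega> \<partial>density M ?f) \<le> (\<integral>\<^sup>+\<omega>. H \<omega> \<partial>M)"
  proof (rule nn_integral_mono_subalgebra[OF _ sub _ H])
    show "subalgebra (density M ?f) F"
      using sub by (simp add: subalgebra_def)
    fix A assume A: "A \<in> sets F"
    then have [measurable]: "A \<in> sets M" using sub by (auto simp: subalgebra_def)
    have "emeasure (density M ?f) A
        = ennreal (exp (- (\<sigma>\<^sup>2 * s\<^sup>2 / 2))) * (\<integral>\<^sup>+\<omega>. ennreal (exp (s * e \<omega>)) * indicator A \<omega> \<partial>M)"
      unfolding f by (simp add: emeasure_density nn_integral_cmult mult.assoc)
    also have "\<dots> \<le> ennreal (exp (- (\<sigma>\<^sup>2 * s\<^sup>2 / 2))) * (ennreal (exp (\<sigma>\<^sup>2 * s\<^sup>2 / 2)) * emeasure M A)"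
      using e A by (intro mult_left_mono) (auto simp: cond_subgaussian_def)
    also have "\<dots> = emeasure M A"
      by (simp add: mult.assoc[symmetric] ennreal_mult[symmetric] exp_add[symmetric])
    finally show "emeasure (density M ?f) A \<le> emeasure M A" .
  qed
  then show ?thesis
    by (simp add: nn_integral_density mult.commute)
qed

text \<open>A predictable multiplier is approximated by simple functions; Fatou's lemma passes to the
  limit without any integrability.\<close>

lemma cond_subgaussian_predictable:
  assumes e: "cond_subgaussian M F \<sigma> e" and H: "H \<in> borel_measurable F"
    and y: "y \<in> borel_measurable F"
  shows "(\<integral>\<^sup>+\<omega>. H \<omega> * ennreal (exp (y \<omega> * e \<omega> - \<sigma>\<^sup>2 * (y \<omega>)\<^sup>2 / 2)) \<partial>M) \<le> (\<integral>\<^sup>+\<omega>. H \<omega> \<partial>M)"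
proof -
  have sub: "subalgebra M F" and [measurable]: "e \<in> borel_measurable M"
    using e by (auto simp: cond_subgaussian_def)
  have space: "space F = space M" using sub by (simp add: subalgebra_def)
  have HM [measurable]: "H \<in> borel_measurable M"
    using sub H by (rule measurable_from_subalg)
  let ?f = "\<lambda>s \<omega>. ennreal (exp (s * e \<omega> - \<sigma>\<^sup>2 * s\<^sup>2 / 2))"
  \<comment> \<open>On each of the finitely many level sets of \<open>s\<close>, which lie in
    \<open>F\<close>, the multiplier is constant; the indicator of the level set is absorbed into
    \<open>H\<close>.\<close>
  have simple: "(\<integral>\<^sup>+\<omega>. H \<omega> * ?f (s \<omega>) \<omega> \<partial>M) \<le> (\<integral>\<^sup>+\<omega>. H \<omega> \<partial>M)"
    if s: "simple_function F s" for s :: "'a \<Rightarrow> real"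
  proof -
    let ?R = "s ` space M"
    let ?I = "\<lambda>c \<omega>. indicator (s -` {c} \<inter> space M) \<omega> :: ennreal"
    have fin: "finite ?R" using s space by (simp add: simple_function_def)
    have IF: "(\<lambda>\<omega>. H \<omega> * ?I c \<omega>) \<in> borel_measurable F" if "c \<in> ?R" for c
    proof -
      have "s -` {c} \<inter> space M \<in> sets F"
        using s that space by (auto simp: simple_function_def)
      then show ?thesis using H by (intro borel_measurable_times_ennreal borel_measurable_indicator)
    qed
    have IM: "(\<lambda>\<omega>. H \<omega> * ?I c \<omega>) \<in> borel_measurable M" if "c \<in> ?R" for c
      using sub IF[OF that] by (rule measurable_from_subalg)
    have split: "H \<omega> * g (s \<omega>) = (\<Sum>c\<in>?R. H \<omega> * ?I c \<omega> * g c)"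
      if "\<omega> \<in> space M" for \<omega> and g :: "real \<Rightarrow> ennreal"
    proof -
      have "(\<Sum>c\<in>?R. H \<omega> * ?I c \<omega> * g c) = (\<Sum>c\<in>?R. if c = s \<omega> then H \<omega> * g c else 0)"
        using that by (intro sum.cong) (auto simp: indicator_def)
      then show ?thesis using that fin by simp
    qed
    have "(\<integral>\<^sup>+\<omega>. H \<omega> * ?f (s \<omega>) \<omega> \<partial>M) = (\<integral>\<^sup>+\<omega>. (\<Sum>c\<in>?R. H \<omega> * ?I c \<omega> * ?f c \<omega>) \<partial>M)"
      by (intro nn_integral_cong split[of _ "\<lambda>c. ?f c _"])
    also have "\<dots> = (\<Sum>c\<in>?R. \<integral>\<^sup>+\<omega>. H \<omega> * ?I c \<omega> * ?f c \<omega> \<partial>M)"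
      by (intro nn_integral_sum borel_measurable_times_ennreal[OF IM]) auto
    also have "\<dots> \<le> (\<Sum>c\<in>?R. \<integral>\<^sup>+\<omega>. H \<omega> * ?I c \<omega> \<partial>M)"
      using IF by (intro sum_mono cond_subgaussian_const[OF e])
    also have "\<dots> = (\<integral>\<^sup>+\<omega>. (\<Sum>c\<in>?R. H \<omega> * ?I c \<omega>) \<partial>M)"
      using IM by (intro nn_integral_sum[symmetric])
    also have "\<dots> = (\<integral>\<^sup>+\<omega>. H \<omega> \<partial>M)"
      using split[of _ "\<lambda>_. 1"] by (intro nn_integral_cong) simp
    finally show ?thesis .
  qed
  obtain s where s: "\<And>i. simple_function F (s i)"
    and lim: "\<And>\<omega>. \<omega> \<in> space M \<Longrightarrow> (\<lambda>i. s i \<omega>) \<longlonglongrightarrow> y \<omega>"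
    using borel_measurable_implies_sequence_metric[OF y] space by metis
  have [measurable]: "s i \<in> borel_measurable M" for i
    using sub borel_measurable_simple_function[OF s] by (rule measurable_from_subalg)
  have "(\<integral>\<^sup>+\<omega>. H \<omega> * ?f (y \<omega>) \<omega> \<partial>M) \<le> (\<integral>\<^sup>+\<omega>. liminf (\<lambda>i. H \<omega> * ?f (s i \<omega>) \<omega>) \<partial>M)"
  proof (rule nn_integral_mono)
    fix \<omega> assume "\<omega> \<in> space M"
    then have "(\<lambda>i. ?f (s i \<omega>) \<omega>) \<longlonglongrightarrow> ?f (y \<omega>) \<omega>"
      by (auto intro!: tendsto_ennrealI tendsto_intros lim)
    then have "(\<lambda>i. H \<omega> * ?f (s i \<omega>) \<omega>) \<longlonglongrightarrow> H \<omega> * ?f (y \<omega>) \<omega>"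
      by (intro tendsto_mult_ennreal) auto
    then have "liminf (\<lambda>i. H \<omega> * ?f (s i \<omega>) \<omega>) = H \<omega> * ?f (y \<omega>) \<omega>"
      by (intro lim_imp_Liminf) auto
    then show "H \<omega> * ?f (y \<omega>) \<omega> \<le> liminf (\<lambda>i. H \<omega> * ?f (s i \<omega>) \<omega>)" by simp
  qed
  also have "\<dots> \<le> liminf (\<lambda>i. \<integral>\<^sup>+\<omega>. H \<omega> * ?f (s i \<omega>) \<omega> \<partial>M)"
    by (intro nn_integral_liminf) measurable
  also have "\<dots> \<le> liminf (\<lambda>i. \<integral>\<^sup>+\<omega>. H \<omega> \<partial>M)"
    by (intro Liminf_mono always_eventually allI simple s)
  also have "\<dots> = (\<integral>\<^sup>+\<omega>. H \<omega> \<partial>M)" by (simp add: Liminf_const)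
  finally show ?thesis .
qed

text \<open>The ratio of consecutive values of the exponential process: \<open>u\<close> is the
  leverage of the new feature, \<open>a\<close> its pairing with the noise sum through the inverse
  design matrix, and \<open>e\<close> the new shock.\<close>

definition mixture_factor :: "real \<Rightarrow> real \<Rightarrow> real \<Rightarrow> real \<Rightarrow> real" where
  "mixture_factor \<sigma> a u e = exp ((2 * e * a + e\<^sup>2 * u - a\<^sup>2) / (2 * \<sigma>\<^sup>2 * (1 + u))) / sqrt (1 + u)"

lemma mixture_factor_nonneg: "0 \<le> u \<Longrightarrow> 0 \<le> mixture_factor \<sigma> a u e"
  by (simp add: mixture_factor_def)

text \<open>The mixing law \<open>N(a / \<sigma>\<^sup>2, u / \<sigma>\<^sup>2)\<close> is the posterior of the Gaussian method of mixtures
  projected on the new feature, so that a one-dimensional integral replaces the \<open>2d\<close>-dimensional one.\<close>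

lemma mixture_factor_integral:
  assumes "0 < \<sigma>" "0 \<le> u"
  shows "(\<integral>\<^sup>+w. ennreal (std_normal_density w) *
      ennreal (exp (((a + sqrt u * \<sigma> * w) / \<sigma>\<^sup>2) * e - \<sigma>\<^sup>2 * ((a + sqrt u * \<sigma> * w) / \<sigma>\<^sup>2)\<^sup>2 / 2)) \<partial>lborel)
    = ennreal (mixture_factor \<sigma> a u e)"
proof -
  \<comment> \<open>Mean and standard deviation found by completing the square in \<open>w\<close>:
    the exponent has quadratic coefficient \<open>- (1 + u) / 2\<close> and linear coefficient
    \<open>sqrt u * (e - a) / \<sigma>\<close>.\<close>
  define \<mu> \<tau> where "\<mu> = sqrt u * (e - a) / (\<sigma> * (1 + u))" and "\<tau> = 1 / sqrt (1 + u)"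
  have u1: "0 < 1 + u" using assms by simp
  have \<tau>: "0 < \<tau>" "\<tau>\<^sup>2 = 1 / (1 + u)" using u1 by (simp_all add: \<tau>_def power_divide)
  have eq: "- w\<^sup>2 / 2 + (((a + sqrt u * \<sigma> * w) / \<sigma>\<^sup>2) * e - \<sigma>\<^sup>2 * ((a + sqrt u * \<sigma> * w) / \<sigma>\<^sup>2)\<^sup>2 / 2)
      = (2 * e * a + e\<^sup>2 * u - a\<^sup>2) / (2 * \<sigma>\<^sup>2 * (1 + u)) + - (w - \<mu>)\<^sup>2 / (2 * \<tau>\<^sup>2)" for w
  proof -
    define q where "q = sqrt u"
    have q: "u = q\<^sup>2" using assms by (simp add: q_def)
    have nz: "1 + q\<^sup>2 \<noteq> 0" "\<sigma> \<noteq> 0" using u1 assms by (auto simp: q)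
    show ?thesis
      unfolding \<tau>(2) \<mu>_def q_def[symmetric] unfolding q using nz
      by (simp add: divide_simps) algebra
  qed
  have "std_normal_density w * exp (((a + sqrt u * \<sigma> * w) / \<sigma>\<^sup>2) * e - \<sigma>\<^sup>2 * ((a + sqrt u * \<sigma> * w) / \<sigma>\<^sup>2)\<^sup>2 / 2)
      = mixture_factor \<sigma> a u e * normal_density \<mu> \<tau> w" for w
  proof -
    have "sqrt (2 * pi * \<tau>\<^sup>2) * sqrt (1 + u) = sqrt (2 * pi)"
      using u1 unfolding \<tau>(2) by (simp add: real_sqrt_mult[symmetric])
    then have "1 / sqrt (2 * pi) = 1 / sqrt (1 + u) * (1 / sqrt (2 * pi * \<tau>\<^sup>2))"
      by (metis (no_types, lifting) divide_divide_eq_left' mult.commute mult_1 times_divide_times_eq)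
    then show ?thesis
      unfolding std_normal_density_def normal_density_def mixture_factor_def
      using eq[of w] by (simp add: exp_add[symmetric] mult.assoc mult.left_commute)
  qed
  then have "(\<integral>\<^sup>+w. ennreal (std_normal_density w) *
      ennreal (exp (((a + sqrt u * \<sigma> * w) / \<sigma>\<^sup>2) * e - \<sigma>\<^sup>2 * ((a + sqrt u * \<sigma> * w) / \<sigma>\<^sup>2)\<^sup>2 / 2)) \<partial>lborel)
    = (\<integral>\<^sup>+w. ennreal (mixture_factor \<sigma> a u e) * ennreal (normal_density \<mu> \<tau> w) \<partial>lborel)"
    by (simp add: ennreal_mult[symmetric] mixture_factor_def u1 less_imp_le)
  also have "\<dots> = ennreal (mixture_factor \<sigma> a u e) * (\<integral>\<^sup>+w. ennreal (normal_density \<mu> \<tau> w) \<partial>lborel)"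
    by (intro nn_integral_cmult) measurable
  also have "(\<integral>\<^sup>+w. ennreal (normal_density \<mu> \<tau> w) \<partial>lborel) = 1"
    using \<tau>(1) by (subst nn_integral_eq_integral) auto
  finally show ?thesis by simp
qed

text \<open>The mixing law depends on the sample point through \<open>a\<close> and
  \<open>u\<close>; writing it as an affine image of a standard normal \<open>w\<close> makes the
  mixing measure fixed, so Fubini applies. For each fixed \<open>w\<close> the multiplier is
  predictable.\<close>

lemma mixture_factor_supermartingale:
  assumes e: "cond_subgaussian M F \<sigma> e" and \<sigma>: "0 < \<sigma>" and M: "sigma_finite_measure M"
    and H: "H \<in> borel_measurable F" and a: "a \<in> borel_measurable F" and u: "u \<in> borel_measurable F"
    and u0: "\<And>\<omega>. \<omega> \<in> space M \<Longrightarrow> 0 \<le> u \<omega>"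
  shows "(\<integral>\<^sup>+\<omega>. H \<omega> * ennreal (mixture_factor \<sigma> (a \<omega>) (u \<omega>) (e \<omega>)) \<partial>M) \<le> (\<integral>\<^sup>+\<omega>. H \<omega> \<partial>M)"
proof -
  interpret sigma_finite_measure M by fact
  interpret P: pair_sigma_finite M lborel ..
  have sub: "subalgebra M F" and [measurable]: "e \<in> borel_measurable M"
    using e by (auto simp: cond_subgaussian_def)
  have [measurable]: "H \<in> borel_measurable M" "a \<in> borel_measurable M" "u \<in> borel_measurable M"
    using sub H a u by (auto intro: measurable_from_subalg)
  let ?y = "\<lambda>\<omega> w. (a \<omega> + sqrt (u \<omega>) * \<sigma> * w) / \<sigma>\<^sup>2"
  let ?f = "\<lambda>\<omega> w. ennreal (exp (?y \<omega> w * e \<omega> - \<sigma>\<^sup>2 * (?y \<omega> w)\<^sup>2 / 2))"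
  have "(\<integral>\<^sup>+\<omega>. H \<omega> * ennreal (mixture_factor \<sigma> (a \<omega>) (u \<omega>) (e \<omega>)) \<partial>M)
      = (\<integral>\<^sup>+\<omega>. \<integral>\<^sup>+w. H \<omega> * (ennreal (std_normal_density w) * ?f \<omega> w) \<partial>lborel \<partial>M)"
    using \<sigma> u0 by (intro nn_integral_cong)
      (simp add: mixture_factor_integral[symmetric] nn_integral_cmult[symmetric])
  also have "\<dots> = (\<integral>\<^sup>+w. \<integral>\<^sup>+\<omega>. H \<omega> * (ennreal (std_normal_density w) * ?f \<omega> w) \<partial>M \<partial>lborel)"
    by (rule P.Fubini'[symmetric]) measurable
  also have "\<dots> = (\<integral>\<^sup>+w. ennreal (std_normal_density w) * (\<integral>\<^sup>+\<omega>. H \<omega> * ?f \<omega> w \<partial>M) \<partial>lborel)"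
    by (simp add: nn_integral_cmult[symmetric] mult.left_commute)
  also have "\<dots> \<le> (\<integral>\<^sup>+w. ennreal (std_normal_density w) * (\<integral>\<^sup>+\<omega>. H \<omega> \<partial>M) \<partial>lborel)"
    using a u H by (intro nn_integral_mono mult_left_mono cond_subgaussian_predictable[OF e]) auto
  also have "\<dots> = (\<integral>\<^sup>+w. ennreal (std_normal_density w) \<partial>lborel) * (\<integral>\<^sup>+\<omega>. H \<omega> \<partial>M)"
    by (intro nn_integral_multc) measurable
  also have "(\<integral>\<^sup>+w. ennreal (std_normal_density w) \<partial>lborel) = 1"
    by (subst nn_integral_eq_integral) auto
  finally show ?thesis by simp
qed

text \<open>The conserved quantity is the integral of \<open>W t\<close> over the paths that have
  stayed below \<open>c\<close>, plus \<open>c\<close> times the mass of those that have not. It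
  starts at most 1 and never increases; \<open>step\<close> is needed only for the indicator of
  \<open>A t\<close> as \<open>H\<close>.\<close>

lemma maximal_inequality:
  fixes W :: "nat \<Rightarrow> 'w \<Rightarrow> real" and F :: "nat \<Rightarrow> 'w measure"
  assumes F: "\<And>t. t \<le> n \<Longrightarrow> subalgebra M (F t)"
    and W: "\<And>s t. s \<le> t \<Longrightarrow> t \<le> n \<Longrightarrow> W s \<in> borel_measurable (F t)"
    and step: "\<And>t H. t < n \<Longrightarrow> H \<in> borel_measurable (F t) \<Longrightarrow>
      (\<integral>\<^sup>+\<omega>. H \<omega> * ennreal (W (Suc t) \<omega>) \<partial>M) \<le> (\<integral>\<^sup>+\<omega>. H \<omega> * ennreal (W t \<omega>) \<partial>M)"
    and start: "(\<integral>\<^sup>+\<omega>. ennreal (W 0 \<omega>) \<partial>M) \<le> 1"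
    and c: "0 \<le> c"
  shows "ennreal c * emeasure M {\<omega> \<in> space M. \<exists>t\<le>n. c \<le> W t \<omega>} \<le> 1"
proof -
  define A where "A t = {\<omega> \<in> space M. \<forall>s\<le>t. W s \<omega> < c}" for t
  have AF: "A t \<in> sets (F t)" if "t \<le> n" for t
  proof -
    have [measurable]: "W s \<in> borel_measurable (F t)" if "s \<le> t" for s
      using W that \<open>t \<le> n\<close> by simp
    have "A t = {\<omega> \<in> space (F t). \<forall>s\<in>{..t}. W s \<omega> < c}"
      using F[OF that] by (auto simp: A_def subalgebra_def)
    also have "\<dots> \<in> sets (F t)" by measurable
    finally show ?thesis .
  qed
  have AM: "A t \<in> sets M" if "t \<le> n" for t
    using AF[OF that] F[OF that] by (auto simp: subalgebra_def)
  have WM: "W t \<in> borel_measurable M" if "t \<le> n" for t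
    using F[OF that] W[OF order_refl that] by (rule measurable_from_subalg)
  have main: "(\<integral>\<^sup>+\<omega>. indicator (A t) \<omega> * ennreal (W t \<omega>) \<partial>M)
      + ennreal c * emeasure M (space M - A t) \<le> 1" if "t \<le> n" for t
    using that
  proof (induction t)
    case 0
    have [measurable]: "A 0 \<in> sets M" "W 0 \<in> borel_measurable M" using AM WM 0 by auto
    have "(\<integral>\<^sup>+\<omega>. indicator (A 0) \<omega> * ennreal (W 0 \<omega>) \<partial>M) + ennreal c * emeasure M (space M - A 0)
        = (\<integral>\<^sup>+\<omega>. indicator (A 0) \<omega> * ennreal (W 0 \<omega>) + ennreal c * indicator (space M - A 0) \<omega> \<partial>M)"
      by (subst nn_integral_add) (auto simp: nn_integral_cmult)
    also have "\<dots> \<le> (\<integral>\<^sup>+\<omega>. ennreal (W 0 \<omega>) \<partial>M)"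
      by (intro nn_integral_mono) (auto simp: A_def indicator_def intro: ennreal_leI)
    finally show ?case using start by (rule order_trans)
  next
    case (Suc t)
    then have t: "t < n" "t \<le> n" by auto
    have [measurable]: "A t \<in> sets M" "A (Suc t) \<in> sets M" "W (Suc t) \<in> borel_measurable M"
      using AM WM Suc.prems t by auto
    have "(\<integral>\<^sup>+\<omega>. indicator (A (Suc t)) \<omega> * ennreal (W (Suc t) \<omega>) \<partial>M)
        + ennreal c * emeasure M (space M - A (Suc t))
        = (\<integral>\<^sup>+\<omega>. indicator (A (Suc t)) \<omega> * ennreal (W (Suc t) \<omega>)
            + ennreal c * indicator (space M - A (Suc t)) \<omega> \<partial>M)"
      by (subst nn_integral_add) (auto simp: nn_integral_cmult)
    \<comment> \<open>Paths that first reach the level now satisfy \<open>c \<le> W (Suc t)\<close>,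
      so their contribution \<open>c\<close> can be charged to the integral over
      \<open>A t\<close>.\<close>
    also have "\<dots> \<le> (\<integral>\<^sup>+\<omega>. indicator (A t) \<omega> * ennreal (W (Suc t) \<omega>)
            + ennreal c * indicator (space M - A t) \<omega> \<partial>M)"
      by (intro nn_integral_mono) (auto simp: A_def indicator_def le_Suc_eq intro: ennreal_leI)
    also have "\<dots> = (\<integral>\<^sup>+\<omega>. indicator (A t) \<omega> * ennreal (W (Suc t) \<omega>) \<partial>M)
        + ennreal c * emeasure M (space M - A t)"
      by (subst nn_integral_add) (auto simp: nn_integral_cmult)
    also have "\<dots> \<le> (\<integral>\<^sup>+\<omega>. indicator (A t) \<omega> * ennreal (W t \<omega>) \<partial>M)
        + ennreal c * emeasure M (space M - A t)"
      using AF[OF t(2)] by (intro add_right_mono step t) auto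
    also have "\<dots> \<le> 1" by (rule Suc.IH[OF t(2)])
    finally show ?case .
  qed
  have "{\<omega> \<in> space M. \<exists>t\<le>n. c \<le> W t \<omega>} = space M - A n"
    by (auto simp: A_def not_less)
  moreover have "ennreal c * emeasure M (space M - A n) \<le> 1"
    by (rule order_trans[OF _ main[OF order_refl]]) simp
  ultimately show ?thesis by simp
qed

section \<open>Measurability and the self-normalized inequality\<close>

lemma measurable_design_inverse:
  assumes "\<And>s i. s \<in> {1..t} \<Longrightarrow> (\<lambda>\<omega>. z s \<omega> $ i) \<in> borel_measurable F"
  shows "(\<lambda>\<omega>. design_inverse (\<lambda>s. z s \<omega>) t $ i $ j) \<in> borel_measurable F"
  using assms
proof (induction t arbitrary: i j)
  case (Suc t)
  have [measurable]: "(\<lambda>\<omega>. z (Suc t) \<omega> $ i) \<in> borel_measurable F"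
    "(\<lambda>\<omega>. design_inverse (\<lambda>s. z s \<omega>) t $ i $ j) \<in> borel_measurable F" for i j
    using Suc by auto
  show ?case
    by (simp add: matrix_vector_mult_def inner_vec_def)
qed simp

lemma measurable_design_inverse_inner:
  assumes [measurable]: "\<And>s i. s \<in> {1..t} \<Longrightarrow> (\<lambda>\<omega>. z s \<omega> $ i) \<in> borel_measurable F"
    "\<And>i. (\<lambda>\<omega>. v \<omega> $ i) \<in> borel_measurable F" "\<And>i. (\<lambda>\<omega>. w \<omega> $ i) \<in> borel_measurable F"
  shows "(\<lambda>\<omega>. v \<omega> \<bullet> (design_inverse (\<lambda>s. z s \<omega>) t *v w \<omega>)) \<in> borel_measurable F"
proof -
  have [measurable]: "(\<lambda>\<omega>. design_inverse (\<lambda>s. z s \<omega>) t $ i $ j) \<in> borel_measurable F" for i j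
    using assms(1) by (rule measurable_design_inverse)
  show ?thesis by (simp add: matrix_vector_mult_def inner_vec_def)
qed

text \<open>The bounds at \<open>s = 1\<close> and \<open>s = - 1\<close> show that
  \<open>exp e + exp (- e) - 2\<close>, a perfect square vanishing only where \<open>e\<close> does,
  has integral zero.\<close>

lemma subgaussian_zero_AE:
  assumes e: "cond_subgaussian M F 0 e" and "prob_space M"
  shows "AE \<omega> in M. e \<omega> = 0"
proof -
  interpret prob_space M by fact
  have [measurable]: "e \<in> borel_measurable M" and sub: "subalgebra M F"
    using e by (auto simp: cond_subgaussian_def)
  have "space M \<in> sets F" using sub by (metis sets.top subalgebra_def)
  then have E: "(\<integral>\<^sup>+\<omega>. ennreal (exp (s * e \<omega>)) \<partial>M) \<le> 1" for s
  proof -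
    have "(\<integral>\<^sup>+\<omega>. ennreal (exp (s * e \<omega>)) \<partial>M) = (\<integral>\<^sup>+\<omega>. ennreal (exp (s * e \<omega>)) * indicator (space M) \<omega> \<partial>M)"
      by (intro nn_integral_cong) simp
    also have "\<dots> \<le> 1"
      using e \<open>space M \<in> sets F\<close> by (fastforce simp: cond_subgaussian_def emeasure_space_1)
    finally show ?thesis .
  qed
  define c where "c \<omega> = exp (e \<omega>) + exp (- e \<omega>) - 2" for \<omega>
  have c0: "0 \<le> c \<omega>" "c \<omega> = 0 \<Longrightarrow> e \<omega> = 0" for \<omega>
  proof -
    have "c \<omega> = (exp (e \<omega> / 2) - exp (- e \<omega> / 2))\<^sup>2"
      by (simp add: c_def power2_diff exp_add[symmetric] power2_eq_square algebra_simps)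
    then show "0 \<le> c \<omega>" "c \<omega> = 0 \<Longrightarrow> e \<omega> = 0" by auto
  qed
  have [measurable]: "c \<in> borel_measurable M" unfolding c_def[abs_def] by measurable
  have "(\<integral>\<^sup>+\<omega>. ennreal (c \<omega>) \<partial>M) + 2 = (\<integral>\<^sup>+\<omega>. ennreal (c \<omega>) + 2 \<partial>M)"
    by (subst nn_integral_add) (auto simp: emeasure_space_1)
  also have "\<dots> = (\<integral>\<^sup>+\<omega>. ennreal (exp (1 * e \<omega>)) + ennreal (exp (- 1 * e \<omega>)) \<partial>M)"
  proof (rule nn_integral_cong)
    fix \<omega>
    have "ennreal (c \<omega>) + 2 = ennreal (c \<omega> + 2)" using c0 by (simp add: ennreal_plus)
    then show "ennreal (c \<omega>) + 2 = ennreal (exp (1 * e \<omega>)) + ennreal (exp (- 1 * e \<omega>))"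
      by (simp add: c_def ennreal_plus[symmetric] del: ennreal_plus)
  qed
  also have "\<dots> \<le> 1 + 1"
    using add_mono[OF E[of 1] E[of "- 1"]] by (subst nn_integral_add) auto
  finally have "2 + (\<integral>\<^sup>+\<omega>. ennreal (c \<omega>) \<partial>M) \<le> 2 + 0" by (simp add: add.commute)
  then have "(\<integral>\<^sup>+\<omega>. ennreal (c \<omega>) \<partial>M) = 0"
    unfolding ennreal_add_left_cancel_le by simp
  then have "AE \<omega> in M. ennreal (c \<omega>) = 0"
    by (subst (asm) nn_integral_0_iff_AE) auto
  then show ?thesis
    using c0 by (auto elim!: eventually_mono simp: ennreal_eq_0_iff intro: antisym)
qed

text \<open>The measurability hypotheses encode predictability: the feature of round
  \<open>Suc t\<close> is known at time \<open>t\<close>, its shock only at time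
  \<open>Suc t\<close>. A single event \<open>E\<close> serves all \<open>t\<close>; on it the claim
  is the logarithm of \<open>W t < c\<close>.\<close>

lemma self_normalized_bound:
  fixes z :: "nat \<Rightarrow> 'w \<Rightarrow> real ^ 'n::finite" and e :: "nat \<Rightarrow> 'w \<Rightarrow> real"
  assumes M: "prob_space M"
    and F: "\<And>s t. s \<le> t \<Longrightarrow> t \<le> n \<Longrightarrow> subalgebra (F t) (F s)"
    and e_meas: "\<And>t. t < n \<Longrightarrow> e (Suc t) \<in> borel_measurable (F (Suc t))"
    and z_meas: "\<And>t i. t < n \<Longrightarrow> (\<lambda>\<omega>. z (Suc t) \<omega> $ i) \<in> borel_measurable (F t)"
    and sub: "\<And>t. t \<le> n \<Longrightarrow> subalgebra M (F t)"
    and e: "\<And>t. t < n \<Longrightarrow> cond_subgaussian M (F t) \<sigma> (e (Suc t))"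
    and \<sigma>: "0 \<le> \<sigma>" and c: "1 \<le> c"
  shows "\<exists>E\<in>sets M. ennreal c * emeasure M (space M - E) \<le> 1 \<and>
    (\<forall>\<omega>\<in>E. \<forall>t\<le>n. leverage (\<lambda>s. z s \<omega>) t (\<Sum>s=1..t. e s \<omega> *\<^sub>R z s \<omega>)
      \<le> \<sigma>\<^sup>2 * (2 * ln c + ln (det (design_matrix 1 (\<lambda>s. z s \<omega>) t))))"
proof -
  interpret prob_space M by fact
  define S where "S t \<omega> = (\<Sum>s=1..t. e s \<omega> *\<^sub>R z s \<omega>)" for t \<omega>
  define d where "d t \<omega> = det (design_matrix 1 (\<lambda>s. z s \<omega>) t)" for t \<omega>
  have d1: "1 \<le> d t \<omega>" for t \<omega> unfolding d_def by (rule det_design_matrix_ge_1)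
  have ln_d: "0 \<le> ln (d t \<omega>)" for t \<omega> using d1 by simp
  \<comment> \<open>The exponent of the process divides by the squared \<sigma>. For \<sigma> = 0
    the shocks, and with them the noise sum, vanish almost surely.\<close>
  consider "\<sigma> = 0" | "0 < \<sigma>" using \<sigma> by linarith
  then show ?thesis
  proof cases
    case 1
    have em: "e s \<in> borel_measurable M" if "s \<in> {1..n}" for s
      using that measurable_from_subalg[OF sub e_meas, of "s - 1"] by (cases s) auto
    define E where "E = {\<omega> \<in> space M. \<forall>s\<in>{1..n}. e s \<omega> = 0}"
    have EM: "E \<in> sets M" unfolding E_def using em by measurable
    have "AE \<omega> in M. e s \<omega> = 0" if "s \<in> {1..n}" for s
      using that subgaussian_zero_AE[OF _ M] e[of "s - 1"] 1 by (cases s) auto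
    then have "AE \<omega> in M. \<forall>s\<in>{1..n}. e s \<omega> = 0"
      by (intro AE_finite_allI) auto
    then have "emeasure M (space M - E) = 0"
      using AE_iff_measurable[of "space M - E" M "\<lambda>\<omega>. \<forall>s\<in>{1..n}. e s \<omega> = 0"] EM
      by (auto simp: E_def)
    moreover have "leverage (\<lambda>s. z s \<omega>) t (S t \<omega>) = 0" if "\<omega> \<in> E" "t \<le> n" for \<omega> t
    proof -
      have "S t \<omega> = 0" unfolding S_def using that by (intro sum.neutral) (auto simp: E_def)
      then show ?thesis by (simp add: leverage_def)
    qed
    ultimately show ?thesis using 1 EM by (intro bexI[of _ E]) (auto simp: S_def)
  next
    case 2
    define a where "a t \<omega> = z (Suc t) \<omega> \<bullet> (design_inverse (\<lambda>s. z s \<omega>) t *v S t \<omega>)" for t \<omega>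
    define u where "u t \<omega> = leverage (\<lambda>s. z s \<omega>) t (z (Suc t) \<omega>)" for t \<omega>
    define W where "W t \<omega> = exp (leverage (\<lambda>s. z s \<omega>) t (S t \<omega>) / (2 * \<sigma>\<^sup>2)) / sqrt (d t \<omega>)" for t \<omega>
    have u0: "0 \<le> u t \<omega>" for t \<omega> unfolding u_def by (rule leverage_nonneg)
    have zF: "(\<lambda>\<omega>. z s \<omega> $ i) \<in> borel_measurable (F t)" if "s \<in> {1..Suc t}" "t < n" for s t i
      using that measurable_from_subalg[OF F z_meas, of "s - 1" t] by (cases s) auto
    have zF': "(\<lambda>\<omega>. z s \<omega> $ i) \<in> borel_measurable (F t)" if "s \<in> {1..t}" "t \<le> n" for s t i
      using that measurable_from_subalg[OF F z_meas, of "s - 1" t] by (cases s) auto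
    have eF: "e s \<in> borel_measurable (F t)" if "s \<in> {1..t}" "t \<le> n" for s t
      using that measurable_from_subalg[OF F e_meas, of "s - 1" t] by (cases s) auto
    have SF: "(\<lambda>\<omega>. S t \<omega> $ i) \<in> borel_measurable (F t)" if "t \<le> n" for t i
      unfolding S_def using zF' eF that by (auto intro!: borel_measurable_sum borel_measurable_times)
    have aF: "a t \<in> borel_measurable (F t)" if "t < n" for t
      unfolding a_def using zF SF that by (intro measurable_design_inverse_inner) auto
    have uF: "u t \<in> borel_measurable (F t)" if "t < n" for t
      unfolding u_def leverage_def using zF that by (intro measurable_design_inverse_inner) auto
    have dF: "d t \<in> borel_measurable (F t)" if "t \<le> n" for t
    proof -
      have "u s \<in> borel_measurable (F t)" if "s < t" for s
        using that \<open>t \<le> n\<close> measurable_from_subalg[OF F uF, of s t] by auto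
      then have "(\<lambda>\<omega>. \<Prod>s<t. 1 + u s \<omega>) \<in> borel_measurable (F t)"
        by (intro borel_measurable_prod borel_measurable_add) auto
      then show ?thesis by (simp add: d_def[abs_def] det_design_matrix u_def)
    qed
    have WF: "W t \<in> borel_measurable (F t)" if "t \<le> n" for t
    proof -
      have [measurable]: "(\<lambda>\<omega>. leverage (\<lambda>s. z s \<omega>) t (S t \<omega>)) \<in> borel_measurable (F t)"
        "d t \<in> borel_measurable (F t)"
        unfolding leverage_def using zF' SF dF that by (auto intro!: measurable_design_inverse_inner)
      show ?thesis unfolding W_def by measurable
    qed
    have W_Suc: "W (Suc t) \<omega> = W t \<omega> * mixture_factor \<sigma> (a t \<omega>) (u t \<omega>) (e (Suc t) \<omega>)" for t \<omega>
    proof -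
      define r where "r = e (Suc t) \<omega>"
      have u1: "1 + u t \<omega> \<noteq> 0" using u0[of t \<omega>] by simp
      have S: "S (Suc t) \<omega> = S t \<omega> + r *\<^sub>R z (Suc t) \<omega>" by (simp add: S_def r_def)
      have "z (Suc t) \<omega> \<bullet> (design_inverse (\<lambda>s. z s \<omega>) t *v S (Suc t) \<omega>) = a t \<omega> + r * u t \<omega>"
        by (simp add: S a_def u_def leverage_def matrix_vector_right_distrib matrix_vector_mult_scaleR
            inner_add_right)
      then have "leverage (\<lambda>s. z s \<omega>) (Suc t) (S (Suc t) \<omega>)
          = leverage (\<lambda>s. z s \<omega>) t (S t \<omega>) + 2 * r * a t \<omega> + r\<^sup>2 * u t \<omega>
            - (a t \<omega> + r * u t \<omega>)\<^sup>2 / (1 + u t \<omega>)"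
        unfolding leverage_Suc by (simp add: S leverage_add a_def u_def)
      also have "\<dots> = leverage (\<lambda>s. z s \<omega>) t (S t \<omega>) + (2 * r * a t \<omega> + r\<^sup>2 * u t \<omega> - (a t \<omega>)\<^sup>2) / (1 + u t \<omega>)"
        using u1 by (simp add: field_simps power2_eq_square)
      finally have "leverage (\<lambda>s. z s \<omega>) (Suc t) (S (Suc t) \<omega>) / (2 * \<sigma>\<^sup>2)
          = leverage (\<lambda>s. z s \<omega>) t (S t \<omega>) / (2 * \<sigma>\<^sup>2)
            + (2 * r * a t \<omega> + r\<^sup>2 * u t \<omega> - (a t \<omega>)\<^sup>2) / (2 * \<sigma>\<^sup>2 * (1 + u t \<omega>))"
        by (simp add: add_divide_distrib mult.commute)
      moreover have "d (Suc t) \<omega> = d t \<omega> * (1 + u t \<omega>)"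
        by (simp add: d_def det_design_matrix u_def)
      ultimately show ?thesis
        by (simp add: W_def mixture_factor_def exp_add real_sqrt_mult r_def)
    qed
    have W0: "0 \<le> W t \<omega>" for t \<omega> using d1[of t \<omega>] by (simp add: W_def)
    define E where "E = space M - {\<omega> \<in> space M. \<exists>t\<le>n. c \<le> W t \<omega>}"
    have WM: "W t \<in> borel_measurable M" if "t \<le> n" for t
      using measurable_from_subalg[OF sub WF] that by simp
    have "{\<omega> \<in> space M. c \<le> W t \<omega>} \<in> sets M" if "t \<le> n" for t
      using WM[OF that] by measurable
    then have "(\<Union>t\<in>{..n}. {\<omega> \<in> space M. c \<le> W t \<omega>}) \<in> sets M"
      by (intro sets.finite_UN) simp_all
    also have "(\<Union>t\<in>{..n}. {\<omega> \<in> space M. c \<le> W t \<omega>}) = {\<omega> \<in> space M. \<exists>t\<le>n. c \<le> W t \<omega>}"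
      by blast
    finally have EM: "E \<in> sets M" unfolding E_def by (rule sets.compl_sets)
    have "ennreal c * emeasure M {\<omega> \<in> space M. \<exists>t\<le>n. c \<le> W t \<omega>} \<le> 1"
    proof (rule maximal_inequality[where F = F])
      show "W s \<in> borel_measurable (F t)" if "s \<le> t" "t \<le> n" for s t
        using measurable_from_subalg[OF F WF, of s t] that by auto
      show "(\<integral>\<^sup>+\<omega>. ennreal (W 0 \<omega>) \<partial>M) \<le> 1"
        by (simp add: W_def S_def d_def leverage_def emeasure_space_1)
      fix t and H :: "'w \<Rightarrow> ennreal"
      assume t: "t < n" and [measurable]: "H \<in> borel_measurable (F t)"
      have [measurable]: "W t \<in> borel_measurable (F t)" using WF t by simp
      have "(\<integral>\<^sup>+\<omega>. H \<omega> * ennreal (W (Suc t) \<omega>) \<partial>M)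
          = (\<integral>\<^sup>+\<omega>. (H \<omega> * ennreal (W t \<omega>)) * ennreal (mixture_factor \<sigma> (a t \<omega>) (u t \<omega>) (e (Suc t) \<omega>)) \<partial>M)"
        using W0 u0 by (simp add: W_Suc ennreal_mult mult.assoc mixture_factor_nonneg)
      also have "\<dots> \<le> (\<integral>\<^sup>+\<omega>. H \<omega> * ennreal (W t \<omega>) \<partial>M)"
        using aF[OF t] uF[OF t] u0
        by (intro mixture_factor_supermartingale[OF e[OF t] 2]) (auto intro: sigma_finite_measure_axioms)
      finally show "(\<integral>\<^sup>+\<omega>. H \<omega> * ennreal (W (Suc t) \<omega>) \<partial>M) \<le> (\<integral>\<^sup>+\<omega>. H \<omega> * ennreal (W t \<omega>) \<partial>M)" .
    qed (use sub c in auto)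
    moreover have "space M - E = {\<omega> \<in> space M. \<exists>t\<le>n. c \<le> W t \<omega>}" by (auto simp: E_def)
    moreover have "leverage (\<lambda>s. z s \<omega>) t (S t \<omega>) \<le> \<sigma>\<^sup>2 * (2 * ln c + ln (d t \<omega>))"
      if "\<omega> \<in> E" "t \<le> n" for \<omega> t
    proof -
      have "W t \<omega> < c" using that unfolding E_def by (auto simp: not_le dest!: spec[of _ t])
      then have "exp (leverage (\<lambda>s. z s \<omega>) t (S t \<omega>) / (2 * \<sigma>\<^sup>2)) < c * sqrt (d t \<omega>)"
        using d1[of t \<omega>] by (simp add: W_def pos_divide_less_eq)
      then have "ln (exp (leverage (\<lambda>s. z s \<omega>) t (S t \<omega>) / (2 * \<sigma>\<^sup>2))) < ln (c * sqrt (d t \<omega>))"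
        using c d1[of t \<omega>] by (subst ln_less_cancel_iff) auto
      then have "leverage (\<lambda>s. z s \<omega>) t (S t \<omega>) / (2 * \<sigma>\<^sup>2) < ln c + ln (d t \<omega>) / 2"
        using c d1[of t \<omega>] by (simp add: ln_mult ln_sqrt)
      then show ?thesis using 2 by (simp add: field_simps)
    qed
    ultimately show ?thesis
      using EM by (intro bexI[of _ E]) (auto simp: S_def d_def)
  qed
qed

section \<open>Quasi-likelihood\<close>

text \<open>The derivative is not assumed continuous. The fundamental theorem for the gauge integral
  does not ask for continuity, and boundedness makes the integral absolute, hence equal to the
  Lebesgue integral.\<close>

lemma interval_integral_lebesgue_FTC:
  fixes F f :: "real \<Rightarrow> real"
  assumes deriv: "\<And>u. u \<in> closed_segment a b \<Longrightarrow> (F has_real_derivative f u) (at u)"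
    and bounded: "\<And>u. u \<in> closed_segment a b \<Longrightarrow> \<bar>f u\<bar> \<le> K"
  shows "(LINT u=ereal a..ereal b|lebesgue. f u) = F b - F a"
proof -
  have main: "(LINT u:einterval (ereal c) (ereal d)|lebesgue. f u) = F d - F c"
    if "c \<le> d" and sub: "{c..d} \<subseteq> closed_segment a b" for c d
  proof -
    have int: "(f has_integral (F d - F c)) {c..d}"
    proof (rule fundamental_theorem_of_calculus[OF \<open>c \<le> d\<close>])
      fix u assume "u \<in> {c..d}"
      with sub have "(F has_real_derivative f u) (at u)"
        by (intro deriv) blast
      then show "(F has_vector_derivative f u) (at u within {c..d})"
        by (metis has_real_derivative_iff_has_vector_derivative has_field_derivative_at_within)
    qed
    then have "f absolutely_integrable_on cbox c d"
      using bounded sub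
      by (intro absolutely_integrable_integrable_bound[where g = "\<lambda>_. K"]) (auto simp: has_integral_iff)
    then have "f absolutely_integrable_on box c d"
      by (simp only: absolutely_integrable_on_open_interval)
    then have "(LINT u:{c<..<d}|lebesgue. f u) = integral {c<..<d} f"
      by (intro set_lebesgue_integral_eq_integral) (simp add: box_real)
    also have "\<dots> = F d - F c"
      using int by (simp add: integral_open_interval_real[symmetric] integral_unique)
    finally show ?thesis by simp
  qed
  show ?thesis
  proof (cases "a \<le> b")
    case True
    then show ?thesis
      using main[of a b] by (simp add: interval_lebesgue_integral_def closed_segment_eq_real_ivl)
  next
    case False
    then show ?thesis
      using main[of b a] by (simp add: interval_lebesgue_integral_def closed_segment_eq_real_ivl)
  qed
qed

text \<open>The strong form of the inverse function rule uses continuity of \<open>g\<close>, a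
  global left inverse and the derivative at the single point \<open>v\<close>, so it copes with a
  discontinuous derivative.\<close>

lemma strict_mono_inv_deriv:
  fixes g :: "real \<Rightarrow> real"
  assumes "strict_mono g" "\<And>v. g differentiable (at v)" "deriv g v \<noteq> 0"
  shows "(inv g has_real_derivative inverse (deriv g v)) (at (g v))"
  unfolding has_field_derivative_def
proof (rule has_derivative_inverse_strong[where S = UNIV and f = g and x = v and f' = "(*) (deriv g v)"])
  show "(g has_derivative (*) (deriv g v)) (at v)"
    using assms(2) by (simp add: DERIV_deriv_iff_real_differentiable flip: has_field_derivative_def)
  show "continuous_on UNIV g"
    using assms(2) by (simp add: continuous_at_imp_continuous_on differentiable_imp_continuous_within)
  show "inv g (g w) = w" for w
    using assms(1) by (simp add: strict_mono_imp_inj_on)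
  show "(*) (deriv g v) \<circ> (*) (inverse (deriv g v)) = id"
    using assms(3) by (simp add: fun_eq_iff)
qed auto

text \<open>Substituting \<open>v = inv g u\<close> turns the integrand of the quasi-likelihood into \<open>g v - D\<close>,
  integrated from \<open>0\<close> to \<open>z \<bullet> \<theta>\<close>. As \<open>deriv g\<close> need not be continuous, the
  substitution is done by the fundamental theorem in the variable \<open>u\<close>.\<close>

lemma quasi_loglik_antiderivative:
  fixes g :: "real \<Rightarrow> real"
  assumes mono: "strict_mono g" and diff: "\<And>v. g differentiable (at v)"
    and low: "\<And>v. \<bar>v\<bar> \<le> R \<Longrightarrow> glow \<le> deriv g v" and glow: "0 < glow"
    and G: "\<And>v. \<bar>v\<bar> \<le> R \<Longrightarrow> (G has_real_derivative g v) (at v)"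
    and th: "\<bar>z \<bullet> \<theta>\<bar> \<le> R"
  shows "quasi_loglik g z D \<theta> = - ((G (z \<bullet> \<theta>) - D * (z \<bullet> \<theta>)) - G 0)"
proof -
  define w where "w = z \<bullet> \<theta>"
  define F where "F u = G (inv g u) - D * inv g u" for u
  have inv: "inv g (g v) = v" for v
    using mono by (simp add: strict_mono_imp_inj_on)
  have cont: "continuous_on A g" for A
    using diff by (simp add: continuous_at_imp_continuous_on differentiable_imp_continuous_within)
  \<comment> \<open>By the intermediate value theorem the range of integration consists of values of
    \<open>g\<close> at arguments between 0 and \<open>w\<close>, where the lower bound on the
    derivative is available.\<close>
  have seg: "\<exists>v. u = g v \<and> \<bar>v\<bar> \<le> R" if u: "u \<in> closed_segment (g 0) (g w)" for u
  proof (cases "0 \<le> w")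
    case True
    then have "g 0 \<le> u" "u \<le> g w"
      using u mono by (auto simp: closed_segment_eq_real_ivl strict_mono_less_eq)
    then obtain v where "0 \<le> v" "v \<le> w" "g v = u"
      using IVT'[of g 0 u w] True cont by auto
    then show ?thesis using th by (intro exI[of _ v]) (auto simp: w_def)
  next
    case False
    then have "g w \<le> u" "u \<le> g 0"
      using u mono by (auto simp: closed_segment_eq_real_ivl strict_mono_less_eq)
    then obtain v where "w \<le> v" "v \<le> 0" "g v = u"
      using IVT'[of g w u 0] False cont by auto
    then show ?thesis using th by (intro exI[of _ v]) (auto simp: w_def)
  qed
  \<comment> \<open>The numerator bounds \<open>u - D\<close> along the path, and
    \<open>glow\<close> bounds the denominator of the integrand from below.\<close>
  define K where "K = (\<bar>g 0\<bar> + \<bar>g w\<bar> + \<bar>D\<bar>) / glow"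
  have "(LINT u=ereal (g 0)..ereal (g w)|lebesgue. ((u - D) / deriv g (inv g u))) = F (g w) - F (g 0)"
  proof (rule interval_integral_lebesgue_FTC[where K = K])
    fix u assume u: "u \<in> closed_segment (g 0) (g w)"
    then obtain v where v: "u = g v" "\<bar>v\<bar> \<le> R" using seg by blast
    have pos: "0 < deriv g v" using low[OF v(2)] glow by simp
    have dinv: "(inv g has_real_derivative inverse (deriv g v)) (at u)"
      unfolding v(1) using pos by (intro strict_mono_inv_deriv mono diff) simp
    have "((\<lambda>u. G (inv g u)) has_real_derivative g v * inverse (deriv g v)) (at u)"
      using DERIV_chain2[OF _ dinv, of G "g v"] G[OF v(2)] by (simp add: v(1) inv)
    then have "(F has_real_derivative g v * inverse (deriv g v) - D * inverse (deriv g v)) (at u)"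
      unfolding F_def[abs_def] by (intro DERIV_diff DERIV_cmult dinv)
    then show "(F has_real_derivative (u - D) / deriv g (inv g u)) (at u)"
      by (simp add: v(1) inv divide_inverse algebra_simps)
    have "\<bar>u - D\<bar> \<le> \<bar>g 0\<bar> + \<bar>g w\<bar> + \<bar>D\<bar>"
      using u by (auto simp: closed_segment_eq_real_ivl split: if_splits)
    then show "\<bar>(u - D) / deriv g (inv g u)\<bar> \<le> K"
      using low[OF v(2)] glow pos unfolding K_def by (simp add: v(1) inv abs_divide frac_le)
  qed
  then show ?thesis
    by (simp add: quasi_loglik_def F_def inv w_def)
qed

text \<open>A second-order Taylor bound without integrals. The derivative of \<open>k\<close> is
  \<open>l\<close>, which vanishes at \<open>a\<close> and is nondecreasing; so \<open>k\<close> is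
  smallest at \<open>a\<close>, whichever side \<open>b\<close> lies on.\<close>

lemma convex_antiderivative_lower_bound:
  fixes g G :: "real \<Rightarrow> real"
  assumes G: "\<And>v. v \<in> closed_segment a b \<Longrightarrow> (G has_real_derivative g v) (at v)"
    and g: "\<And>v. v \<in> closed_segment a b \<Longrightarrow> (g has_real_derivative g' v) (at v)"
    and low: "\<And>v. v \<in> closed_segment a b \<Longrightarrow> c \<le> g' v"
  shows "g a * (b - a) + c / 2 * (b - a)\<^sup>2 \<le> G b - G a"
proof -
  define k where "k v = G v - g a * v - c / 2 * (v - a)\<^sup>2" for v
  have dk: "(k has_real_derivative (g v - g a - c * (v - a))) (at v)" if "v \<in> closed_segment a b" for v
    unfolding k_def[abs_def]
    by (rule derivative_eq_intros G[OF that] refl | simp)+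
  define l where "l v = g v - g a - c * (v - a)" for v
  have dl: "(l has_real_derivative (g' v - c)) (at v)" if "v \<in> closed_segment a b" for v
    unfolding l_def[abs_def]
    by (rule derivative_eq_intros g[OF that] refl | simp)+
  have "k a \<le> k b"
  proof (cases "a \<le> b")
    case True
    show ?thesis
    proof (rule DERIV_nonneg_imp_nondecreasing[OF True])
      fix v assume v: "a \<le> v" "v \<le> b"
      have "l a \<le> l v"
      proof (rule DERIV_nonneg_imp_nondecreasing[OF v(1)])
        fix w assume "a \<le> w" "w \<le> v"
        then show "\<exists>y. (l has_real_derivative y) (at w) \<and> 0 \<le> y"
          using dl[of w] low[of w] v True by (auto simp: closed_segment_eq_real_ivl)
      qed
      then show "\<exists>y. (k has_real_derivative y) (at v) \<and> 0 \<le> y"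
        using dk[of v] v True by (auto simp: closed_segment_eq_real_ivl l_def)
    qed
  next
    case False
    then have "b \<le> a" by simp
    then have "k a \<le> k b"
    proof (rule DERIV_nonpos_imp_nonincreasing)
      fix v assume v: "b \<le> v" "v \<le> a"
      have "l v \<le> l a"
      proof (rule DERIV_nonneg_imp_nondecreasing[OF v(2)])
        fix w assume "v \<le> w" "w \<le> a"
        then show "\<exists>y. (l has_real_derivative y) (at w) \<and> 0 \<le> y"
          using dl[of w] low[of w] v False by (auto simp: closed_segment_eq_real_ivl)
      qed
      then show "\<exists>y. (k has_real_derivative y) (at v) \<and> y \<le> 0"
        using dk[of v] v False by (auto simp: closed_segment_eq_real_ivl l_def)
    qed
    then show ?thesis .
  qed
  then show ?thesis by (simp add: k_def algebra_simps)
qed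

text \<open>As a function of \<open>w = z \<bullet> \<theta>\<close> the quasi-likelihood is
  \<open>D * w - G w\<close> up to a constant, where \<open>G\<close> is an antiderivative of
  \<open>g\<close> with curvature at least \<open>glow\<close>.\<close>

lemma quasi_loglik_gap:
  fixes g :: "real \<Rightarrow> real"
  assumes mono: "strict_mono g" and diff: "\<And>v. g differentiable (at v)"
    and low: "\<And>v. \<bar>v\<bar> \<le> R \<Longrightarrow> glow \<le> deriv g v" and glow: "0 < glow"
    and th: "\<bar>z \<bullet> \<theta>\<bar> \<le> R" and th': "\<bar>z \<bullet> \<theta>'\<bar> \<le> R"
  shows "quasi_loglik g z D \<theta>' - quasi_loglik g z D \<theta>
    \<le> (D - g (z \<bullet> \<theta>)) * (z \<bullet> (\<theta>' - \<theta>)) - glow / 2 * (z \<bullet> (\<theta>' - \<theta>))\<^sup>2"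
proof -
  \<comment> \<open>The margin of 1 puts the endpoints \<open>R\<close> and \<open>- R\<close> into
    the interior, so the antiderivative has two-sided derivatives there.\<close>
  have "continuous_on {- R - 1..R + 1} g"
    using diff by (simp add: continuous_at_imp_continuous_on differentiable_imp_continuous_within)
  then obtain G where G: "\<And>v. v \<in> {- R - 1..R + 1} \<Longrightarrow>
      (G has_vector_derivative g v) (at v within {- R - 1..R + 1})"
    using antiderivative_continuous by blast
  have dG: "(G has_real_derivative g v) (at v)" if "\<bar>v\<bar> \<le> R" for v
  proof -
    have "v \<in> interior {- R - 1..R + 1}" using that by auto
    moreover have "v \<in> {- R - 1..R + 1}" using that by auto
    ultimately show ?thesis
      using G[of v] at_within_interior[of v "{- R - 1..R + 1}"]
      by (simp add: has_real_derivative_iff_has_vector_derivative)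
  qed
  have seg: "\<bar>v\<bar> \<le> R" if "v \<in> closed_segment (z \<bullet> \<theta>) (z \<bullet> \<theta>')" for v
    using that th th' by (auto simp: closed_segment_eq_real_ivl split: if_splits)
  have "g (z \<bullet> \<theta>) * (z \<bullet> \<theta>' - z \<bullet> \<theta>) + glow / 2 * (z \<bullet> \<theta>' - z \<bullet> \<theta>)\<^sup>2 \<le> G (z \<bullet> \<theta>') - G (z \<bullet> \<theta>)"
    using seg dG low diff
    by (intro convex_antiderivative_lower_bound[where g' = "deriv g"])
      (auto simp: DERIV_deriv_iff_real_differentiable)
  then show ?thesis
    using quasi_loglik_antiderivative[OF mono diff low glow dG th, of D]
      quasi_loglik_antiderivative[OF mono diff low glow dG th', of D]
    by (simp add: inner_diff_right algebra_simps)
qed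

section \<open>Randomized policies and the history\<close>

text \<open>Generated by one map into a product space, so that every event is the preimage of one
  measurable set of pairs, which can be cut at a fixed seed. Prices are absent from the generators
  because they turn out to be functions of the seed and the shocks.\<close>

definition seeded_past :: "'w set \<Rightarrow> ('w \<Rightarrow> 'u) \<Rightarrow> 'u measure \<Rightarrow> (nat \<Rightarrow> 'w \<Rightarrow> real) \<Rightarrow> nat \<Rightarrow> 'w measure" where
  "seeded_past \<Omega> U N \<epsilon> t =
    vimage_algebra \<Omega> (\<lambda>\<omega>. (U \<omega>, \<lambda>s\<in>{1..t}. \<epsilon> s \<omega>)) (N \<Otimes>\<^sub>M Pi\<^sub>M {1..t} (\<lambda>_. borel))"

lemma space_seeded_past [simp]: "space (seeded_past \<Omega> U N \<epsilon> t) = \<Omega>"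
  by (simp add: seeded_past_def)

lemma seeded_past_components:
  assumes "U \<in> \<Omega> \<rightarrow> space N"
  shows "U \<in> seeded_past \<Omega> U N \<epsilon> t \<rightarrow>\<^sub>M N"
    and "s \<in> {1..t} \<Longrightarrow> \<epsilon> s \<in> borel_measurable (seeded_past \<Omega> U N \<epsilon> t)"
proof -
  let ?f = "\<lambda>\<omega>. (U \<omega>, \<lambda>s\<in>{1..t}. \<epsilon> s \<omega>)"
  have f: "?f \<in> seeded_past \<Omega> U N \<epsilon> t \<rightarrow>\<^sub>M N \<Otimes>\<^sub>M Pi\<^sub>M {1..t} (\<lambda>_. borel)"
    unfolding seeded_past_def using assms
    by (intro measurable_vimage_algebra1) (auto simp: space_pair_measure space_PiM)
  from measurable_comp[OF f measurable_fst] show "U \<in> seeded_past \<Omega> U N \<epsilon> t \<rightarrow>\<^sub>M N"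
    by (simp add: comp_def)
  assume s: "s \<in> {1..t}"
  have "(\<lambda>x. x s) \<in> Pi\<^sub>M {1..t} (\<lambda>_. borel) \<rightarrow>\<^sub>M (borel :: real measure)"
    using measurable_component_singleton[OF s, of "\<lambda>_. borel"] .
  from measurable_comp[OF f measurable_comp[OF measurable_snd this]] s
  show "\<epsilon> s \<in> borel_measurable (seeded_past \<Omega> U N \<epsilon> t)"
    by (simp add: comp_def)
qed

lemma subalgebra_seeded_past:
  assumes U: "U \<in> A \<rightarrow>\<^sub>M N" and e: "\<And>s. s \<in> {1..t} \<Longrightarrow> \<epsilon> s \<in> borel_measurable A"
  shows "subalgebra A (seeded_past (space A) U N \<epsilon> t)"
proof -
  have "(\<lambda>\<omega>. (U \<omega>, \<lambda>s\<in>{1..t}. \<epsilon> s \<omega>)) \<in> A \<rightarrow>\<^sub>M N \<Otimes>\<^sub>M Pi\<^sub>M {1..t} (\<lambda>_. borel)"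
    using U e by (intro measurable_Pair measurable_restrict)
  then show ?thesis
    using sets_image_in_sets[of A "space A"] by (auto simp: subalgebra_def seeded_past_def)
qed

lemma seeded_past_mono:
  assumes "U \<in> \<Omega> \<rightarrow> space N" "s \<le> t"
  shows "subalgebra (seeded_past \<Omega> U N \<epsilon> t) (seeded_past \<Omega> U N \<epsilon> s)"
proof -
  have "subalgebra (seeded_past \<Omega> U N \<epsilon> t) (seeded_past (space (seeded_past \<Omega> U N \<epsilon> t)) U N \<epsilon> s)"
    using assms by (intro subalgebra_seeded_past seeded_past_components) auto
  then show ?thesis by simp
qed

section \<open>Independence of the seed from the shocks\<close>

lemma distr_pair_indep_set:
  assumes "prob_space M" and U: "U \<in> M \<rightarrow>\<^sub>M N" and Y: "Y \<in> M \<rightarrow>\<^sub>M K"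
    and ind: "prob_space.indep_set M (preimages (space M) U N) (preimages (space M) Y K)"
  shows "distr M (N \<Otimes>\<^sub>M K) (\<lambda>\<omega>. (U \<omega>, Y \<omega>)) = distr M N U \<Otimes>\<^sub>M distr M K Y"
proof -
  interpret prob_space M by fact
  interpret U: prob_space "distr M N U" by (rule prob_space_distr[OF U])
  interpret Y: prob_space "distr M K Y" by (rule prob_space_distr[OF Y])
  show ?thesis
  proof (rule pair_measure_eqI[symmetric])
    show "sigma_finite_measure (distr M N U)" "sigma_finite_measure (distr M K Y)"
      by (simp_all add: U.sigma_finite_measure_axioms Y.sigma_finite_measure_axioms)
    show "sets (distr M N U \<Otimes>\<^sub>M distr M K Y) = sets (distr M (N \<Otimes>\<^sub>M K) (\<lambda>\<omega>. (U \<omega>, Y \<omega>)))"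
      by (simp cong: sets_pair_measure_cong)
    fix A B assume "A \<in> sets (distr M N U)" "B \<in> sets (distr M K Y)"
    then have AB: "A \<in> sets N" "B \<in> sets K" by simp_all
    have "(\<lambda>\<omega>. (U \<omega>, Y \<omega>)) -` (A \<times> B) \<inter> space M = (U -` A \<inter> space M) \<inter> (Y -` B \<inter> space M)"
      by auto
    moreover have "prob ((U -` A \<inter> space M) \<inter> (Y -` B \<inter> space M))
        = prob (U -` A \<inter> space M) * prob (Y -` B \<inter> space M)"
      using AB by (intro indep_setD[OF ind]) (auto simp: preimages_def)
    ultimately show "emeasure (distr M N U) A * emeasure (distr M K Y) B
        = emeasure (distr M (N \<Otimes>\<^sub>M K) (\<lambda>\<omega>. (U \<omega>, Y \<omega>))) (A \<times> B)"
      using U Y AB by (simp add: emeasure_distr emeasure_eq_measure ennreal_mult)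
  qed
qed

text \<open>Fubini for the product law, with both factors pulled back to \<open>M\<close>:
  \<open>\<omega>'\<close> supplies the seed and \<open>\<omega>\<close> the shocks, so the inner
  integral runs over shocks at a frozen seed.\<close>

lemma nn_integral_independent_seed:
  fixes f :: "'u \<times> 'v \<Rightarrow> ennreal"
  assumes "prob_space M" and U [measurable]: "U \<in> M \<rightarrow>\<^sub>M N" and Y [measurable]: "Y \<in> M \<rightarrow>\<^sub>M K"
    and ind: "prob_space.indep_set M (preimages (space M) U N) (preimages (space M) Y K)"
    and f: "f \<in> borel_measurable (N \<Otimes>\<^sub>M K)"
  shows "(\<integral>\<^sup>+\<omega>. f (U \<omega>, Y \<omega>) \<partial>M) = (\<integral>\<^sup>+\<omega>'. \<integral>\<^sup>+\<omega>. f (U \<omega>', Y \<omega>) \<partial>M \<partial>M)"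
proof -
  interpret prob_space M by fact
  interpret Y: prob_space "distr M K Y" by (rule prob_space_distr) measurable
  note [measurable] = f
  have "(\<integral>\<^sup>+\<omega>. f (U \<omega>, Y \<omega>) \<partial>M) = (\<integral>\<^sup>+x. f x \<partial>distr M (N \<Otimes>\<^sub>M K) (\<lambda>\<omega>. (U \<omega>, Y \<omega>)))"
    by (subst nn_integral_distr) auto
  also have "distr M (N \<Otimes>\<^sub>M K) (\<lambda>\<omega>. (U \<omega>, Y \<omega>)) = distr M N U \<Otimes>\<^sub>M distr M K Y"
    by (rule distr_pair_indep_set[OF assms(1) U Y ind])
  also have "(\<integral>\<^sup>+x. f x \<partial>(distr M N U \<Otimes>\<^sub>M distr M K Y)) = (\<integral>\<^sup>+u. \<integral>\<^sup>+y. f (u, y) \<partial>distr M K Y \<partial>distr M N U)"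
    by (rule Y.nn_integral_fst[symmetric]) simp
  also have "\<dots> = (\<integral>\<^sup>+\<omega>'. \<integral>\<^sup>+y. f (U \<omega>', y) \<partial>distr M K Y \<partial>M)"
    by (subst nn_integral_distr) auto
  also have "\<dots> = (\<integral>\<^sup>+\<omega>'. \<integral>\<^sup>+\<omega>. f (U \<omega>', Y \<omega>) \<partial>M \<partial>M)"
    by (intro nn_integral_cong nn_integral_distr) (auto dest: measurable_space)
  finally show ?thesis .
qed

text \<open>Translates the logarithmic form of the sub-Gaussian hypothesis into the event-wise form
  of \<open>cond_subgaussian\<close>, through the defining property of conditional
  expectation.\<close>

lemma cond_exp_le_set_integral:
  assumes "prob_space M" and sub: "subalgebra M F"
    and int: "integrable M f" and f: "\<And>\<omega>. 0 < f \<omega>"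
    and le: "AE \<omega> in M. ln (real_cond_exp M F f \<omega>) \<le> b" and A: "A \<in> sets F"
  shows "(\<integral>\<^sup>+\<omega>. ennreal (f \<omega>) * indicator A \<omega> \<partial>M) \<le> ennreal (exp b) * emeasure M A"
proof -
  interpret prob_space M by fact
  interpret finite_measure_subalgebra M F by standard (rule sub)
  have AM [measurable]: "A \<in> sets M" using A sub by (auto simp: subalgebra_def)
  have fA: "integrable M (\<lambda>\<omega>. indicator A \<omega> * f \<omega>)"
    using int AM by (intro integrable_mult_indicator[where 'b = real, simplified]) auto
  have "AE \<omega> in M. real_cond_exp M F f \<omega> \<le> exp b"
    using le
  proof eventually_elim
    case (elim \<omega>)
    show ?case
    proof (cases "0 < real_cond_exp M F f \<omega>")
      case True
      with elim show ?thesis by (metis exp_le_cancel_iff exp_ln)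
    next
      \<comment> \<open>Where the chosen version is not positive its logarithm is not informative,
        but \<open>exp b\<close> is then trivially larger.\<close>
      case False
      then show ?thesis by (auto intro: order_trans[of _ 0])
    qed
  qed
  then have "(\<integral>\<omega>\<in>A. real_cond_exp M F f \<omega> \<partial>M) \<le> (\<integral>\<omega>\<in>A. exp b \<partial>M)"
    unfolding set_lebesgue_integral_def
    using real_cond_exp_int(1)[OF int] AM
    by (intro integral_mono_AE integrable_mult_indicator) (auto simp: indicator_def elim!: eventually_mono)
  also have "\<dots> = exp b * measure M A"
    by (simp add: set_lebesgue_integral_def)
  finally have "(\<integral>\<omega>\<in>A. f \<omega> \<partial>M) \<le> exp b * measure M A"
    using real_cond_exp_intA[OF int A] by simp
  then have le: "(\<integral>\<omega>. indicator A \<omega> * f \<omega> \<partial>M) \<le> exp b * measure M A"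
    by (simp add: set_lebesgue_integral_def)
  have "(\<integral>\<^sup>+\<omega>. ennreal (f \<omega>) * indicator A \<omega> \<partial>M) = (\<integral>\<^sup>+\<omega>. ennreal (indicator A \<omega> * f \<omega>) \<partial>M)"
    by (intro nn_integral_cong) (auto simp: indicator_def)
  also have "\<dots> = ennreal (\<integral>\<omega>. indicator A \<omega> * f \<omega> \<partial>M)"
    using f by (intro nn_integral_eq_integral fA) (auto simp: less_imp_le)
  also have "\<dots> \<le> ennreal (exp b * measure M A)"
    using le by (rule ennreal_leI)
  also have "\<dots> = ennreal (exp b) * emeasure M A"
    by (simp add: emeasure_eq_measure ennreal_mult)
  finally show ?thesis .
qed

text \<open>Freezing the seed turns an event of the seeded past into an event of the history, where the
  shock is sub-Gaussian; Fubini then integrates over the independent seed.\<close>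

lemma cond_subgaussian_seeded_past:
  assumes M: "prob_space M"
    and U [measurable]: "U \<in> M \<rightarrow>\<^sub>M N"
    and ind: "prob_space.indep_set M (preimages (space M) U N)
      (preimages (space M) (\<lambda>\<omega>. \<lambda>t\<in>{1..T}. \<epsilon> t \<omega>) (Pi\<^sub>M {1..T} (\<lambda>_. borel)))"
    and \<epsilon>: "\<And>s. s \<in> {1..T} \<Longrightarrow> \<epsilon> s \<in> borel_measurable M" and t: "t < T"
    and H: "subalgebra M H" "\<And>s. s \<in> {1..t} \<Longrightarrow> \<epsilon> s \<in> borel_measurable H"
    and int: "\<And>s. integrable M (\<lambda>\<omega>. exp (s * \<epsilon> (Suc t) \<omega>))"
    and le: "\<And>s. AE \<omega> in M. ln (real_cond_exp M H (\<lambda>\<omega>'. exp (s * \<epsilon> (Suc t) \<omega>')) \<omega>) \<le> \<sigma>\<^sup>2 * s\<^sup>2 / 2"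
  shows "cond_subgaussian M (seeded_past (space M) U N \<epsilon> t) \<sigma> (\<epsilon> (Suc t))"
proof -
  interpret prob_space M by fact
  let ?K = "Pi\<^sub>M {1..T} (\<lambda>_. borel :: real measure)" and ?L = "Pi\<^sub>M {1..t} (\<lambda>_. borel :: real measure)"
  let ?E = "\<lambda>\<omega>. \<lambda>t\<in>{1..T}. \<epsilon> t \<omega>" and ?P = "\<lambda>\<omega>. \<lambda>s\<in>{1..t}. \<epsilon> s \<omega>"
  have E: "?E \<in> M \<rightarrow>\<^sub>M ?K" using \<epsilon> by (intro measurable_restrict)
  have sub: "subalgebra M (seeded_past (space M) U N \<epsilon> t)"
    using U \<epsilon> t by (intro subalgebra_seeded_past) auto
  have tr: "(\<lambda>y. restrict y {1..t}) \<in> ?K \<rightarrow>\<^sub>M ?L"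
    using t by (intro measurable_restrict_subset) auto
  have comp: "(\<lambda>y. y (Suc t)) \<in> ?K \<rightarrow>\<^sub>M borel"
    using t measurable_component_singleton[of "Suc t" "{1..T}" "\<lambda>_. borel"] by simp
  have PE: "restrict (?E \<omega>) {1..t} = ?P \<omega>" for \<omega>
    using t by (auto simp: restrict_def fun_eq_iff)
  have PH: "?P \<in> H \<rightarrow>\<^sub>M ?L"
    using H(2) by (intro measurable_restrict)
  have "(\<integral>\<^sup>+\<omega>. ennreal (exp (s * \<epsilon> (Suc t) \<omega>)) * indicator A \<omega> \<partial>M)
      \<le> ennreal (exp (\<sigma>\<^sup>2 * s\<^sup>2 / 2)) * emeasure M A"
    if A: "A \<in> sets (seeded_past (space M) U N \<epsilon> t)" for s A
  proof -
    have AM [measurable]: "A \<in> sets M" using A sub by (auto simp: subalgebra_def)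
    have maps: "(\<lambda>\<omega>. (U \<omega>, ?P \<omega>)) \<in> space M \<rightarrow> space (N \<Otimes>\<^sub>M ?L)"
      using measurable_space[OF U] by (auto simp: space_pair_measure space_PiM)
    obtain S where S [measurable]: "S \<in> sets (N \<Otimes>\<^sub>M ?L)"
      and AS: "A = (\<lambda>\<omega>. (U \<omega>, ?P \<omega>)) -` S \<inter> space M"
      using A unfolding seeded_past_def sets_vimage_algebra2[OF maps] by blast
    \<comment> \<open>Independence concerns the full vector of \<open>T\<close> shocks, so the event
      is read as a function of the seed and the whole vector that looks only at the first
      \<open>t\<close> coordinates.\<close>
    define q where "q = (\<lambda>(u, y). indicator S (u, restrict y {1..t}) :: ennreal)"
    have pair: "(\<lambda>x. (fst x, restrict (snd x) {1..t})) \<in> N \<Otimes>\<^sub>M ?K \<rightarrow>\<^sub>M N \<Otimes>\<^sub>M ?L"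
      using tr by (intro measurable_Pair measurable_fst measurable_compose[OF measurable_snd])
    have q [measurable]: "q \<in> borel_measurable (N \<Otimes>\<^sub>M ?K)"
      unfolding q_def case_prod_beta
      using measurable_compose[OF pair borel_measurable_indicator[OF S]] by simp
    define f where "f = (\<lambda>x. ennreal (exp (s * snd x (Suc t))) * q x)"
    have f: "f \<in> borel_measurable (N \<Otimes>\<^sub>M ?K)"
      using measurable_compose[OF measurable_snd comp] unfolding f_def by measurable
    have qA: "q (U \<omega>, ?E \<omega>) = indicator A \<omega>" if "\<omega> \<in> space M" for \<omega>
      unfolding q_def prod.case PE using that by (simp add: AS indicator_def)
    have fA: "f (U \<omega>', ?E \<omega>) = ennreal (exp (s * \<epsilon> (Suc t) \<omega>)) * q (U \<omega>', ?E \<omega>)" for \<omega> \<omega>'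
      using t by (simp add: f_def)
    have "(\<integral>\<^sup>+\<omega>. ennreal (exp (s * \<epsilon> (Suc t) \<omega>)) * indicator A \<omega> \<partial>M) = (\<integral>\<^sup>+\<omega>. f (U \<omega>, ?E \<omega>) \<partial>M)"
      by (intro nn_integral_cong) (simp only: fA qA)
    also have "\<dots> = (\<integral>\<^sup>+\<omega>'. \<integral>\<^sup>+\<omega>. f (U \<omega>', ?E \<omega>) \<partial>M \<partial>M)"
      by (rule nn_integral_independent_seed[OF M U E ind f])
    also have "\<dots> \<le> (\<integral>\<^sup>+\<omega>'. ennreal (exp (\<sigma>\<^sup>2 * s\<^sup>2 / 2)) * (\<integral>\<^sup>+\<omega>. q (U \<omega>', ?E \<omega>) \<partial>M) \<partial>M)"
    proof (rule nn_integral_mono)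
      fix \<omega>' assume \<omega>': "\<omega>' \<in> space M"
      define C where "C = (\<lambda>\<omega>. (U \<omega>', ?P \<omega>)) -` S \<inter> space M"
      have "(\<lambda>\<omega>. (U \<omega>', ?P \<omega>)) \<in> H \<rightarrow>\<^sub>M N \<Otimes>\<^sub>M ?L"
        using PH measurable_space[OF U \<omega>'] by (intro measurable_Pair measurable_const)
      from measurable_sets[OF this S] have C: "C \<in> sets H"
        using H(1) by (simp add: C_def subalgebra_def)
      then have CM: "C \<in> sets M" using H(1) by (auto simp: subalgebra_def)
      have qC: "q (U \<omega>', ?E \<omega>) = indicator C \<omega>" if "\<omega> \<in> space M" for \<omega>
        unfolding q_def prod.case PE using that by (simp add: C_def indicator_def)
      have "(\<integral>\<^sup>+\<omega>. f (U \<omega>', ?E \<omega>) \<partial>M) = (\<integral>\<^sup>+\<omega>. ennreal (exp (s * \<epsilon> (Suc t) \<omega>)) * indicator C \<omega> \<partial>M)"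
        by (intro nn_integral_cong) (simp only: fA qC)
      also have "\<dots> \<le> ennreal (exp (\<sigma>\<^sup>2 * s\<^sup>2 / 2)) * emeasure M C"
        by (intro cond_exp_le_set_integral[OF M H(1) int _ le C]) simp
      also have "emeasure M C = (\<integral>\<^sup>+\<omega>. q (U \<omega>', ?E \<omega>) \<partial>M)"
        unfolding nn_integral_indicator[OF CM, symmetric] by (intro nn_integral_cong qC[symmetric])
      finally show "(\<integral>\<^sup>+\<omega>. f (U \<omega>', ?E \<omega>) \<partial>M)
          \<le> ennreal (exp (\<sigma>\<^sup>2 * s\<^sup>2 / 2)) * (\<integral>\<^sup>+\<omega>. q (U \<omega>', ?E \<omega>) \<partial>M)" .
    qed
    also have "\<dots> = (\<integral>\<^sup>+\<omega>'. \<integral>\<^sup>+\<omega>. ennreal (exp (\<sigma>\<^sup>2 * s\<^sup>2 / 2)) * q (U \<omega>', ?E \<omega>) \<partial>M \<partial>M)"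
    proof (rule nn_integral_cong)
      fix \<omega>' assume \<omega>': "\<omega>' \<in> space M"
      from E have "(\<lambda>\<omega>. (U \<omega>', ?E \<omega>)) \<in> M \<rightarrow>\<^sub>M N \<Otimes>\<^sub>M ?K"
        using measurable_space[OF U \<omega>'] by (intro measurable_Pair measurable_const)
      from measurable_compose[OF this q]
      show "ennreal (exp (\<sigma>\<^sup>2 * s\<^sup>2 / 2)) * (\<integral>\<^sup>+\<omega>. q (U \<omega>', ?E \<omega>) \<partial>M)
          = (\<integral>\<^sup>+\<omega>. ennreal (exp (\<sigma>\<^sup>2 * s\<^sup>2 / 2)) * q (U \<omega>', ?E \<omega>) \<partial>M)"
        by (rule nn_integral_cmult[symmetric])
    qed
    also have "\<dots> = (\<integral>\<^sup>+\<omega>. ennreal (exp (\<sigma>\<^sup>2 * s\<^sup>2 / 2)) * q (U \<omega>, ?E \<omega>) \<partial>M)"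
      by (rule nn_integral_independent_seed[OF M U E ind, symmetric]) measurable
    also have "\<dots> = (\<integral>\<^sup>+\<omega>. ennreal (exp (\<sigma>\<^sup>2 * s\<^sup>2 / 2)) * indicator A \<omega> \<partial>M)"
      by (intro nn_integral_cong) (simp only: qA)
    also have "\<dots> = ennreal (exp (\<sigma>\<^sup>2 * s\<^sup>2 / 2)) * emeasure M A"
      by (rule nn_integral_cmult_indicator) simp
    finally show ?thesis .
  qed
  then show ?thesis
    using sub \<epsilon>[of "Suc t"] t by (simp add: cond_subgaussian_def)
qed

section \<open>Measurability of prices and of the history\<close>

lemma sets_sigma_subset:
  assumes "space F = \<Omega>" "\<And>A. A \<in> G \<Longrightarrow> A \<in> sets F"
  shows "sets (sigma \<Omega> G) \<subseteq> sets F"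
proof -
  have "G \<subseteq> Pow \<Omega>" using assms sets.sets_into_space by blast
  then have "sets (sigma \<Omega> G) = sigma_sets \<Omega> G" by (rule sets_measure_of)
  then show ?thesis
    using sets.sigma_sets_subset[of G F] assms by auto
qed

lemma preimages_subset_sets:
  assumes "A \<in> preimages (space F) f N" "f \<in> F \<rightarrow>\<^sub>M N"
  shows "A \<in> sets F"
  using assms by (auto simp: preimages_def intro: measurable_sets)

text \<open>Each round the price is a function of the seed and earlier demands, and the demand a
  function of the price and the shock; so all past prices reduce to the seed and past shocks.\<close>

lemma policy_measurable_seeded_past:
  fixes p D \<epsilon> :: "nat \<Rightarrow> 'w \<Rightarrow> real"
  assumes U: "U \<in> \<Omega> \<rightarrow> space N"
    and D: "\<And>t \<omega>. t \<in> {1..T} \<Longrightarrow> \<omega> \<in> \<Omega> \<Longrightarrow> D t \<omega> = f t (p t \<omega>) + \<epsilon> t \<omega>"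
    and f: "\<And>t. f t \<in> borel_measurable borel"
    and p: "\<And>t. t \<in> {1..T} \<Longrightarrow> p t \<in> borel_measurable (policy_algebra \<Omega> U N x p D t)"
    and t: "t < T"
  shows "p (Suc t) \<in> borel_measurable (seeded_past \<Omega> U N \<epsilon> t)"
  using t
proof (induction t rule: less_induct)
  case (less t)
  let ?F = "seeded_past \<Omega> U N \<epsilon> t"
  have UF: "U \<in> ?F \<rightarrow>\<^sub>M N" using seeded_past_components(1)[OF U] .
  have pF: "p s \<in> borel_measurable ?F" if "s \<in> {1..t}" for s
  proof -
    obtain r where r: "s = Suc r" "r < t" using \<open>s \<in> {1..t}\<close> by (cases s) auto
    have "p (Suc r) \<in> borel_measurable (seeded_past \<Omega> U N \<epsilon> r)"
      using less r by simp
    then show ?thesis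
      unfolding r(1) by (rule measurable_from_subalg[OF seeded_past_mono[OF U less_imp_le[OF r(2)]]])
  qed
  have DF: "D s \<in> borel_measurable ?F" if s: "s \<in> {1..t}" for s
  proof -
    have [measurable]: "f s \<in> borel_measurable borel" "p s \<in> borel_measurable ?F" "\<epsilon> s \<in> borel_measurable ?F"
      using f pF[OF s] seeded_past_components(2)[OF U s] by auto
    have "(\<lambda>\<omega>. f s (p s \<omega>) + \<epsilon> s \<omega>) \<in> borel_measurable ?F" by measurable
    then show ?thesis
      by (rule measurable_cong[THEN iffD1, rotated]) (use D s less.prems in auto)
  qed
  have space: "space (policy_algebra \<Omega> U N x p D (Suc t)) = \<Omega>"
    unfolding policy_algebra_def by (intro space_measure_of) (auto simp: preimages_def)
  have "sets (policy_algebra \<Omega> U N x p D (Suc t)) \<subseteq> sets ?F"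
    unfolding policy_algebra_def
  proof (rule sets_sigma_subset)
    fix A
    assume "A \<in> preimages \<Omega> U N \<union> (\<Union>s\<in>{1..Suc t}. preimages \<Omega> (\<lambda>_. x s) borel) \<union>
       (\<Union>s\<in>{1..<Suc t}. preimages \<Omega> (D s) borel) \<union> (\<Union>s\<in>{1..<Suc t}. preimages \<Omega> (p s) borel)"
    then show "A \<in> sets ?F"
      by (elim UnE UN_E) (rule preimages_subset_sets[of _ ?F], simp, simp add: UF DF pF)+
  qed simp
  then have "subalgebra ?F (policy_algebra \<Omega> U N x p D (Suc t))"
    using space by (simp add: subalgebra_def)
  then show ?case
    using p[of "Suc t"] less.prems by (intro measurable_from_subalg[of ?F]) auto
qed

lemma history_algebra_subalgebra:
  assumes "\<And>s. s \<in> {1..t} \<Longrightarrow> p s \<in> borel_measurable M" "\<And>s. s \<in> {1..t} \<Longrightarrow> \<epsilon> s \<in> borel_measurable M"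
  shows "subalgebra M (history_algebra (space M) x p \<epsilon> t)"
    and "s \<in> {1..t} \<Longrightarrow> \<epsilon> s \<in> borel_measurable (history_algebra (space M) x p \<epsilon> t)"
proof -
  let ?G = "(\<Union>s\<in>{1..t}. preimages (space M) (p s) borel) \<union>
              (\<Union>s\<in>{1..t}. preimages (space M) (\<epsilon> s) borel) \<union>
              (\<Union>s\<in>{1..t + 1}. preimages (space M) (\<lambda>_. x s) borel)"
  have G: "?G \<subseteq> Pow (space M)" by (auto simp: preimages_def)
  have space: "space (history_algebra (space M) x p \<epsilon> t) = space M"
    unfolding history_algebra_def using G by (rule space_measure_of)
  have "sets (history_algebra (space M) x p \<epsilon> t) \<subseteq> sets M"
    unfolding history_algebra_def
  proof (rule sets_sigma_subset)
    show "A \<in> sets M" if "A \<in> ?G" for A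
      using that by (elim UnE UN_E) (erule preimages_subset_sets, simp add: assms)+
  qed simp
  then show "subalgebra M (history_algebra (space M) x p \<epsilon> t)"
    using space by (simp add: subalgebra_def)
  assume s: "s \<in> {1..t}"
  show "\<epsilon> s \<in> borel_measurable (history_algebra (space M) x p \<epsilon> t)"
  proof (rule measurableI)
    fix A :: "real set" assume "A \<in> sets borel"
    then have "\<epsilon> s -` A \<inter> space M \<in> ?G" using s by (auto simp: preimages_def)
    then show "\<epsilon> s -` A \<inter> space (history_algebra (space M) x p \<epsilon> t) \<in> sets (history_algebra (space M) x p \<epsilon> t)"
      unfolding space unfolding history_algebra_def using G by (simp add: sets_measure_of sigma_sets.Basic)
  qed simp
qed

section \<open>Regret\<close>

lemma ln_ratio_le:
  assumes "1 \<le> d" "2 \<le> n"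
  shows "0 \<le> ln ((2 * real d + real n) / (2 * real d))"
    and "ln ((2 * real d + real n) / (2 * real d)) \<le> 2 * ln (real n)"
proof -
  have eq: "(2 * real d + real n) / (2 * real d) = 1 + real n / (2 * real d)"
    using assms by (simp add: field_simps)
  show "0 \<le> ln ((2 * real d + real n) / (2 * real d))"
    unfolding eq by simp
  have "real n * 1 \<le> real n * (2 * real d)"
    using assms by (intro mult_left_mono) auto
  then have "real n / (2 * real d) \<le> real n"
    using assms by (simp add: pos_divide_le_eq)
  moreover have "1 + real n \<le> (real n)\<^sup>2"
  proof -
    have "1 + real n \<le> 2 * real n" using assms by simp
    also have "\<dots> \<le> real n * real n" using assms by (intro mult_right_mono) auto
    finally show ?thesis by (simp add: power2_eq_square)
  qed
  ultimately have "ln (1 + real n / (2 * real d)) \<le> ln ((real n)\<^sup>2)"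
    using assms by (intro ln_mono) (auto intro!: add_pos_nonneg)
  then show "ln ((2 * real d + real n) / (2 * real d)) \<le> 2 * ln (real n)"
    unfolding eq using assms by (simp add: ln_realpow)
qed

text \<open>The filter lets \<open>n\<close> grow uniformly over all \<open>d\<close> from 1 on,
  with the other parameters fixed. The confidence radius and the potential each contribute a square
  root of \<open>d\<close>. The exponent 2 is generous: \<open>sqrt l \<le> l\<close> is used in
  both factors.\<close>

lemma regret_bound_bigo:
  "(\<lambda>(d, n). regret_bound gup glow pu Dbar B sig d n)
    \<in> O[principal {1..} \<times>\<^sub>F at_top](\<lambda>(d, n). real d * sqrt (real n) * ln (real n) ^ 2)"
proof -
  define a b c where "a = 4 * \<bar>gup * pu\<bar>" and "b = 2 * \<bar>B\<bar>" and "c = 2 * \<bar>sig / glow\<bar>"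
  \<comment> \<open>The 6 comes from \<open>2 * l + 2 * d * r \<le> 6 * d * l\<close> and the 2 from
    \<open>r \<le> 2 * l\<close>; the condition \<open>3 \<le> n\<close> below makes
    \<open>l\<close> at least 1.\<close>
  define K where "K = a * (b + c * sqrt 6) * sqrt 2 + \<bar>pu * Dbar\<bar>"
  have abc: "0 \<le> a" "0 \<le> b" "0 \<le> c" by (simp_all add: a_def b_def c_def)
  have bound: "\<bar>regret_bound gup glow pu Dbar B sig d n\<bar> \<le> K * (real d * sqrt (real n) * ln (real n) ^ 2)"
    if d: "1 \<le> d" and n: "3 \<le> n" for d n :: nat
  proof -
    define l where "l = ln (real n)"
    define r where "r = ln ((2 * real d + real n) / (2 * real d))"
    have r: "0 \<le> r" "r \<le> 2 * l" using ln_ratio_le[of d n] d n by (simp_all add: r_def l_def)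
    have "exp 1 \<le> real n" using exp_le n by linarith
    then have l: "1 \<le> l" using n by (simp add: l_def ln_ge_iff)
    define s where "s = sqrt (real d)"
    have s: "1 \<le> s" "s * s = real d" using d by (simp_all add: s_def)
    have l2: "sqrt l \<le> l"
      using l by (intro real_le_lsqrt) (auto simp: power2_eq_square)
    have "2 * l + 2 * real d * r \<le> 6 * real d * l"
    proof -
      have "2 * l * 1 \<le> 2 * l * real d" "2 * real d * r \<le> 2 * real d * (2 * l)"
        using d l r by (auto intro!: mult_left_mono)
      then show ?thesis by (simp add: algebra_simps)
    qed
    then have "sqrt (2 * l + 2 * real d * r) \<le> sqrt (6 * real d * l)"
      by simp
    also have "\<dots> = sqrt 6 * s * sqrt l" by (simp add: real_sqrt_mult s_def)
    also have "\<dots> \<le> sqrt 6 * s * l" using l2 s by (intro mult_left_mono) auto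
    finally have q: "sqrt (2 * l + 2 * real d * r) \<le> sqrt 6 * s * l" .
    have q0: "0 \<le> sqrt (2 * l + 2 * real d * r)" using l r by simp
    have "\<bar>gamma_bar B sig glow d n\<bar> \<le> b + c * sqrt (2 * l + 2 * real d * r)"
      unfolding gamma_bar_def b_def c_def l_def[symmetric] r_def[symmetric]
      using q0 by (intro order_trans[OF abs_triangle_ineq]) (simp add: abs_mult)
    also have "\<dots> \<le> b * (s * l) + c * (sqrt 6 * s * l)"
      using abc q mult_mono[of 1 s 1 l] s l by (intro add_mono mult_left_mono mult_left_le[THEN order_trans]) (auto simp: mult_le_cancel_left1)
    also have "\<dots> = (b + c * sqrt 6) * (s * l)" by (simp add: algebra_simps)
    finally have g: "\<bar>gamma_bar B sig glow d n\<bar> \<le> (b + c * sqrt 6) * (s * l)" .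
    have "sqrt (real n * real d * r) \<le> sqrt (real n * real d * (2 * l))"
      using r by (intro real_sqrt_le_mono mult_left_mono) auto
    also have "\<dots> = sqrt 2 * sqrt (real n) * s * sqrt l" by (simp add: real_sqrt_mult s_def)
    also have "\<dots> \<le> sqrt 2 * sqrt (real n) * s * l" using l2 s by (intro mult_left_mono) auto
    finally have w: "sqrt (real n * real d * r) \<le> sqrt 2 * sqrt (real n) * s * l" .
    have w0: "0 \<le> sqrt (real n * real d * r)" using r by simp
    have "\<bar>regret_bound gup glow pu Dbar B sig d n\<bar>
        \<le> a * \<bar>gamma_bar B sig glow d n\<bar> * sqrt (real n * real d * r) + \<bar>pu * Dbar\<bar>"
      unfolding regret_bound_def r_def[symmetric] a_def using w0
      by (intro order_trans[OF abs_triangle_ineq]) (simp add: abs_mult)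
    also have "\<dots> \<le> a * ((b + c * sqrt 6) * (s * l)) * (sqrt 2 * sqrt (real n) * s * l) + \<bar>pu * Dbar\<bar> * (real d * sqrt (real n) * l ^ 2)"
    proof (intro add_mono mult_mono mult_left_mono g w abc w0)
      have "1 * 1 * 1 \<le> real d * sqrt (real n) * l ^ 2"
        using d n l by (intro mult_mono) auto
      then show "\<bar>pu * Dbar\<bar> \<le> \<bar>pu * Dbar\<bar> * (real d * sqrt (real n) * l ^ 2)"
        by (simp add: mult_le_cancel_left1)
    qed (use abc s l in auto)
    also have "\<dots> = K * (real d * sqrt (real n) * l ^ 2)"
      by (simp add: K_def s(2)[symmetric] power2_eq_square algebra_simps)
    finally show ?thesis by (simp add: l_def)
  qed
  show ?thesis
  proof (rule landau_o.bigI[where c = "K + 1"])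
    \<comment> \<open>The added 1 keeps the constant positive even if \<open>K\<close> is
      zero.\<close>
    show "0 < K + 1" using abc by (simp add: K_def add_nonneg_pos)
    have "\<forall>\<^sub>F x in principal {1..} \<times>\<^sub>F at_top. 1 \<le> fst x \<and> 3 \<le> (snd x :: nat)"
      by (intro eventually_prodI) (auto simp: eventually_principal eventually_ge_at_top)
    then show "\<forall>\<^sub>F x in principal {1..} \<times>\<^sub>F at_top.
        norm (case x of (d, n) \<Rightarrow> regret_bound gup glow pu Dbar B sig d n)
        \<le> (K + 1) * norm (case x of (d, n) \<Rightarrow> real d * sqrt (real n) * (ln (real n))\<^sup>2)"
    proof (rule eventually_mono)
      fix x :: "nat \<times> nat"
      assume "1 \<le> fst x \<and> 3 \<le> snd x"
      then obtain d n where x: "x = (d, n)" "1 \<le> d" "3 \<le> n" by (cases x) auto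
      have "K * (real d * sqrt (real n) * ln (real n) ^ 2) \<le> (K + 1) * (real d * sqrt (real n) * ln (real n) ^ 2)"
        by (intro mult_right_mono) auto
      then have "\<bar>regret_bound gup glow pu Dbar B sig d n\<bar> \<le> (K + 1) * (real d * sqrt (real n) * ln (real n) ^ 2)"
        using bound[OF x(2,3)] by linarith
      then show "norm (case x of (d, n) \<Rightarrow> regret_bound gup glow pu Dbar B sig d n)
        \<le> (K + 1) * norm (case x of (d, n) \<Rightarrow> real d * sqrt (real n) * (ln (real n))\<^sup>2)"
        using x by (simp add: abs_mult)
    qed
  qed
qed

text \<open>The moment bound for \<open>s\<close> of both signs makes \<open>f\<close> nonnegative;
  since \<open>f 0 = 0\<close>, its derivative \<open>- m\<close> at 0 vanishes. Applied to a price
  and the shock of the same round, this removes the shocks from the expected revenue.\<close>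

lemma cond_subgaussian_uncorrelated:
  assumes M: "prob_space M" and e: "cond_subgaussian M F \<sigma> e" and int: "integrable M e"
    and y: "y \<in> borel_measurable F" and bnd: "\<And>\<omega>. \<omega> \<in> space M \<Longrightarrow> 0 \<le> y \<omega> \<and> y \<omega> \<le> C"
  shows "(\<integral>\<omega>. y \<omega> * e \<omega> \<partial>M) = 0"
proof -
  interpret prob_space M by fact
  have [measurable]: "e \<in> borel_measurable M" using int by auto
  have yM [measurable]: "y \<in> borel_measurable M"
    using e y by (auto simp: cond_subgaussian_def intro: measurable_from_subalg)
  have iy: "integrable M y"
    using bnd by (intro integrable_const_bound[where B = C]) auto
  have iye: "integrable M (\<lambda>\<omega>. y \<omega> * e \<omega>)"
  proof (rule Bochner_Integration.integrable_bound[OF integrable_mult_right[OF int, of C]])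
    have "\<bar>y \<omega> * e \<omega>\<bar> \<le> \<bar>C * e \<omega>\<bar>" if "\<omega> \<in> space M" for \<omega>
      unfolding abs_mult using bnd[OF that] by (intro mult_right_mono) auto
    then show "AE \<omega> in M. norm (y \<omega> * e \<omega>) \<le> norm (C * e \<omega>)" by (intro AE_I2) simp
  qed measurable
  define m Y where "m = (\<integral>\<omega>. y \<omega> * e \<omega> \<partial>M)" and "Y = (\<integral>\<omega>. y \<omega> \<partial>M)"
  define f where "f s = exp (\<sigma>\<^sup>2 * s\<^sup>2 / 2) * Y - Y - s * m" for s
  have "0 \<le> f s" for s
  proof -
    let ?c = "\<sigma>\<^sup>2 * s\<^sup>2 / 2"
    let ?h = "\<lambda>\<omega>. y \<omega> * exp (s * e \<omega> - ?c)"
    have le: "(\<integral>\<^sup>+\<omega>. ennreal (?h \<omega>) \<partial>M) \<le> ennreal Y"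
    proof -
      have "(\<integral>\<^sup>+\<omega>. ennreal (?h \<omega>) \<partial>M) = (\<integral>\<^sup>+\<omega>. ennreal (y \<omega>) * ennreal (exp (s * e \<omega> - ?c)) \<partial>M)"
        using bnd by (intro nn_integral_cong) (simp add: ennreal_mult)
      also have "\<dots> \<le> (\<integral>\<^sup>+\<omega>. ennreal (y \<omega>) \<partial>M)"
        by (intro cond_subgaussian_const[OF e] measurable_compose[OF y measurable_ennreal])
      also have "\<dots> = ennreal Y"
        unfolding Y_def using bnd by (intro nn_integral_eq_integral iy) (auto intro!: AE_I2)
      finally show ?thesis .
    qed
    have h0: "0 \<le> ?h \<omega>" if "\<omega> \<in> space M" for \<omega>
      using bnd[OF that] by simp
    have ih: "integrable M ?h"
    proof (rule integrableI_bounded)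
      have "(\<integral>\<^sup>+\<omega>. ennreal (norm (?h \<omega>)) \<partial>M) = (\<integral>\<^sup>+\<omega>. ennreal (?h \<omega>) \<partial>M)"
        using h0 by (intro nn_integral_cong) simp
      then show "(\<integral>\<^sup>+\<omega>. ennreal (norm (?h \<omega>)) \<partial>M) < \<infinity>"
        using le by (simp add: le_less_trans)
    qed measurable
    have Y0: "0 \<le> Y" unfolding Y_def using bnd by (intro integral_nonneg_AE AE_I2) auto
    have "ennreal (\<integral>\<omega>. ?h \<omega> \<partial>M) = (\<integral>\<^sup>+\<omega>. ennreal (?h \<omega>) \<partial>M)"
      using h0 by (intro nn_integral_eq_integral[symmetric] ih) auto
    with le have hY: "(\<integral>\<omega>. ?h \<omega> \<partial>M) \<le> Y"
      using Y0 by (metis ennreal_le_iff)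
    have "Y + s * m = (\<integral>\<omega>. y \<omega> + s * (y \<omega> * e \<omega>) \<partial>M)"
      using iy iye by (simp add: Y_def m_def)
    also have "\<dots> \<le> (\<integral>\<omega>. exp ?c * ?h \<omega> \<partial>M)"
    proof (rule integral_mono)
      show "integrable M (\<lambda>\<omega>. y \<omega> + s * (y \<omega> * e \<omega>))" "integrable M (\<lambda>\<omega>. exp ?c * ?h \<omega>)"
        using iy iye ih by auto
      fix \<omega> assume \<omega>: "\<omega> \<in> space M"
      have "y \<omega> * (1 + s * e \<omega>) \<le> y \<omega> * exp (s * e \<omega>)"
        using bnd[OF \<omega>] exp_ge_add_one_self[of "s * e \<omega>"] by (intro mult_left_mono) auto
      then show "y \<omega> + s * (y \<omega> * e \<omega>) \<le> exp ?c * ?h \<omega>"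
        by (simp add: algebra_simps exp_add[symmetric])
    qed
    also have "\<dots> = exp ?c * (\<integral>\<omega>. ?h \<omega> \<partial>M)" by simp
    also have "\<dots> \<le> exp ?c * Y" using hY by (intro mult_left_mono) auto
    finally show ?thesis by (simp add: f_def)
  qed
  moreover have "f 0 = 0" by (simp add: f_def)
  moreover have "(f has_real_derivative - m) (at 0)"
    unfolding f_def[abs_def] by (auto intro!: derivative_eq_intros)
  ultimately have "- m = 0"
    by (intro DERIV_local_min[of f _ 0 1]) auto
  then show ?thesis by (simp add: m_def)
qed

section \<open>Deterministic analysis of one trajectory\<close>

lemma upper_block_vstack [simp]: "upper_block (vstack a b) = a"
  and lower_block_vstack [simp]: "lower_block (vstack a b) = b"
  and vstack_blocks [simp]: "vstack (upper_block \<theta>) (lower_block \<theta>) = \<theta>"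
  by (simp_all add: upper_block_def lower_block_def vstack_def vec_eq_iff split: sum.split)

lemma vstack_inner: "vstack a b \<bullet> \<theta> = a \<bullet> upper_block \<theta> + b \<bullet> lower_block \<theta>"
  by (simp add: inner_vec_def vstack_def upper_block_def lower_block_def
      UNIV_Plus_UNIV[symmetric] sum.Plus del: UNIV_Plus_UNIV)

lemma feature_inner: "feature x q \<bullet> \<theta> = x \<bullet> upper_block \<theta> + (x \<bullet> lower_block \<theta>) * q"
  by (simp add: feature_def vstack_inner)

lemma feature_nth: "feature x q $ i = (case i of Inl j \<Rightarrow> x $ j | Inr j \<Rightarrow> q * x $ j)"
  by (simp add: feature_def vstack_def split: sum.split)

lemma weighted_norm_minus: "weighted_norm A (- v) = weighted_norm A v"
  using matrix_vector_mult_diff_distrib[of A 0 v] by (simp add: weighted_norm_def)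

lemma weighted_norm_sq:
  "(weighted_norm (design_matrix 1 z t) v)\<^sup>2 = (norm v)\<^sup>2 + (\<Sum>s=1..t. (z s \<bullet> v)\<^sup>2)"
  unfolding weighted_norm_def using design_matrix_psd[of 1 v z t]
  by (simp add: design_quadratic_form)

text \<open>Comparing the objective at the maximizer with its value at the truth costs a factor 2 against the
  first-order condition, but needs no differentiation of the objective.\<close>

lemma estimator_error:
  fixes z :: "nat \<Rightarrow> real ^ 'n::finite"
  assumes glow: "0 < glow"
    and th: "norm \<theta> \<le> B"
    and opt: "penalized_loglik g glow 1 z D t \<theta> \<le> penalized_loglik g glow 1 z D t \<theta>h"
    and gap: "\<And>s. s \<in> {1..t} \<Longrightarrow> quasi_loglik g (z s) (D s) \<theta>h - quasi_loglik g (z s) (D s) \<theta>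
      \<le> (D s - g (z s \<bullet> \<theta>)) * (z s \<bullet> (\<theta>h - \<theta>)) - glow / 2 * (z s \<bullet> (\<theta>h - \<theta>))\<^sup>2"
  shows "weighted_norm (design_matrix 1 z t) (\<theta> - \<theta>h)
    \<le> 2 * B + 2 / glow * sqrt (leverage z t (\<Sum>s=1..t. (D s - g (z s \<bullet> \<theta>)) *\<^sub>R z s))"
proof -
  define \<Delta> where "\<Delta> = \<theta>h - \<theta>"
  define S where "S = (\<Sum>s=1..t. (D s - g (z s \<bullet> \<theta>)) *\<^sub>R z s)"
  define n where "n = weighted_norm (design_matrix 1 z t) \<Delta>"
  have n0: "0 \<le> n" by (simp add: n_def weighted_norm_def design_matrix_psd)
  have "penalized_loglik g glow 1 z D t \<theta>h - penalized_loglik g glow 1 z D t \<theta>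
      = - (glow / 2) * ((norm \<theta>h)\<^sup>2 - (norm \<theta>)\<^sup>2)
        + (\<Sum>s=1..t. quasi_loglik g (z s) (D s) \<theta>h - quasi_loglik g (z s) (D s) \<theta>)"
    by (simp add: penalized_loglik_def sum_subtractf algebra_simps)
  also have "\<dots> \<le> - (glow / 2) * ((norm \<theta>h)\<^sup>2 - (norm \<theta>)\<^sup>2)
        + (\<Sum>s=1..t. (D s - g (z s \<bullet> \<theta>)) * (z s \<bullet> \<Delta>) - glow / 2 * (z s \<bullet> \<Delta>)\<^sup>2)"
    using gap by (intro add_left_mono sum_mono) (simp add: \<Delta>_def)
  \<comment> \<open>The ridge penalty contributes the identity part of the design matrix and the
    curvature of the quasi-likelihood the rest; together they form the square of
    \<open>n\<close>.\<close>
  also have "\<dots> = - (glow / 2) * (n\<^sup>2 + 2 * (\<theta> \<bullet> \<Delta>)) + S \<bullet> \<Delta>"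
  proof -
    have "(norm \<theta>h)\<^sup>2 - (norm \<theta>)\<^sup>2 = (norm \<Delta>)\<^sup>2 + 2 * (\<theta> \<bullet> \<Delta>)"
      by (simp add: power2_norm_eq_inner \<Delta>_def inner_diff_left inner_diff_right inner_commute)
    moreover have "(\<Sum>s=1..t. (D s - g (z s \<bullet> \<theta>)) * (z s \<bullet> \<Delta>) - glow / 2 * (z s \<bullet> \<Delta>)\<^sup>2)
        = S \<bullet> \<Delta> - glow / 2 * (\<Sum>s=1..t. (z s \<bullet> \<Delta>)\<^sup>2)"
      by (simp add: S_def inner_sum_left sum_subtractf sum_distrib_left)
    ultimately show ?thesis
      by (simp add: n_def weighted_norm_sq algebra_simps)
  qed
  finally have "glow / 2 * n\<^sup>2 \<le> S \<bullet> \<Delta> + glow * \<bar>\<theta> \<bullet> \<Delta>\<bar>"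
    using opt glow mult_left_mono[OF abs_ge_minus_self[of "\<theta> \<bullet> \<Delta>"], of glow] by (simp add: algebra_simps)
  also have "S \<bullet> \<Delta> \<le> sqrt (leverage z t S) * n"
    using design_Cauchy_Schwarz[of S \<Delta> z t] by (simp add: n_def)
  \<comment> \<open>The inverse design matrix is at most the identity, so the leverage of
    \<open>\<theta>\<close> is at most its squared norm.\<close>
  also have "\<bar>\<theta> \<bullet> \<Delta>\<bar> \<le> B * n"
  proof -
    have "sqrt (leverage z t \<theta>) \<le> sqrt ((norm \<theta>)\<^sup>2)"
      by (intro real_sqrt_le_mono leverage_le_norm)
    then have "sqrt (leverage z t \<theta>) * n \<le> B * n"
      using th n0 by (intro mult_right_mono) auto
    then show ?thesis
      using design_Cauchy_Schwarz[of \<theta> \<Delta> z t] by (simp add: n_def)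
  qed
  finally have "glow / 2 * n\<^sup>2 \<le> sqrt (leverage z t S) * n + glow * (B * n)"
    using glow by simp
  then have "n * n \<le> (2 * B + 2 / glow * sqrt (leverage z t S)) * n"
    using glow by (simp add: field_simps power2_eq_square)
  moreover have "0 \<le> 2 * B + 2 / glow * sqrt (leverage z t S)"
    using glow order_trans[OF norm_ge_zero th] leverage_nonneg[of z t S] by (intro add_nonneg_nonneg) auto
  ultimately have "n \<le> 2 * B + 2 / glow * sqrt (leverage z t S)"
    using n0 by (cases "n = 0") auto
  moreover have "n = weighted_norm (design_matrix 1 z t) (\<theta> - \<theta>h)"
    using weighted_norm_minus[of _ "\<theta>h - \<theta>"] by (simp add: n_def \<Delta>_def)
  ultimately show ?thesis by (simp add: S_def)
qed

text \<open>Multiples of the feature within the parameter ball realize every \<open>v\<close> in the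
  interval as an inner product. The mean value theorem and the integral of the quasi-likelihood need
  the bounds on a whole interval.\<close>

lemma deriv_bounds_interval:
  fixes g :: "real \<Rightarrow> real" and X :: "(real ^ 'd::finite) set"
  assumes deriv_bounds: "\<And>y a b q. y \<in> X \<Longrightarrow> vstack a b \<in> param_space B \<Longrightarrow> q \<in> {pl..pu} \<Longrightarrow>
          glow \<le> deriv g (y \<bullet> a + (y \<bullet> b) * q) \<and> deriv g (y \<bullet> a + (y \<bullet> b) * q) \<le> gup"
    and y: "y \<in> X" and q: "q \<in> {pl..pu}" and B: "0 \<le> B" and v: "\<bar>v\<bar> \<le> B * norm (feature y q)"
  shows "glow \<le> deriv g v" "deriv g v \<le> gup"
proof -
  let ?z = "feature y q"
  \<comment> \<open>If the feature is zero, division by zero gives \<open>\<theta> = 0\<close>, and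
    \<open>v\<close> is zero as well.\<close>
  define \<theta> where "\<theta> = (v / (norm ?z)\<^sup>2) *\<^sub>R ?z"
  have "?z \<bullet> \<theta> = v"
    using v by (cases "norm ?z = 0") (auto simp: \<theta>_def power2_norm_eq_inner)
  moreover have "norm \<theta> \<le> B"
    using v B by (cases "norm ?z = 0") (auto simp: \<theta>_def power2_eq_square field_simps)
  ultimately show "glow \<le> deriv g v" "deriv g v \<le> gup"
    using deriv_bounds[OF y _ q, of "upper_block \<theta>" "lower_block \<theta>"]
    by (auto simp: param_space_def feature_inner)
qed

lemma abs_feature_inner_le:
  assumes "\<theta> \<in> param_space B"
  shows "\<bar>z \<bullet> \<theta>\<bar> \<le> B * norm z"
proof -
  have "\<bar>z \<bullet> \<theta>\<bar> \<le> norm z * norm \<theta>" by (rule Cauchy_Schwarz_ineq2)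
  also have "\<dots> \<le> norm z * B" using assms by (intro mult_left_mono) (auto simp: param_space_def)
  finally show ?thesis by (simp add: mult.commute)
qed

lemma Lipschitz_of_deriv_le:
  fixes g :: "real \<Rightarrow> real"
  assumes diff: "\<And>v. g differentiable (at v)" and "\<And>v. \<bar>v\<bar> \<le> R \<Longrightarrow> 0 \<le> deriv g v \<and> deriv g v \<le> K"
    and "\<bar>a\<bar> \<le> R" "\<bar>b\<bar> \<le> R"
  shows "\<bar>g a - g b\<bar> \<le> K * \<bar>a - b\<bar>"
proof -
  have *: "\<bar>g a - g b\<bar> \<le> K * \<bar>a - b\<bar>" if "a < b" "\<bar>a\<bar> \<le> R" "\<bar>b\<bar> \<le> R" for a b
  proof -
    obtain c where c: "a < c" "c < b" "g b - g a = (b - a) * deriv g c"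
      using MVT2[OF \<open>a < b\<close>, of g "deriv g"] diff by (auto simp: DERIV_deriv_iff_real_differentiable)
    then have "\<bar>c\<bar> \<le> R" using that by auto
    then have "\<bar>deriv g c\<bar> \<le> K" using assms(2)[of c] by simp
    then have "\<bar>deriv g c\<bar> * \<bar>b - a\<bar> \<le> K * \<bar>b - a\<bar>" by (rule mult_right_mono) simp
    moreover have "\<bar>g b - g a\<bar> = \<bar>deriv g c\<bar> * \<bar>b - a\<bar>" by (simp add: c(3) abs_mult)
    ultimately show ?thesis by (simp add: abs_minus_commute)
  qed
  consider "a < b" | "b < a" | "a = b" by linarith
  then show ?thesis
    using *[of a b] *[of b a] assms(3,4) by cases (auto simp: abs_minus_commute)
qed

lemma opt_revenue_eq_max:
  assumes "is_arg_max (\<lambda>q. revenue g q a b) (\<lambda>q. q \<in> {pl..pu}) q"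
  shows "opt_revenue g pl pu a b = revenue g q a b"
  unfolding opt_revenue_def using assms
  by (intro cSup_eq_maximum) (auto simp: is_arg_max_def not_less)

text \<open>All that remains of probability is the hypothesis \<open>good\<close>, asked for
  \<open>t < T\<close> because round \<open>t\<close> uses the estimator from \<open>t - 1\<close>
  rounds. The constant 4 is 2 * 2: two confidence radii separate the optimistic from the true
  parameter, and the potential bound in dimension 2d yields twice a square root.\<close>

lemma ucb_run_regret_le:
  fixes g :: "real \<Rightarrow> real" and X :: "(real ^ 'd::finite) set" and x :: "nat \<Rightarrow> real ^ 'd"
    and p D :: "nat \<Rightarrow> real" and \<theta>hat \<theta>opt :: "nat \<Rightarrow> real ^ ('d + 'd)"
  defines "z \<equiv> \<lambda>s. feature (x s) (p s)"
  assumes T: "1 \<le> T" and prices: "0 \<le> pl" "pl \<le> pu"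
    and B_pos: "0 < B" and true_param: "vstack \<alpha> \<beta> \<in> param_space B"
    and feature_bound: "\<And>y q. y \<in> X \<Longrightarrow> q \<in> {pl..pu} \<Longrightarrow> norm (feature y q) \<le> 1"
    and g_mono: "strict_mono g" and g_diff: "\<And>v. g differentiable (at v)" and glow: "0 < glow"
    and deriv_bounds: "\<And>y a b q. y \<in> X \<Longrightarrow> vstack a b \<in> param_space B \<Longrightarrow> q \<in> {pl..pu} \<Longrightarrow>
          glow \<le> deriv g (y \<bullet> a + (y \<bullet> b) * q) \<and> deriv g (y \<bullet> a + (y \<bullet> b) * q) \<le> gup"
    and covariates: "\<And>t. t \<in> {1..T} \<Longrightarrow> x t \<in> X" and sig: "0 \<le> sig"
    and run: "ucb_pricing_run g pl pu glow B sig 1 T x p D \<theta>hat \<theta>opt"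
    and good: "\<And>t. t < T \<Longrightarrow> leverage z t (\<Sum>s=1..t. (D s - g (z s \<bullet> vstack \<alpha> \<beta>)) *\<^sub>R z s)
      \<le> sig\<^sup>2 * (2 * ln (real T) + ln (det (design_matrix 1 z t)))"
  shows "(\<Sum>t=1..T. opt_revenue g pl pu (x t \<bullet> \<alpha>) (x t \<bullet> \<beta>) - revenue g (p t) (x t \<bullet> \<alpha>) (x t \<bullet> \<beta>))
    \<le> 4 * gup * pu * gamma_bar B sig glow CARD('d) T *
       sqrt (real T * real CARD('d) * ln ((2 * real CARD('d) + real T) / (2 * real CARD('d))))"
proof -
  let ?\<theta> = "vstack \<alpha> \<beta>" and ?d = "CARD('d)"
  define \<gamma> where "\<gamma> = gamma_bar B sig glow ?d T"
  define L where "L = ln ((2 * real ?d + real T) / (2 * real ?d))"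
  have radius: "conf_radius 1 B sig glow ?d T = \<gamma>"
    by (simp add: conf_radius_def \<gamma>_def gamma_bar_def)
  have hat: "is_arg_max (penalized_loglik g glow 1 z D (t - 1)) (\<lambda>\<theta>. \<theta> \<in> param_space B) (\<theta>hat (t - 1))"
    and opt: "is_arg_max (\<lambda>\<theta>. opt_revenue g pl pu (x t \<bullet> upper_block \<theta>) (x t \<bullet> lower_block \<theta>))
          (\<lambda>\<theta>. \<theta> \<in> conf_set 1 B sig glow T z t (\<theta>hat (t - 1))) (\<theta>opt t)"
    and price: "is_arg_max (\<lambda>q. revenue g q (x t \<bullet> upper_block (\<theta>opt t)) (x t \<bullet> lower_block (\<theta>opt t)))
          (\<lambda>q. q \<in> {pl..pu}) (p t)" if "t \<in> {1..T}" for t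
    using run that unfolding ucb_pricing_run_def Let_def z_def by blast+
  have p: "p t \<in> {pl..pu}" if "t \<in> {1..T}" for t
    using price[OF that] by (simp add: is_arg_max_def)
  have z1: "norm (z t) \<le> 1" if "t \<in> {1..T}" for t
    unfolding z_def using that by (intro feature_bound covariates p)
  have dI: "glow \<le> deriv g v" "deriv g v \<le> gup" if "t \<in> {1..T}" "\<bar>v\<bar> \<le> B * norm (z t)" for t v
    using deriv_bounds_interval[of X B pl pu glow g gup, OF deriv_bounds covariates p] that B_pos
    by (auto simp: z_def)
  have gup: "0 \<le> gup"
    using dI[of 1 0] T glow B_pos by simp
  have conf: "?\<theta> \<in> conf_set 1 B sig glow T z t (\<theta>hat (t - 1))" if t: "t \<in> {1..T}" for t
  proof -
    have hatB: "\<theta>hat (t - 1) \<in> param_space B" using hat[OF t] by (simp add: is_arg_max_def)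
    have "weighted_norm (design_matrix 1 z (t - 1)) (?\<theta> - \<theta>hat (t - 1))
        \<le> 2 * B + 2 / glow * sqrt (leverage z (t - 1) (\<Sum>s=1..t - 1. (D s - g (z s \<bullet> ?\<theta>)) *\<^sub>R z s))"
    proof (rule estimator_error[OF glow])
      show "norm ?\<theta> \<le> B" using true_param by (simp add: param_space_def)
      show "penalized_loglik g glow 1 z D (t - 1) ?\<theta> \<le> penalized_loglik g glow 1 z D (t - 1) (\<theta>hat (t - 1))"
        using hat[OF t] true_param by (auto simp: is_arg_max_def not_less)
      fix s assume "s \<in> {1..t - 1}"
      then have s: "s \<in> {1..T}" using t by auto
      show "quasi_loglik g (z s) (D s) (\<theta>hat (t - 1)) - quasi_loglik g (z s) (D s) ?\<theta>
          \<le> (D s - g (z s \<bullet> ?\<theta>)) * (z s \<bullet> (\<theta>hat (t - 1) - ?\<theta>)) - glow / 2 * (z s \<bullet> (\<theta>hat (t - 1) - ?\<theta>))\<^sup>2"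
        using dI[OF s]
        by (intro quasi_loglik_gap[where R = "B * norm (z s)"] g_mono g_diff glow abs_feature_inner_le
            true_param hatB)
    qed
    also have "leverage z (t - 1) (\<Sum>s=1..t - 1. (D s - g (z s \<bullet> ?\<theta>)) *\<^sub>R z s)
        \<le> sig\<^sup>2 * (2 * ln (real T) + 2 * real ?d * L)"
    proof -
      have "t - 1 < T" using t by auto
      have "ln (det (design_matrix 1 z (t - 1))) \<le> CARD('d + 'd) * ln ((CARD('d + 'd) + real (t - 1)) / CARD('d + 'd))"
        using z1 t by (intro ln_det_design_matrix_le) auto
      \<comment> \<open>The radius is the same in every round, so the bound for \<open>t - 1\<close>
        rounds is enlarged to the horizon.\<close>
      also have "\<dots> \<le> CARD('d + 'd) * ln ((CARD('d + 'd) + real T) / CARD('d + 'd))"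
        using t by (intro mult_left_mono ln_mono divide_right_mono) (auto intro!: divide_pos_pos add_pos_nonneg)
      also have "\<dots> = 2 * real ?d * L" by (simp add: L_def)
      finally show ?thesis
        using good[OF \<open>t - 1 < T\<close>] mult_left_mono[of _ _ "sig\<^sup>2"] by (meson add_left_mono order_trans zero_le_power2)
    qed
    then have "sqrt (leverage z (t - 1) (\<Sum>s=1..t - 1. (D s - g (z s \<bullet> ?\<theta>)) *\<^sub>R z s))
        \<le> sig * sqrt (2 * ln (real T) + 2 * real ?d * L)"
      using sig real_sqrt_le_mono by (fastforce simp: real_sqrt_mult)
    then have "2 * B + 2 / glow * sqrt (leverage z (t - 1) (\<Sum>s=1..t - 1. (D s - g (z s \<bullet> ?\<theta>)) *\<^sub>R z s)) \<le> \<gamma>"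
      using glow by (simp add: \<gamma>_def gamma_bar_def L_def field_simps)
    finally show ?thesis
      using true_param by (simp add: conf_set_def radius)
  qed
  have round: "opt_revenue g pl pu (x t \<bullet> \<alpha>) (x t \<bullet> \<beta>) - revenue g (p t) (x t \<bullet> \<alpha>) (x t \<bullet> \<beta>)
      \<le> 2 * gup * pu * \<gamma> * sqrt (leverage z (t - 1) (z t))" if t: "t \<in> {1..T}" for t
  proof -
    let ?A = "design_matrix 1 z (t - 1)" and ?s = "sqrt (leverage z (t - 1) (z t))"
    have optC: "\<theta>opt t \<in> conf_set 1 B sig glow T z t (\<theta>hat (t - 1))"
      using opt[OF t] by (simp add: is_arg_max_def)
    have "opt_revenue g pl pu (x t \<bullet> \<alpha>) (x t \<bullet> \<beta>)
        \<le> opt_revenue g pl pu (x t \<bullet> upper_block (\<theta>opt t)) (x t \<bullet> lower_block (\<theta>opt t))"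
      using opt[OF t] conf[OF t] by (auto simp: is_arg_max_def not_less)
    also have "\<dots> = p t * g (z t \<bullet> \<theta>opt t)"
      using opt_revenue_eq_max[OF price[OF t]] by (simp add: revenue_def z_def feature_inner)
    finally have "opt_revenue g pl pu (x t \<bullet> \<alpha>) (x t \<bullet> \<beta>) - revenue g (p t) (x t \<bullet> \<alpha>) (x t \<bullet> \<beta>)
        \<le> p t * (g (z t \<bullet> \<theta>opt t) - g (z t \<bullet> ?\<theta>))"
      by (simp add: revenue_def z_def feature_inner algebra_simps)
    also have "\<dots> \<le> p t * (gup * \<bar>z t \<bullet> \<theta>opt t - z t \<bullet> ?\<theta>\<bar>)"
    proof -
      have "\<bar>g (z t \<bullet> \<theta>opt t) - g (z t \<bullet> ?\<theta>)\<bar> \<le> gup * \<bar>z t \<bullet> \<theta>opt t - z t \<bullet> ?\<theta>\<bar>"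
        using dI[OF t] glow optC true_param
        by (intro Lipschitz_of_deriv_le[where R = "B * norm (z t)"] g_diff abs_feature_inner_le)
          (auto simp: conf_set_def intro: order_trans less_imp_le)
      then show ?thesis using p[OF t] prices by (intro mult_left_mono) auto
    qed
    also have "\<dots> \<le> pu * (gup * (?s * \<gamma> + ?s * \<gamma>))"
    proof -
      have s0: "0 \<le> ?s" using leverage_nonneg by simp
      have near: "\<bar>z t \<bullet> (\<theta> - \<theta>hat (t - 1))\<bar> \<le> ?s * \<gamma>"
        if "\<theta> \<in> conf_set 1 B sig glow T z t (\<theta>hat (t - 1))" for \<theta>
      proof -
        have "\<bar>z t \<bullet> (\<theta> - \<theta>hat (t - 1))\<bar> \<le> ?s * weighted_norm ?A (\<theta> - \<theta>hat (t - 1))"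
          by (rule design_Cauchy_Schwarz)
        also have "\<dots> \<le> ?s * \<gamma>"
          using that s0 by (intro mult_left_mono) (auto simp: conf_set_def radius)
        finally show ?thesis .
      qed
      \<comment> \<open>Both parameters are compared through the centre of the confidence
        set.\<close>
      have "z t \<bullet> \<theta>opt t - z t \<bullet> ?\<theta> = z t \<bullet> (\<theta>opt t - \<theta>hat (t - 1)) - z t \<bullet> (?\<theta> - \<theta>hat (t - 1))"
        by (simp add: inner_diff_right)
      then have "\<bar>z t \<bullet> \<theta>opt t - z t \<bullet> ?\<theta>\<bar> \<le> ?s * \<gamma> + ?s * \<gamma>"
        using near[OF optC] near[OF conf[OF t]] by linarith
      then show ?thesis using p[OF t] prices gup by (intro mult_mono mult_left_mono) auto
    qed
    finally show ?thesis by (simp add: algebra_simps)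
  qed
  \<comment> \<open>The radius dominates a weighted norm in round 1.\<close>
  have \<gamma>0: "0 \<le> \<gamma>"
  proof -
    have "0 \<le> weighted_norm (design_matrix 1 z 0) (?\<theta> - \<theta>hat 0)"
      unfolding weighted_norm_def by (intro real_sqrt_ge_zero design_matrix_psd) simp
    also have "\<dots> \<le> \<gamma>" using conf[of 1] T by (simp add: conf_set_def radius)
    finally show ?thesis .
  qed
  have "(\<Sum>t=1..T. opt_revenue g pl pu (x t \<bullet> \<alpha>) (x t \<bullet> \<beta>) - revenue g (p t) (x t \<bullet> \<alpha>) (x t \<bullet> \<beta>))
      \<le> (\<Sum>t=1..T. 2 * gup * pu * \<gamma> * sqrt (leverage z (t - 1) (z t)))"
    using round by (rule sum_mono)
  also have "\<dots> = 2 * gup * pu * \<gamma> * (\<Sum>t=1..T. sqrt (leverage z (t - 1) (z t)))"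
    by (simp add: sum_distrib_left)
  also have "\<dots> \<le> 2 * gup * pu * \<gamma> * sqrt (T * (2 * CARD('d + 'd) * ln ((CARD('d + 'd) + real T) / CARD('d + 'd))))"
    using gup prices \<gamma>0 z1 by (intro mult_left_mono elliptical_potential) auto
  also have "T * (2 * CARD('d + 'd) * ln ((CARD('d + 'd) + real T) / CARD('d + 'd))) = 2\<^sup>2 * (real T * real ?d * L)"
    by (simp add: L_def)
  also have "sqrt (2\<^sup>2 * (real T * real ?d * L)) = 2 * sqrt (real T * real ?d * L)"
    by (simp only: real_sqrt_mult real_sqrt_abs)
  finally show ?thesis by (simp add: \<gamma>_def L_def)
qed

section \<open>Expected regret over all trajectories\<close>

theorem theorem1:
  fixes M :: "'w measure" and N :: "'u measure" and U :: "'w \<Rightarrow> 'u"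
    and g :: "real \<Rightarrow> real"
    and X :: "(real ^ 'd::finite) set" and x :: "nat \<Rightarrow> real ^ 'd"
    and \<alpha> \<beta> :: "real ^ 'd"
    and pl pu B Dbar glow gup sig :: real and T :: nat
    and p D \<epsilon> :: "nat \<Rightarrow> 'w \<Rightarrow> real"
    and \<theta>hat \<theta>opt :: "nat \<Rightarrow> 'w \<Rightarrow> real ^ ('d + 'd)"
  assumes horizon: "1 \<le> T"
    and prices: "0 \<le> pl" "pl \<le> pu"
    and prob: "prob_space M"
    and B_pos: "0 < B" and true_param: "vstack \<alpha> \<beta> \<in> param_space B"
    and demand_bounds: "\<And>y q. y \<in> X \<Longrightarrow> q \<in> {pl..pu} \<Longrightarrow>
          0 \<le> g (y \<bullet> \<alpha> + (y \<bullet> \<beta>) * q) \<and> g (y \<bullet> \<alpha> + (y \<bullet> \<beta>) * q) \<le> Dbar"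
    and feature_bound: "\<And>y q. y \<in> X \<Longrightarrow> q \<in> {pl..pu} \<Longrightarrow> norm (feature y q) \<le> 1"
    and g_mono: "strict_mono g" and g_diff: "\<And>v. g differentiable (at v)"
    and glow_pos: "0 < glow"
    and deriv_bounds: "\<And>y a b q. y \<in> X \<Longrightarrow> vstack a b \<in> param_space B \<Longrightarrow> q \<in> {pl..pu} \<Longrightarrow>
          glow \<le> deriv g (y \<bullet> a + (y \<bullet> b) * q) \<and> deriv g (y \<bullet> a + (y \<bullet> b) * q) \<le> gup"
    and covariates: "\<And>t. t \<in> {1..T} \<Longrightarrow> x t \<in> X"
    and demand: "\<And>t \<omega>. t \<in> {1..T} \<Longrightarrow> \<omega> \<in> space M \<Longrightarrow>
          D t \<omega> = g (x t \<bullet> \<alpha> + (x t \<bullet> \<beta>) * p t \<omega>) + \<epsilon> t \<omega>"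
    (* demand shocks; integrability makes the conditional expectations meaningful *)
    and sig_nonneg: "0 \<le> sig"
    and shock_integrable: "\<And>t. t \<in> {1..T} \<Longrightarrow> integrable M (\<epsilon> t)"
    and shock_mean: "\<And>t. t \<in> {1..T} \<Longrightarrow>
          AE \<omega> in M. real_cond_exp M (history_algebra (space M) x p \<epsilon> (t - 1)) (\<epsilon> t) \<omega> = 0"
    and shock_exp_integrable: "\<And>t s. t \<in> {1..T} \<Longrightarrow> integrable M (\<lambda>\<omega>. exp (s * \<epsilon> t \<omega>))"
    and shock_subgaussian: "\<And>t s. t \<in> {1..T} \<Longrightarrow>
          AE \<omega> in M. ln (real_cond_exp M (history_algebra (space M) x p \<epsilon> (t - 1))
                           (\<lambda>\<omega>'. exp (s * \<epsilon> t \<omega>')) \<omega>) \<le> sig\<^sup>2 * s\<^sup>2 / 2"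
    (* non-anticipating policy whose randomization U is independent of the shocks *)
    and seed_measurable: "U \<in> M \<rightarrow>\<^sub>M N"
    and seed_indep: "prob_space.indep_set M (preimages (space M) U N)
          (preimages (space M) (\<lambda>\<omega>. \<lambda>t\<in>{1..T}. \<epsilon> t \<omega>) (Pi\<^sub>M {1..T} (\<lambda>_. borel)))"
    and non_anticipating: "\<And>t. t \<in> {1..T} \<Longrightarrow>
          p t \<in> borel_measurable (policy_algebra (space M) U N x p D t)"
    and ucb: "\<And>\<omega>. \<omega> \<in> space M \<Longrightarrow>
          ucb_pricing_run g pl pu glow B sig 1 T x (\<lambda>t. p t \<omega>) (\<lambda>t. D t \<omega>)
            (\<lambda>t. \<theta>hat t \<omega>) (\<lambda>t. \<theta>opt t \<omega>)"
  shows "regret M g pl pu \<alpha> \<beta> T x p D \<le> regret_bound gup glow pu Dbar B sig CARD('d) T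
    \<and> (\<exists>k::nat. (\<lambda>(d, n). regret_bound gup glow pu Dbar B sig d n)
          \<in> O[principal {1..} \<times>\<^sub>F at_top](\<lambda>(d, n). real d * sqrt (real n) * ln (real n) ^ k))"
proof
  interpret prob_space M by (rule prob)
  let ?\<theta> = "vstack \<alpha> \<beta>" and ?E = "\<lambda>\<omega>. \<lambda>t\<in>{1..T}. \<epsilon> t \<omega>"
  define F where "F = seeded_past (space M) U N \<epsilon>"
  define z where "z t \<omega> = feature (x t) (p t \<omega>)" for t \<omega>
  define \<rho> where "\<rho> t \<omega> = revenue g (p t \<omega>) (x t \<bullet> \<alpha>) (x t \<bullet> \<beta>)" for t \<omega>
  have UM: "U \<in> space M \<rightarrow> space N" using measurable_space[OF seed_measurable] by auto
  have \<epsilon>M: "\<epsilon> t \<in> borel_measurable M" if "t \<in> {1..T}" for t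
    using shock_integrable[OF that] by simp
  have g_meas [measurable]: "g \<in> borel_measurable borel"
    using g_diff by (intro borel_measurable_continuous_onI)
      (simp add: continuous_at_imp_continuous_on differentiable_imp_continuous_within)
  have subF: "subalgebra M (F t)" if "t \<le> T" for t
    unfolding F_def using that \<epsilon>M seed_measurable by (intro subalgebra_seeded_past) auto
  have pF: "p (Suc t) \<in> borel_measurable (F t)" if "t < T" for t
    unfolding F_def
  proof (rule policy_measurable_seeded_past[OF UM, where x = x and D = D and T = T and f = "\<lambda>t q. g (x t \<bullet> \<alpha> + (x t \<bullet> \<beta>) * q)"])
    show "(\<lambda>q. g (x t \<bullet> \<alpha> + (x t \<bullet> \<beta>) * q)) \<in> borel_measurable borel" for t by measurable
    show "D t \<omega> = g (x t \<bullet> \<alpha> + (x t \<bullet> \<beta>) * p t \<omega>) + \<epsilon> t \<omega>"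
      if "t \<in> {1..T}" "\<omega> \<in> space M" for t \<omega>
      using that by (rule demand)
    show "p t \<in> borel_measurable (policy_algebra (space M) U N x p D t)" if "t \<in> {1..T}" for t
      using that by (rule non_anticipating)
  qed (rule that)
  have pM: "p t \<in> borel_measurable M" if "t \<in> {1..T}" for t
    using that measurable_from_subalg[OF subF pF, of "t - 1"] by (cases t) auto
  have range: "p t \<omega> \<in> {pl..pu}" if "t \<in> {1..T}" "\<omega> \<in> space M" for t \<omega>
    using ucb[OF that(2)] that(1) unfolding ucb_pricing_run_def Let_def is_arg_max_def by blast
  \<comment> \<open>The filtration must make the next price measurable, and that price may depend on
    the seed; so the hypothesis on the shocks is moved from the history to the seeded past.\<close>
  have subg: "cond_subgaussian M (F t) sig (\<epsilon> (Suc t))" if t: "t < T" for t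
    unfolding F_def
  proof (rule cond_subgaussian_seeded_past[OF prob seed_measurable seed_indep _ t])
    let ?H = "history_algebra (space M) x p \<epsilon> t"
    show "\<epsilon> s \<in> borel_measurable M" if "s \<in> {1..T}" for s
      using \<epsilon>M[OF that] .
    show "subalgebra M ?H"
      using pM \<epsilon>M t by (intro history_algebra_subalgebra) auto
    show "\<epsilon> s \<in> borel_measurable ?H" if "s \<in> {1..t}" for s
      using pM \<epsilon>M t that by (intro history_algebra_subalgebra) auto
    show "integrable M (\<lambda>\<omega>. exp (s * \<epsilon> (Suc t) \<omega>))" for s
      using t by (intro shock_exp_integrable) auto
    show "AE \<omega> in M. ln (real_cond_exp M ?H (\<lambda>\<omega>'. exp (s * \<epsilon> (Suc t) \<omega>')) \<omega>) \<le> sig\<^sup>2 * s\<^sup>2 / 2" for s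
      using shock_subgaussian[of "Suc t" s] t by simp
  qed
  obtain E where E: "E \<in> sets M" "ennreal (real T) * emeasure M (space M - E) \<le> 1"
    and good: "\<And>\<omega> t. \<omega> \<in> E \<Longrightarrow> t \<le> T \<Longrightarrow> leverage (\<lambda>s. z s \<omega>) t (\<Sum>s=1..t. \<epsilon> s \<omega> *\<^sub>R z s \<omega>)
      \<le> sig\<^sup>2 * (2 * ln (real T) + ln (det (design_matrix 1 (\<lambda>s. z s \<omega>) t)))"
  proof -
    have "\<exists>E\<in>sets M. ennreal (real T) * emeasure M (space M - E) \<le> 1 \<and>
      (\<forall>\<omega>\<in>E. \<forall>t\<le>T. leverage (\<lambda>s. z s \<omega>) t (\<Sum>s=1..t. \<epsilon> s \<omega> *\<^sub>R z s \<omega>)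
        \<le> sig\<^sup>2 * (2 * ln (real T) + ln (det (design_matrix 1 (\<lambda>s. z s \<omega>) t))))"
    proof (rule self_normalized_bound[where F = F])
      show "subalgebra (F t) (F s)" if "s \<le> t" for s t
        unfolding F_def using UM that by (rule seeded_past_mono)
      show "\<epsilon> (Suc t) \<in> borel_measurable (F (Suc t))" for t
        unfolding F_def using UM by (rule seeded_past_components) simp
      show "(\<lambda>\<omega>. z (Suc t) \<omega> $ i) \<in> borel_measurable (F t)" if "t < T" for t i
        using pF[OF that] by (cases i) (auto simp: z_def feature_nth)
    qed (use prob subF subg sig_nonneg horizon in auto)
    with that show thesis by blast
  qed
  define V where "V = (\<Sum>t=1..T. opt_revenue g pl pu (x t \<bullet> \<alpha>) (x t \<bullet> \<beta>))"
  define R where "R \<omega> = (\<Sum>t=1..T. \<rho> t \<omega>)" for \<omega>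
  define C where "C = 4 * gup * pu * gamma_bar B sig glow CARD('d) T *
       sqrt (real T * real CARD('d) * ln ((2 * real CARD('d) + real T) / (2 * real CARD('d))))"
  have rev: "0 \<le> revenue g q (x t \<bullet> \<alpha>) (x t \<bullet> \<beta>)" "revenue g q (x t \<bullet> \<alpha>) (x t \<bullet> \<beta>) \<le> pu * Dbar"
    if "t \<in> {1..T}" "q \<in> {pl..pu}" for t q
    using demand_bounds[OF covariates[OF that(1)] that(2)] that(2) prices
    by (auto simp: revenue_def intro!: mult_mono)
  have worst: "V - R \<omega> \<le> real T * (pu * Dbar)" if "\<omega> \<in> space M" for \<omega>
  proof -
    have "V - R \<omega> = (\<Sum>t=1..T. opt_revenue g pl pu (x t \<bullet> \<alpha>) (x t \<bullet> \<beta>) - \<rho> t \<omega>)"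
      by (simp add: V_def R_def sum_subtractf)
    also have "\<dots> \<le> (\<Sum>t=1..T. pu * Dbar)"
    proof (rule sum_mono)
      fix t assume t: "t \<in> {1..T}"
      have "opt_revenue g pl pu (x t \<bullet> \<alpha>) (x t \<bullet> \<beta>) \<le> pu * Dbar"
        unfolding opt_revenue_def using rev[OF t] prices by (intro cSUP_least) auto
      then show "opt_revenue g pl pu (x t \<bullet> \<alpha>) (x t \<bullet> \<beta>) - \<rho> t \<omega> \<le> pu * Dbar"
        using rev(1)[OF t range[OF t that]] by (simp add: \<rho>_def)
    qed
    finally show ?thesis by simp
  qed
  have typical: "V - R \<omega> \<le> C" if \<omega>: "\<omega> \<in> E" for \<omega>
  proof -
    have \<omega>M: "\<omega> \<in> space M" using \<omega> E(1) sets.sets_into_space by blast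
    have "V - R \<omega> = (\<Sum>t=1..T. opt_revenue g pl pu (x t \<bullet> \<alpha>) (x t \<bullet> \<beta>) - \<rho> t \<omega>)"
      by (simp add: V_def R_def sum_subtractf)
    also have "\<dots> \<le> C"
      unfolding C_def \<rho>_def
    proof (rule ucb_run_regret_le[OF horizon prices B_pos true_param feature_bound g_mono g_diff
          glow_pos deriv_bounds covariates sig_nonneg ucb[OF \<omega>M]])
      fix t assume t: "t < T"
      have "(\<Sum>s=1..t. (D s \<omega> - g (feature (x s) (p s \<omega>) \<bullet> ?\<theta>)) *\<^sub>R feature (x s) (p s \<omega>))
          = (\<Sum>s=1..t. \<epsilon> s \<omega> *\<^sub>R z s \<omega>)"
        using t by (intro sum.cong refl) (simp add: z_def demand \<omega>M feature_inner)
      with good[OF \<omega>, of t] t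
      show "leverage (\<lambda>s. feature (x s) (p s \<omega>)) t
          (\<Sum>s=1..t. (D s \<omega> - g (feature (x s) (p s \<omega>) \<bullet> ?\<theta>)) *\<^sub>R feature (x s) (p s \<omega>))
        \<le> sig\<^sup>2 * (2 * ln (real T) + ln (det (design_matrix 1 (\<lambda>s. feature (x s) (p s \<omega>)) t)))"
        by (simp add: z_def)
    qed
    finally show ?thesis .
  qed
  have \<rho>int: "integrable M (\<rho> t)" if t: "t \<in> {1..T}" for t
  proof (rule integrable_const_bound[where B = "pu * Dbar"])
    show "AE \<omega> in M. norm (\<rho> t \<omega>) \<le> pu * Dbar"
      using rev[OF t range[OF t]] by (intro AE_I2) (simp add: \<rho>_def)
    have [measurable]: "p t \<in> borel_measurable M" using pM[OF t] .
    show "\<rho> t \<in> borel_measurable M" unfolding \<rho>_def revenue_def by measurable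
  qed
  have p\<epsilon>: "integrable M (\<lambda>\<omega>. p t \<omega> * \<epsilon> t \<omega>)" "(\<integral>\<omega>. p t \<omega> * \<epsilon> t \<omega> \<partial>M) = 0" if t: "t \<in> {1..T}" for t
  proof -
    obtain r where r: "t = Suc r" "r < T" using t by (cases t) auto
    show "(\<integral>\<omega>. p t \<omega> * \<epsilon> t \<omega> \<partial>M) = 0"
      unfolding r(1) using range[of "Suc r"] prices r
      by (intro cond_subgaussian_uncorrelated[OF prob subg[OF r(2)] shock_integrable pF[OF r(2)], where C = pu])
        (auto intro: order_trans)
    show "integrable M (\<lambda>\<omega>. p t \<omega> * \<epsilon> t \<omega>)"
    proof (rule Bochner_Integration.integrable_bound[OF integrable_mult_right[OF shock_integrable[OF t], of pu]])
      have "\<bar>p t \<omega>\<bar> \<le> \<bar>pu\<bar>" if "\<omega> \<in> space M" for \<omega>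
        using range[OF t that] prices by auto
      then show "AE \<omega> in M. norm (p t \<omega> * \<epsilon> t \<omega>) \<le> norm (pu * \<epsilon> t \<omega>)"
        by (intro AE_I2) (simp add: abs_mult mult_right_mono)
      show "(\<lambda>\<omega>. p t \<omega> * \<epsilon> t \<omega>) \<in> borel_measurable M"
        using pM[OF t] \<epsilon>M[OF t] by measurable
    qed
  qed
  have ind: "integrable M (indicat_real (space M - E))"
    using E(1) by (intro integrable_real_indicator) (auto simp: less_top[symmetric])
  have Rint: "integrable M R" unfolding R_def[abs_def] using \<rho>int by (intro Bochner_Integration.integrable_sum)
  have "(\<integral>\<omega>. (\<Sum>t=1..T. p t \<omega> * D t \<omega>) \<partial>M) = (\<integral>\<omega>. (\<Sum>t=1..T. \<rho> t \<omega> + p t \<omega> * \<epsilon> t \<omega>) \<partial>M)"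
    by (intro Bochner_Integration.integral_cong sum.cong refl)
      (simp add: demand \<rho>_def revenue_def algebra_simps)
  also have "\<dots> = (\<Sum>t=1..T. (\<integral>\<omega>. \<rho> t \<omega> \<partial>M) + (\<integral>\<omega>. p t \<omega> * \<epsilon> t \<omega> \<partial>M))"
    using \<rho>int p\<epsilon>(1) by (subst Bochner_Integration.integral_sum) auto
  also have "\<dots> = (\<Sum>t=1..T. (\<integral>\<omega>. \<rho> t \<omega> \<partial>M))"
    using p\<epsilon>(2) by (intro sum.cong) auto
  also have "\<dots> = (\<integral>\<omega>. R \<omega> \<partial>M)"
    unfolding R_def using \<rho>int by (intro Bochner_Integration.integral_sum[symmetric])
  finally have "regret M g pl pu \<alpha> \<beta> T x p D = V - (\<integral>\<omega>. R \<omega> \<partial>M)"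
    by (simp add: regret_def V_def)
  also have "\<dots> = (\<integral>\<omega>. V - R \<omega> \<partial>M)"
    using Rint by (simp add: prob_space)
  also have "\<dots> \<le> (\<integral>\<omega>. C + real T * (pu * Dbar) * indicator (space M - E) \<omega> \<partial>M)"
  proof (rule integral_mono)
    \<comment> \<open>A witness at which both derivative bounds apply, so that they can be
      compared.\<close>
    have "x 1 \<in> X" "pl \<in> {pl..pu}" using covariates horizon prices by auto
    then have "glow \<le> gup"
      using deriv_bounds[OF _ true_param] by (meson order_trans)
    fix \<omega> assume \<omega>: "\<omega> \<in> space M"
    \<comment> \<open>Outside \<open>E\<close> the majorant is \<open>C\<close> plus the worst case,
      which dominates only if \<open>C\<close> is nonnegative.\<close>
    have C0: "0 \<le> C"
      unfolding C_def gamma_bar_def using \<open>glow \<le> gup\<close> glow_pos prices B_pos sig_nonneg horizon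
      by (intro mult_nonneg_nonneg add_nonneg_nonneg divide_nonneg_nonneg real_sqrt_ge_zero) auto
    show "V - R \<omega> \<le> C + real T * (pu * Dbar) * indicator (space M - E) \<omega>"
      using typical[of \<omega>] worst[OF \<omega>] C0 \<omega> by (cases "\<omega> \<in> E") auto
  next
    show "integrable M (\<lambda>\<omega>. C + real T * (pu * Dbar) * indicator (space M - E) \<omega>)"
      by (intro Bochner_Integration.integrable_add integrable_const integrable_mult_right ind)
    show "integrable M (\<lambda>\<omega>. V - R \<omega>)"
      using Rint by (intro Bochner_Integration.integrable_diff integrable_const)
  qed
  also have "\<dots> = C + real T * (pu * Dbar) * prob (space M - E)"
    using E(1) by (subst Bochner_Integration.integral_add[OF integrable_const integrable_mult_right[OF ind]])
      (simp add: prob_space)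
  also have "\<dots> \<le> C + pu * Dbar"
  proof -
    have "ennreal (real T * prob (space M - E)) \<le> ennreal 1"
      using E(2) by (simp add: emeasure_eq_measure ennreal_mult)
    then have "real T * prob (space M - E) \<le> 1" by (subst (asm) ennreal_le_iff) auto
    moreover have "0 \<le> pu * Dbar"
      using rev[of 1 pl] horizon prices by (auto intro: order_trans)
    ultimately have "real T * prob (space M - E) * (pu * Dbar) \<le> 1 * (pu * Dbar)"
      by (rule mult_right_mono)
    then show ?thesis by (simp add: mult_ac)
  qed
  finally show "regret M g pl pu \<alpha> \<beta> T x p D \<le> regret_bound gup glow pu Dbar B sig CARD('d) T"
    by (simp add: regret_bound_def C_def)
  show "\<exists>k::nat. (\<lambda>(d, n). regret_bound gup glow pu Dbar B sig d n)
          \<in> O[principal {1..} \<times>\<^sub>F at_top](\<lambda>(d, n). real d * sqrt (real n) * ln (real n) ^ k)"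
    using regret_bound_bigo by blast
qed

end
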